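(* For any $\mathbf d=(d_1,\dots,d_k)$ with $1\le d_1<\dots<d_k<n$, the variety $R_{\mathbf d}$ is smooth, and the natural map $R_{\mathbf d}\to\mathcal F^a_{\mathbf d}$ defined by forgetting the off-diagonal ($i\neq j$) subspaces $V_{i,j}$, i.e. $(V_{i,j})_{(i,j)\in P_{\mathbf d}}\mapsto(V_{d_l,d_l})_{l=1}^k$, is a desingularization (a birational isomorphism).
   Context: Ground field $\mathbb C$. $W$ is a vector space with basis $w_1,\dots,w_n$, and $pr_d(\sum c_iw_i)=\sum_{i\ne d}c_iw_i$. Degenerate partial flag variety: $\mathcal F^a_{\mathbf d}$ is the variety of $(V_{d_i})_{i=1}^k\in\prod_{i=1}^kGr(d_i,W)$ with $pr_{d_i+1}\,pr_{d_i+2}\cdots pr_{d_{i+1}}V_{d_i}\subset V_{d_{i+1}}$ for $i=1,\dots,k-1$. Let $P_{\mathbf d}=\{(i,j):1\le i\le j\le n-1,\ \exists\, l\text{ with } i\le d_l\le j\}$ (so $(i,i)\in P_{\mathbf d}$ iff $i\in\{d_1,\dots,d_k\}$). Let $W_{i,j}=\mathrm{span}(w_1,\dots,w_i,w_{j+1},\dots,w_n)$. $R_{\mathbf d}$ is the variety of collections $(V_{i,j})_{(i,j)\in P_{\mathbf d}}$ of subspaces of $W$ such that: $\dim V_{i,j}=i$; $V_{i,j}\subset W_{i,j}$; $pr_{j+1}V_{i,j}\subset V_{i,j+1}$ whenever $(i,j),(i,j+1)\in P_{\mathbf d}$; and $V_{i,j+1}\subset V_{i+1,j+1}$ whenever $(i,j+1),(i+1,j+1)\in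 P_{\mathbf d}$. *)

theory Defs
  imports "HOL-Analysis.Analysis"
begin

section \<open>Complex algebraic varieties, classically\<close>

text \<open>
  A variety is a subset \<open>X\<close> of an ambient space that is covered by affine spaces.
  The ambient space is given by an atlas: a set of pairs \<open>(I, \<psi>)\<close>, where \<open>\<psi>\<close> parametrizes a
  Zariski open piece of the ambient space by the affine space with coordinates indexed by the
  finite set \<open>I\<close>.  A subset carries the induced reduced structure.  The atlases used below (affine
  spaces, Grassmannians, and products of these) have injective charts and regular transition maps.
\<close>

type_synonym ('i, 'p) atlas = "('i set \<times> (('i \<Rightarrow> complex) \<Rightarrow> 'p)) set"

definition aff_space :: "'i set \<Rightarrow> ('i \<Rightarrow> complex) set" where
  "aff_space I = {x. \<forall>i. i \<notin> I \<longrightarrow> x i = 0}"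

text \<open>Since the field is infinite, polynomials are identified with polynomial functions.\<close>

inductive_set polyfuns :: "'i set \<Rightarrow> (('i \<Rightarrow> complex) \<Rightarrow> complex) set" for I :: "'i set" where
  const: "(\<lambda>_. c) \<in> polyfuns I"
| coord: "i \<in> I \<Longrightarrow> (\<lambda>x. x i) \<in> polyfuns I"
| add: "f \<in> polyfuns I \<Longrightarrow> g \<in> polyfuns I \<Longrightarrow> (\<lambda>x. f x + g x) \<in> polyfuns I"
| mult: "f \<in> polyfuns I \<Longrightarrow> g \<in> polyfuns I \<Longrightarrow> (\<lambda>x. f x * g x) \<in> polyfuns I"

definition pderiv_at :: "(('i \<Rightarrow> complex) \<Rightarrow> complex) \<Rightarrow> 'i \<Rightarrow> ('i \<Rightarrow> complex) \<Rightarrow> complex" where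
  "pderiv_at f i x = deriv (\<lambda>t. f (x(i := t))) (x i)"

definition atlas_points :: "('i, 'p) atlas \<Rightarrow> 'p set" where
  "atlas_points \<A> = (\<Union>(I, \<psi>)\<in>\<A>. \<psi> ` aff_space I)"

definition zariski_open :: "('i, 'p) atlas \<Rightarrow> 'p set \<Rightarrow> bool" where
  "zariski_open \<A> U \<longleftrightarrow> U \<subseteq> atlas_points \<A> \<and>
     (\<forall>(I, \<psi>)\<in>\<A>. \<exists>F\<subseteq>polyfuns I. \<forall>x\<in>aff_space I. \<psi> x \<in> U \<longleftrightarrow> (\<exists>f\<in>F. f x \<noteq> 0))"

lemma zariski_openD:
  assumes "zariski_open \<A> U" and "(I, \<psi>) \<in> \<A>"
  shows "\<exists>F. F \<subseteq> polyfuns I \<and> (\<forall>x\<in>aff_space I. \<psi> x \<in> U \<longleftrightarrow> (\<exists>f\<in>F. f x \<noteq> 0))"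
  using bspec[OF conjunct2[OF assms(1)[unfolded zariski_open_def]] assms(2)]
  unfolding prod.case .

lemma zariski_openI:
  assumes "U \<subseteq> atlas_points \<A>"
    and "\<And>I \<psi>. (I, \<psi>) \<in> \<A> \<Longrightarrow>
      \<exists>F\<subseteq>polyfuns I. \<forall>x\<in>aff_space I. \<psi> x \<in> U \<longleftrightarrow> (\<exists>f\<in>F. f x \<noteq> 0)"
  shows "zariski_open \<A> U"
  unfolding zariski_open_def by (rule conjI[OF assms(1)], clarify) (rule assms(2))

lemma istopology_zariski_open: "istopology (zariski_open \<A>)"
  unfolding istopology_def
proof (intro conjI allI impI)
  fix S T assume S: "zariski_open \<A> S" and T: "zariski_open \<A> T"
  show "zariski_open \<A> (S \<inter> T)"
  proof (rule zariski_openI)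
    show "S \<inter> T \<subseteq> atlas_points \<A>"
      using S unfolding zariski_open_def by blast
    fix I \<psi> assume I: "(I, \<psi>) \<in> \<A>"
    obtain F where F: "F \<subseteq> polyfuns I" "\<forall>x\<in>aff_space I. \<psi> x \<in> S \<longleftrightarrow> (\<exists>f\<in>F. f x \<noteq> 0)"
      using zariski_openD[OF S I] by (elim exE conjE)
    obtain G where G: "G \<subseteq> polyfuns I" "\<forall>x\<in>aff_space I. \<psi> x \<in> T \<longleftrightarrow> (\<exists>f\<in>G. f x \<noteq> 0)"
      using zariski_openD[OF T I] by (elim exE conjE)
    define H where "H = (\<lambda>(f, g) x. f x * g x) ` (F \<times> G)"
    have "H \<subseteq> polyfuns I"
      using F(1) G(1) by (auto simp: H_def intro!: polyfuns.mult)
    moreover have "\<psi> x \<in> S \<inter> T \<longleftrightarrow> (\<exists>f\<in>H. f x \<noteq> 0)" if "x \<in> aff_space I" for x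
      by (simp add: bspec[OF F(2) that] bspec[OF G(2) that] H_def Bex_def) iprover
    ultimately show "\<exists>H\<subseteq>polyfuns I. \<forall>x\<in>aff_space I. \<psi> x \<in> S \<inter> T \<longleftrightarrow> (\<exists>f\<in>H. f x \<noteq> 0)"
      by (intro exI[of _ H] conjI ballI)
  qed
next
  fix K assume K: "\<forall>S\<in>K. zariski_open \<A> S"
  show "zariski_open \<A> (\<Union>K)"
  proof (rule zariski_openI)
    show "\<Union>K \<subseteq> atlas_points \<A>"
      using K unfolding zariski_open_def by blast
    fix I \<psi> assume I: "(I, \<psi>) \<in> \<A>"
    define F where "F = {f \<in> polyfuns I. \<forall>x\<in>aff_space I. f x \<noteq> 0 \<longrightarrow> \<psi> x \<in> \<Union>K}"
    have "\<psi> x \<in> \<Union>K \<longleftrightarrow> (\<exists>f\<in>F. f x \<noteq> 0)" if x: "x \<in> aff_space I" for x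
    proof
      assume "\<psi> x \<in> \<Union>K"
      then obtain S where S: "S \<in> K" "\<psi> x \<in> S" by blast
      obtain G where G: "G \<subseteq> polyfuns I" "\<forall>x\<in>aff_space I. \<psi> x \<in> S \<longleftrightarrow> (\<exists>f\<in>G. f x \<noteq> 0)"
        using zariski_openD[OF bspec[OF K S(1)] I] by (elim exE conjE)
      obtain f where f: "f \<in> G" "f x \<noteq> 0"
        using S(2) unfolding bspec[OF G(2) x] by (rule bexE)
      have "f \<in> F"
        unfolding F_def
      proof (intro CollectI conjI ballI impI)
        show "f \<in> polyfuns I" using f(1) G(1) by (rule rev_subsetD)
        fix y assume "y \<in> aff_space I" "f y \<noteq> 0"
        then have "\<psi> y \<in> S" using bspec[OF G(2)] f(1) by (metis (no_types))
        then show "\<psi> y \<in> \<Union>K" using S(1) by (rule UnionI[rotated])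
      qed
      with f(2) show "\<exists>f\<in>F. f x \<noteq> 0" by (intro bexI[of _ f])
    next
      assume "\<exists>f\<in>F. f x \<noteq> 0"
      then obtain f where "f \<in> F" "f x \<noteq> 0" by (rule bexE)
      then show "\<psi> x \<in> \<Union>K" using x unfolding F_def by simp
    qed
    then show "\<exists>H\<subseteq>polyfuns I. \<forall>x\<in>aff_space I. \<psi> x \<in> \<Union>K \<longleftrightarrow> (\<exists>f\<in>H. f x \<noteq> 0)"
      by (intro exI[of _ F] conjI ballI) (simp_all add: F_def)
  qed
qed

definition zariski :: "('i, 'p) atlas \<Rightarrow> 'p topology" where
  "zariski \<A> = topology (zariski_open \<A>)"

lemma openin_zariski: "openin (zariski \<A>) = zariski_open \<A>"
  unfolding zariski_def by (rule topology_inverse'[OF istopology_zariski_open])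

text \<open>Regularity of a complex-valued function on a subset \<open>U\<close> with its induced structure.\<close>

definition regular_on :: "('i, 'p) atlas \<Rightarrow> 'p set \<Rightarrow> ('p \<Rightarrow> complex) \<Rightarrow> bool" where
  "regular_on \<A> U f \<longleftrightarrow>
     (\<forall>p\<in>U. \<exists>(I, \<psi>)\<in>\<A>. \<exists>x\<in>aff_space I. \<psi> x = p \<and>
        (\<exists>g\<in>polyfuns I. \<exists>h\<in>polyfuns I. h x \<noteq> 0 \<and>
           (\<forall>y\<in>aff_space I. \<psi> y \<in> U \<and> h y \<noteq> 0 \<longrightarrow> f (\<psi> y) = g y / h y)))"

definition var_morphism ::
  "('i, 'p) atlas \<Rightarrow> 'p set \<Rightarrow> ('j, 'q) atlas \<Rightarrow> 'q set \<Rightarrow> ('p \<Rightarrow> 'q) \<Rightarrow> bool" where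
  "var_morphism \<A> X \<B> Y f \<longleftrightarrow>
     continuous_map (subtopology (zariski \<A>) X) (subtopology (zariski \<B>) Y) f \<and>
     (\<forall>V \<phi>. openin (subtopology (zariski \<B>) Y) V \<and> regular_on \<B> V \<phi> \<longrightarrow>
        regular_on \<A> {p \<in> X. f p \<in> V} (\<phi> \<circ> f))"

definition var_isomorphism ::
  "('i, 'p) atlas \<Rightarrow> 'p set \<Rightarrow> ('j, 'q) atlas \<Rightarrow> 'q set \<Rightarrow> ('p \<Rightarrow> 'q) \<Rightarrow> bool" where
  "var_isomorphism \<A> X \<B> Y f \<longleftrightarrow> var_morphism \<A> X \<B> Y f \<and>
     (\<exists>g. var_morphism \<B> Y \<A> X g \<and> (\<forall>p\<in>X. g (f p) = p) \<and> (\<forall>q\<in>Y. f (g q) = q))"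

definition birational_morphism ::
  "('i, 'p) atlas \<Rightarrow> 'p set \<Rightarrow> ('j, 'q) atlas \<Rightarrow> 'q set \<Rightarrow> ('p \<Rightarrow> 'q) \<Rightarrow> bool" where
  "birational_morphism \<A> X \<B> Y f \<longleftrightarrow> var_morphism \<A> X \<B> Y f \<and>
     (\<exists>U V. openin (subtopology (zariski \<A>) X) U \<and> subtopology (zariski \<A>) X closure_of U = X \<and>
            openin (subtopology (zariski \<B>) Y) V \<and> subtopology (zariski \<B>) Y closure_of V = Y \<and>
            var_isomorphism \<A> U \<B> V f)"

text \<open>
  Smoothness at \<open>p\<close>: on a principal open neighbourhood \<open>h \<noteq> 0\<close> inside some affine chart, \<open>X\<close> is the
  zero set of \<open>f\<^sub>0, \<dots>, f\<^bsub>c-1\<^esub>\<close>, these generate the localized vanishing ideal of \<open>X\<close>, and the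
  Jacobian matrix of \<open>f\<^sub>0, \<dots>, f\<^bsub>c-1\<^esub>\<close> at the point has rank \<open>c\<close>; that is, the local
  coordinate ring of \<open>X\<close> is a standard smooth algebra.
\<close>

definition smooth_at :: "('i, 'p) atlas \<Rightarrow> 'p set \<Rightarrow> 'p \<Rightarrow> bool" where
  "smooth_at \<A> X p \<longleftrightarrow>
     (\<exists>(I, \<psi>)\<in>\<A>. \<exists>x\<in>aff_space I. \<psi> x = p \<and>
       (\<exists>h\<in>polyfuns I. \<exists>(c::nat) f. h x \<noteq> 0 \<and> (\<forall>k<c. f k \<in> polyfuns I) \<and>
          (\<forall>y\<in>aff_space I. h y \<noteq> 0 \<longrightarrow> (\<psi> y \<in> X \<longleftrightarrow> (\<forall>k<c. f k y = 0))) \<and>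
          (\<forall>g\<in>polyfuns I. (\<forall>y\<in>aff_space I. h y \<noteq> 0 \<and> \<psi> y \<in> X \<longrightarrow> g y = 0) \<longrightarrow>
             (\<exists>(m::nat) a. (\<forall>k<c. a k \<in> polyfuns I) \<and>
                (\<forall>y\<in>aff_space I. h y ^ m * g y = (\<Sum>k<c. a k y * f k y)))) \<and>
          (\<forall>b :: nat \<Rightarrow> complex. (\<forall>i\<in>I. (\<Sum>k<c. b k * pderiv_at (f k) i x) = 0) \<longrightarrow>
             (\<forall>k<c. b k = 0))))"

definition smooth_variety :: "('i, 'p) atlas \<Rightarrow> 'p set \<Rightarrow> bool" where
  "smooth_variety \<A> X \<longleftrightarrow> (\<forall>p\<in>X. smooth_at \<A> X p)"

definition affine_atlas :: "'i set \<Rightarrow> ('i, 'i \<Rightarrow> complex) atlas" where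
  "affine_atlas I = {(I, \<lambda>x. x)}"

definition prod_atlas :: "('i, 'p) atlas \<Rightarrow> ('j, 'q) atlas \<Rightarrow> ('i + 'j, 'p \<times> 'q) atlas" where
  "prod_atlas \<A> \<B> =
     {(I <+> J, \<lambda>x. (\<psi> (\<lambda>i. x (Inl i)), \<phi> (\<lambda>j. x (Inr j)))) | I \<psi> J \<phi>. (I, \<psi>) \<in> \<A> \<and> (J, \<phi>) \<in> \<B>}"

text \<open>The points of the product over a finite index set \<open>A\<close> are extensional functions on \<open>A\<close>.\<close>

definition pi_atlas :: "'a set \<Rightarrow> ('a \<Rightarrow> ('i, 'p) atlas) \<Rightarrow> ('a \<times> 'i, 'a \<Rightarrow> 'p) atlas" where
  "pi_atlas A \<A> =
     {(SIGMA a:A. fst (c a), \<lambda>x. \<lambda>a\<in>A. snd (c a) (\<lambda>i. x (a, i))) | c. c \<in> (\<Pi>\<^sub>E a\<in>A. \<A> a)}"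

definition separated_morphism ::
  "('i, 'p) atlas \<Rightarrow> 'p set \<Rightarrow> ('p \<Rightarrow> 'q) \<Rightarrow> bool" where
  "separated_morphism \<A> X f \<longleftrightarrow>
     closedin (subtopology (zariski (prod_atlas \<A> \<A>)) {(p, q). p \<in> X \<and> q \<in> X \<and> f p = f q})
       ((\<lambda>p. (p, p)) ` X)"

text \<open>
  Every base change \<open>X \<times>\<^sub>Y Z \<rightarrow> Z\<close> along a morphism from a variety \<open>Z\<close> to \<open>Y\<close> is closed.
  Closedness is local on \<open>Z\<close>, so \<open>Z\<close> ranges over the affine varieties.
\<close>

definition universally_closed_morphism ::
  "('i, 'p) atlas \<Rightarrow> 'p set \<Rightarrow> ('j, 'q) atlas \<Rightarrow> 'q set \<Rightarrow> ('p \<Rightarrow> 'q) \<Rightarrow> bool" where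
  "universally_closed_morphism \<A> X \<B> Y f \<longleftrightarrow>
     (\<forall>(J :: nat set) Z g. finite J \<and> closedin (zariski (affine_atlas J)) Z \<and>
        var_morphism (affine_atlas J) Z \<B> Y g \<longrightarrow>
        closed_map
          (subtopology (zariski (prod_atlas \<A> (affine_atlas J))) {(p, z). p \<in> X \<and> z \<in> Z \<and> f p = g z})
          (subtopology (zariski (affine_atlas J)) Z) snd)"

definition proper_morphism ::
  "('i, 'p) atlas \<Rightarrow> 'p set \<Rightarrow> ('j, 'q) atlas \<Rightarrow> 'q set \<Rightarrow> ('p \<Rightarrow> 'q) \<Rightarrow> bool" where
  "proper_morphism \<A> X \<B> Y f \<longleftrightarrow> var_morphism \<A> X \<B> Y f \<and>
     separated_morphism \<A> X f \<and> universally_closed_morphism \<A> X \<B> Y f"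

definition desingularization ::
  "('i, 'p) atlas \<Rightarrow> 'p set \<Rightarrow> ('j, 'q) atlas \<Rightarrow> 'q set \<Rightarrow> ('p \<Rightarrow> 'q) \<Rightarrow> bool" where
  "desingularization \<A> X \<B> Y f \<longleftrightarrow>
     smooth_variety \<A> X \<and> proper_morphism \<A> X \<B> Y f \<and> birational_morphism \<A> X \<B> Y f"


section \<open>Degenerate partial flag varieties\<close>

definition flag_index_set :: "nat \<Rightarrow> (nat \<Rightarrow> nat) \<Rightarrow> nat \<Rightarrow> (nat \<times> nat) set" where
  "flag_index_set n d k =
     {(i, j). 1 \<le> i \<and> i \<le> j \<and> j \<le> n - 1 \<and> (\<exists>l\<in>{1..k}. i \<le> d l \<and> d l \<le> j)}"

locale based_vector_space = vector_space scale
  for scale :: "complex \<Rightarrow> 'w::ab_group_add \<Rightarrow> 'w" (infixr "*\<^sub>W" 75) +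
  fixes n :: nat and w :: "nat \<Rightarrow> 'w"
  assumes w_inj: "inj_on w {1..n}"
    and w_independent: "independent (w ` {1..n})"
    and w_span: "span (w ` {1..n}) = UNIV"
begin

definition pr :: "nat \<Rightarrow> 'w \<Rightarrow> 'w" where
  "pr e v = (\<Sum>i\<in>{1..n} - {e}. representation (w ` {1..n}) v (w i) *\<^sub>W w i)"

definition Gr :: "nat \<Rightarrow> 'w set set" where
  "Gr m = {V. subspace V \<and> dim V = m}"

text \<open>
  The standard charts: for \<open>S \<subseteq> {1..n}\<close> with \<open>card S = m\<close>, the subspaces complementary to the span of
  the \<open>w t\<close> with \<open>t \<notin> S\<close>, as graphs of linear maps with matrix \<open>x\<close>.
\<close>

definition gr_atlas :: "nat \<Rightarrow> (nat \<times> nat, 'w set) atlas" where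
  "gr_atlas m =
     {(S \<times> ({1..n} - S), \<lambda>x. span ((\<lambda>s. w s + (\<Sum>t\<in>{1..n} - S. x (s, t) *\<^sub>W w t)) ` S)) | S.
        S \<subseteq> {1..n} \<and> card S = m}"

text \<open>\<open>V l\<close> is the subspace of dimension \<open>d l\<close>; the \<open>foldr\<close> is \<open>pr (d l + 1) \<circ> \<dots> \<circ> pr (d (l + 1))\<close>.\<close>

definition deg_flag_variety :: "(nat \<Rightarrow> nat) \<Rightarrow> nat \<Rightarrow> (nat \<Rightarrow> 'w set) set" where
  "deg_flag_variety d k =
     {V \<in> (\<Pi>\<^sub>E l\<in>{1..k}. Gr (d l)).
        \<forall>l\<in>{1..<k}. foldr pr [d l + 1..<d (l + 1) + 1] ` V l \<subseteq> V (l + 1)}"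

definition deg_flag_ambient ::
  "(nat \<Rightarrow> nat) \<Rightarrow> nat \<Rightarrow> (nat \<times> nat \<times> nat, nat \<Rightarrow> 'w set) atlas" where
  "deg_flag_ambient d k = pi_atlas {1..k} (\<lambda>l. gr_atlas (d l))"

definition Wij :: "nat \<Rightarrow> nat \<Rightarrow> 'w set" where
  "Wij i j = span (w ` ({1..i} \<union> {j + 1..n}))"

definition R_variety :: "(nat \<Rightarrow> nat) \<Rightarrow> nat \<Rightarrow> (nat \<times> nat \<Rightarrow> 'w set) set" where
  "R_variety d k =
     {V \<in> (\<Pi>\<^sub>E (i, j)\<in>flag_index_set n d k. Gr i).
        (\<forall>(i, j)\<in>flag_index_set n d k. V (i, j) \<subseteq> Wij i j) \<and>
        (\<forall>i j. (i, j) \<in> flag_index_set n d k \<and> (i, j + 1) \<in> flag_index_set n d k \<longrightarrow>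
           pr (j + 1) ` V (i, j) \<subseteq> V (i, j + 1)) \<and>
        (\<forall>i j. (i, j + 1) \<in> flag_index_set n d k \<and> (i + 1, j + 1) \<in> flag_index_set n d k \<longrightarrow>
           V (i, j + 1) \<subseteq> V (i + 1, j + 1))}"

definition R_ambient ::
  "(nat \<Rightarrow> nat) \<Rightarrow> nat \<Rightarrow> ((nat \<times> nat) \<times> nat \<times> nat, nat \<times> nat \<Rightarrow> 'w set) atlas" where
  "R_ambient d k = pi_atlas (flag_index_set n d k) (\<lambda>(i, j). gr_atlas i)"

definition forget_off_diagonal ::
  "(nat \<Rightarrow> nat) \<Rightarrow> nat \<Rightarrow> (nat \<times> nat \<Rightarrow> 'w set) \<Rightarrow> nat \<Rightarrow> 'w set" where
  "forget_off_diagonal d k V = (\<lambda>l\<in>{1..k}. V (d l, d l))"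

end

end

theory Submission
  imports Defs "Jordan_Normal_Form.Determinant" "HOL-Computational_Algebra.Fundamental_Theorem_Algebra"
    "HOL-Computational_Algebra.Field_as_Ring"
begin

text \<open>
  \<open>R\<^sub>d\<close> is a tower of projective lines: with suitable conventions at the boundary, \<open>V\<^bsub>i,j\<^esub>\<close> is an
  arbitrary \<open>i\<close>-dimensional subspace between \<open>V\<^bsub>i-1,j\<^esub>\<close> and the preimage of \<open>V\<^bsub>i,j+1\<^esub>\<close> under
  \<open>pr\<^bsub>j+1\<^esub>\<close>, whose dimensions are \<open>i - 1\<close> and \<open>i + 1\<close>. Each line is covered by two standard charts of
  the Grassmannian, so around every point \<open>R\<^sub>d\<close> is, in a chart of the ambient product, the graph of a
  polynomial map on an affine space, hence smooth. Forgetting the \<open>V\<^bsub>i,j\<^esub>\<close> one at a time reduces universal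
  closedness to that of the projection of a projective line, which is elimination by Sylvester's
  determinant. Filling in complete flags shows that \<open>R\<^sub>d\<close> maps onto \<open>F\<^sup>a\<^sub>d\<close>. On the big cell, where each
  \<open>V\<^sub>m\<close>, \<open>m = d\<^sub>l\<close>, is complementary to \<open>span (w\<^bsub>m+1\<^esub>, \<dots>, w\<^sub>n)\<close>, all \<open>V\<^bsub>i,j\<^esub>\<close> are determined by the \<open>V\<^sub>m\<close>; it is dense in
  \<open>R\<^sub>d\<close> because a point can be moved into it along the lines of the tower, and so its image is dense
  in \<open>F\<^sup>a\<^sub>d\<close>.
\<close>

section \<open>Polynomial functions\<close>

text \<open>The conditions \<open>V (i, j) \<subseteq> Wij i j\<close> make each fibre a projective
  line: since i < j + 1, vectors of the space at (i, j + 1) have no coordinate at j + 1, so its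
  preimage under \<open>pr (j + 1)\<close> is its sum with the line of \<open>w (j + 1)\<close>; and
  the space at (i - 1, j) goes into that at (i - 1, j + 1), hence into that at (i, j + 1). Read from
  j = n downwards, the boundary convention even implies these conditions, so they are absent from
  \<open>tower\<close>. To add or remove a single line, statements are made for index sets
  \<open>Q\<close> closed under the moves to (i - 1, j) and (i, j + 1). The matrix of one space
  depends on the charts chosen for its two neighbours, so chart choices are made coherently
  (\<open>admissible\<close>). The definitions of open sets and morphisms, however, test all charts
  of the ambient products; rational transitions with one denominator, obtained by exchanging pivots,
  reduce this to the charts adapted to the tower. For the base change in universal closedness, the
  coordinates of the affine test variety are carried along as parameters of the elimination.\<close>

lemma polyfuns_uminus: "f \<in> polyfuns I \<Longrightarrow> (\<lambda>x. - f x) \<in> polyfuns I"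
  using polyfuns.mult[OF polyfuns.const[of "-1"]] by simp

lemma polyfuns_diff: "f \<in> polyfuns I \<Longrightarrow> g \<in> polyfuns I \<Longrightarrow> (\<lambda>x. f x - g x) \<in> polyfuns I"
  using polyfuns.add[OF _ polyfuns_uminus] by simp

lemma polyfuns_sum: "(\<And>a. a \<in> A \<Longrightarrow> f a \<in> polyfuns I) \<Longrightarrow> (\<lambda>x. \<Sum>a\<in>A. f a x) \<in> polyfuns I"
  by (induction A rule: infinite_finite_induct) (auto intro: polyfuns.intros)

lemma polyfuns_prod: "(\<And>a. a \<in> A \<Longrightarrow> f a \<in> polyfuns I) \<Longrightarrow> (\<lambda>x. \<Prod>a\<in>A. f a x) \<in> polyfuns I"
  by (induction A rule: infinite_finite_induct) (auto intro: polyfuns.intros)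

lemma polyfuns_power: "f \<in> polyfuns I \<Longrightarrow> (\<lambda>x. f x ^ m) \<in> polyfuns I"
  by (induction m) (auto intro: polyfuns.intros)

lemmas polyfuns_intros =
  polyfuns.intros polyfuns_uminus polyfuns_diff polyfuns_sum polyfuns_prod polyfuns_power

lemma polyfuns_compose:
  assumes "f \<in> polyfuns K" and "\<And>i. i \<in> K \<Longrightarrow> (\<lambda>y. u y i) \<in> polyfuns I"
  shows "(\<lambda>y. f (u y)) \<in> polyfuns I"
  using assms(1) by induction (auto intro: polyfuns.intros assms(2))

lemma polyfuns_cong: "f \<in> polyfuns I \<Longrightarrow> (\<And>i. i \<in> I \<Longrightarrow> x i = y i) \<Longrightarrow> f x = f y"
  by (induction rule: polyfuns.induct) auto

lemma polyfuns_mono: "f \<in> polyfuns I \<Longrightarrow> I \<subseteq> J \<Longrightarrow> f \<in> polyfuns J"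
  by (induction rule: polyfuns.induct) (auto intro: polyfuns.intros)

text \<open>Clearing denominators: fractions over powers of \<open>h\<close> are closed under sums
  and products. The point \<open>u\<close> is constrained on \<open>K\<close> only, as
  \<open>f\<close> sees nothing else.\<close>

lemma polyfuns_rational:
  assumes "f \<in> polyfuns K" and num: "\<And>k. k \<in> K \<Longrightarrow> num k \<in> polyfuns I" and h: "h \<in> polyfuns I"
  shows "\<exists>N. \<exists>g\<in>polyfuns I. \<forall>y u. h y \<noteq> 0 \<longrightarrow> (\<forall>k\<in>K. u k = num k y / h y) \<longrightarrow> f u = g y / h y ^ N"
  using assms(1)
proof induction
  case (const c)
  show ?case by (rule exI[of _ 0], rule bexI[of _ "\<lambda>_. c"]) (auto intro: polyfuns.intros)
next
  case (coord i)
  then show ?case by (intro exI[of _ 1] bexI[of _ "num i"]) (auto intro: num)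
next
  case (add f1 f2)
  obtain M g1 where 1: "g1 \<in> polyfuns I"
    "\<forall>y u. h y \<noteq> 0 \<longrightarrow> (\<forall>k\<in>K. u k = num k y / h y) \<longrightarrow> f1 u = g1 y / h y ^ M"
    using add.IH(1) by blast
  obtain N g2 where 2: "g2 \<in> polyfuns I"
    "\<forall>y u. h y \<noteq> 0 \<longrightarrow> (\<forall>k\<in>K. u k = num k y / h y) \<longrightarrow> f2 u = g2 y / h y ^ N"
    using add.IH(2) by blast
  have "(\<lambda>y. g1 y * h y ^ N + g2 y * h y ^ M) \<in> polyfuns I"
    using 1 2 h by (intro polyfuns_intros)
  then show ?case
    by (rule_tac exI[of _ "M + N"], rule_tac bexI)
      (use 1(2) 2(2) in \<open>auto simp: field_simps power_add\<close>)
next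
  case (mult f1 f2)
  obtain M g1 where 1: "g1 \<in> polyfuns I"
    "\<forall>y u. h y \<noteq> 0 \<longrightarrow> (\<forall>k\<in>K. u k = num k y / h y) \<longrightarrow> f1 u = g1 y / h y ^ M"
    using mult.IH(1) by blast
  obtain N g2 where 2: "g2 \<in> polyfuns I"
    "\<forall>y u. h y \<noteq> 0 \<longrightarrow> (\<forall>k\<in>K. u k = num k y / h y) \<longrightarrow> f2 u = g2 y / h y ^ N"
    using mult.IH(2) by blast
  have "(\<lambda>y. g1 y * g2 y) \<in> polyfuns I"
    using 1 2 by (intro polyfuns_intros)
  then show ?case
    by (rule_tac exI[of _ "M + N"], rule_tac bexI)
      (use 1(2) 2(2) in \<open>auto simp: field_simps power_add\<close>)
qed

text \<open>A point given by fractions over one common denominator, so that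
  \<open>h y \<noteq> 0\<close> is the only condition to watch. The value 0 off \<open>I\<close>
  places it in \<open>aff_space I\<close>.\<close>

definition ratvec :: "'i set \<Rightarrow> ('i \<Rightarrow> 'a \<Rightarrow> complex) \<Rightarrow> ('a \<Rightarrow> complex) \<Rightarrow> 'a \<Rightarrow> 'i \<Rightarrow> complex" where
  "ratvec I num h y = (\<lambda>i. if i \<in> I then num i y / h y else 0)"

lemma ratvec_aff_space: "ratvec I num h y \<in> aff_space I"
  by (simp add: ratvec_def aff_space_def)

lemma polyfuns_ratvec:
  assumes "f \<in> polyfuns K" and "\<forall>k\<in>K. num k \<in> polyfuns I" and "h \<in> polyfuns I"
  obtains N g where "g \<in> polyfuns I" "\<And>y. h y \<noteq> 0 \<Longrightarrow> f (ratvec K num h y) = g y / h y ^ N"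
proof -
  obtain N g where "g \<in> polyfuns I"
    "\<forall>y u. h y \<noteq> 0 \<longrightarrow> (\<forall>k\<in>K. u k = num k y / h y) \<longrightarrow> f u = g y / h y ^ N"
    using polyfuns_rational[OF assms(1), of num I h] assms(2,3) by blast
  then show ?thesis by (intro that[of g N]) (auto simp: ratvec_def)
qed

text \<open>Makes one-parameter deformations usable: on a polynomial curve, a polynomial function
  that is nonzero somewhere has only finitely many zeros.\<close>

lemma polyfuns_curve:
  assumes "f \<in> polyfuns I"
  shows "\<exists>p. \<forall>t. f (\<lambda>i. poly (q i) t) = poly p t"
  using assms
proof induction
  case (const c)
  show ?case by (rule exI[of _ "[:c:]"]) simp
next
  case (add f g)
  then show ?case by (metis poly_add)
next
  case (mult f g)
  then show ?case by (metis poly_mult)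
qed blast

text \<open>The bound \<open>N\<close> is uniform in \<open>y\<close> because such bounds fix the
  size of the Sylvester matrix in the elimination.\<close>

lemma polyfuns_univariate:
  assumes "f \<in> polyfuns (insert q I)"
  shows "\<exists>N P. (\<forall>y. degree (P y) \<le> N) \<and> (\<forall>k. (\<lambda>y. coeff (P y) k) \<in> polyfuns I) \<and>
    (\<forall>y l. f (y(q := l)) = poly (P y) l)"
  using assms
proof induction
  case (const c)
  show ?case
    by (rule exI[of _ 0], rule exI[of _ "\<lambda>_. [:c:]"]) (auto intro: polyfuns.intros)
next
  case (coord i)
  show ?case
  proof (cases "i = q")
    case True
    then show ?thesis
      by (intro exI[of _ 1] exI[of _ "\<lambda>_. [:0, 1:]"]) (auto intro: polyfuns.intros)
  next
    case False
    then have "(\<lambda>y. coeff [:y i:] k) \<in> polyfuns I" for k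
      using coord by (cases k) (auto intro: polyfuns.intros)
    with False show ?thesis
      by (intro exI[of _ 0] exI[of _ "\<lambda>y. [:y i:]"]) auto
  qed
next
  case (add f g)
  obtain M P where P: "\<forall>y. degree (P y) \<le> M" "\<forall>k. (\<lambda>y. coeff (P y) k) \<in> polyfuns I"
    "\<forall>y l. f (y(q := l)) = poly (P y) l"
    using add.IH(1) by blast
  obtain N Q where Q: "\<forall>y. degree (Q y) \<le> N" "\<forall>k. (\<lambda>y. coeff (Q y) k) \<in> polyfuns I"
    "\<forall>y l. g (y(q := l)) = poly (Q y) l"
    using add.IH(2) by blast
  have "degree (P y + Q y) \<le> max M N" for y
    using P(1) Q(1) by (meson degree_add_le max.coboundedI1 max.coboundedI2)
  with P Q show ?case
    by (intro exI[of _ "max M N"] exI[of _ "\<lambda>y. P y + Q y"] conjI allI)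
      (simp_all add: polyfuns.add del: fun_upd_apply)
next
  case (mult f g)
  obtain M P where P: "\<forall>y. degree (P y) \<le> M" "\<forall>k. (\<lambda>y. coeff (P y) k) \<in> polyfuns I"
    "\<forall>y l. f (y(q := l)) = poly (P y) l"
    using mult.IH(1) by blast
  obtain N Q where Q: "\<forall>y. degree (Q y) \<le> N" "\<forall>k. (\<lambda>y. coeff (Q y) k) \<in> polyfuns I"
    "\<forall>y l. g (y(q := l)) = poly (Q y) l"
    using mult.IH(2) by blast
  have "degree (P y * Q y) \<le> M + N" for y
    using P(1) Q(1) by (meson add_mono degree_mult_le order_trans)
  with P Q show ?case
    by (intro exI[of _ "M + N"] exI[of _ "\<lambda>y. P y * Q y"] conjI allI)
      (simp_all add: coeff_mult polyfuns_sum polyfuns.mult del: fun_upd_apply)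
qed


section \<open>Zariski topology and morphisms\<close>

lemma atlas_pointsI: "(I, \<psi>) \<in> \<A> \<Longrightarrow> x \<in> aff_space I \<Longrightarrow> \<psi> x \<in> atlas_points \<A>"
  unfolding atlas_points_def by blast

lemma atlas_pointsE:
  assumes "p \<in> atlas_points \<A>"
  obtains I \<psi> x where "(I, \<psi>) \<in> \<A>" "x \<in> aff_space I" "\<psi> x = p"
  using assms unfolding atlas_points_def by blast

lemma zariski_open_localI:
  assumes "U \<subseteq> atlas_points \<A>"
    and "\<And>I \<psi> x. (I, \<psi>) \<in> \<A> \<Longrightarrow> x \<in> aff_space I \<Longrightarrow> \<psi> x \<in> U \<Longrightarrow>
      \<exists>h\<in>polyfuns I. h x \<noteq> 0 \<and> (\<forall>y\<in>aff_space I. h y \<noteq> 0 \<longrightarrow> \<psi> y \<in> U)"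
  shows "zariski_open \<A> U"
proof (rule zariski_openI[OF assms(1)])
  fix I \<psi> assume I: "(I, \<psi>) \<in> \<A>"
  \<comment> \<open>The largest family allowed: all polynomials whose nonvanishing locus stays in
    \<open>U\<close>. The local witnesses belong to it.\<close>
  define F where "F = {h \<in> polyfuns I. \<forall>y\<in>aff_space I. h y \<noteq> 0 \<longrightarrow> \<psi> y \<in> U}"
  have "\<psi> x \<in> U \<longleftrightarrow> (\<exists>f\<in>F. f x \<noteq> 0)" if x: "x \<in> aff_space I" for x
    using assms(2)[OF I x] x unfolding F_def by blast
  then show "\<exists>F\<subseteq>polyfuns I. \<forall>x\<in>aff_space I. \<psi> x \<in> U \<longleftrightarrow> (\<exists>f\<in>F. f x \<noteq> 0)"
    by (intro exI[of _ F]) (auto simp: F_def)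
qed

lemma zariski_open_localD:
  assumes "zariski_open \<A> U" "(I, \<psi>) \<in> \<A>" "x \<in> aff_space I" "\<psi> x \<in> U"
  obtains h where "h \<in> polyfuns I" "h x \<noteq> 0" "\<And>y. y \<in> aff_space I \<Longrightarrow> h y \<noteq> 0 \<Longrightarrow> \<psi> y \<in> U"
  using zariski_openD[OF assms(1,2)] assms(3,4) by (metis subsetD)

lemma topspace_zariski: "topspace (zariski \<A>) = atlas_points \<A>"
proof -
  have "zariski_open \<A> (atlas_points \<A>)"
    by (rule zariski_open_localI) (auto intro!: bexI[of _ "\<lambda>_. 1"] atlas_pointsI polyfuns.const)
  then show ?thesis
    unfolding topspace_def openin_zariski by (auto simp: zariski_open_def)
qed

lemma closedin_zariskiI:
  assumes "C \<subseteq> atlas_points \<A>"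
    and "\<And>I \<psi> x. (I, \<psi>) \<in> \<A> \<Longrightarrow> x \<in> aff_space I \<Longrightarrow> \<psi> x \<notin> C \<Longrightarrow>
      \<exists>h\<in>polyfuns I. h x \<noteq> 0 \<and> (\<forall>y\<in>aff_space I. \<psi> y \<in> C \<longrightarrow> h y = 0)"
  shows "closedin (zariski \<A>) C"
  unfolding closedin_def topspace_zariski openin_zariski
proof (intro conjI assms(1) zariski_open_localI)
  fix I \<psi> x assume *: "(I, \<psi>) \<in> \<A>" "x \<in> aff_space I" "\<psi> x \<in> atlas_points \<A> - C"
  then show "\<exists>h\<in>polyfuns I. h x \<noteq> 0 \<and>
      (\<forall>y\<in>aff_space I. h y \<noteq> 0 \<longrightarrow> \<psi> y \<in> atlas_points \<A> - C)"
    using assms(2)[OF *(1,2)] atlas_pointsI[OF *(1)] by blast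
qed blast

lemma closedin_zariskiD:
  assumes "closedin (zariski \<A>) C" "(I, \<psi>) \<in> \<A>" "x \<in> aff_space I" "\<psi> x \<notin> C"
  obtains h where "h \<in> polyfuns I" "h x \<noteq> 0" "\<And>y. y \<in> aff_space I \<Longrightarrow> \<psi> y \<in> C \<Longrightarrow> h y = 0"
proof -
  have "zariski_open \<A> (atlas_points \<A> - C)"
    using assms(1) by (simp add: closedin_def topspace_zariski openin_zariski)
  then show ?thesis
    by (rule zariski_open_localD[OF _ assms(2,3)])
      (use assms(4) atlas_pointsI[OF assms(2)] assms(3) that in \<open>auto\<close>)
qed

text \<open>The denominator \<open>h\<close> also cuts out the neighbourhood on which the transition
  formula holds. This allows open sets and maps described in one chart to be read in any
  other.\<close>

definition good_atlas :: "('i, 'p) atlas \<Rightarrow> bool" where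
  "good_atlas \<A> \<longleftrightarrow> (\<forall>(I, \<psi>)\<in>\<A>. finite I \<and> inj_on \<psi> (aff_space I)) \<and>
     (\<forall>I \<psi> J \<phi> x y. (I, \<psi>) \<in> \<A> \<and> (J, \<phi>) \<in> \<A> \<and> x \<in> aff_space I \<and> y \<in> aff_space J \<and> \<psi> x = \<phi> y \<longrightarrow>
       (\<exists>h num. h \<in> polyfuns I \<and> (\<forall>j\<in>J. num j \<in> polyfuns I) \<and> h x \<noteq> 0 \<and>
          (\<forall>z\<in>aff_space I. h z \<noteq> 0 \<longrightarrow> \<psi> z = \<phi> (ratvec J num h z))))"

lemma good_atlas_finite: "good_atlas \<A> \<Longrightarrow> (I, \<psi>) \<in> \<A> \<Longrightarrow> finite I"
  unfolding good_atlas_def by blast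

lemma good_atlas_inj: "good_atlas \<A> \<Longrightarrow> (I, \<psi>) \<in> \<A> \<Longrightarrow> inj_on \<psi> (aff_space I)"
  unfolding good_atlas_def by blast

lemma good_atlas_transition:
  assumes "good_atlas \<A>" "(I, \<psi>) \<in> \<A>" "(J, \<phi>) \<in> \<A>" "x \<in> aff_space I" "y \<in> aff_space J" "\<psi> x = \<phi> y"
  obtains h num where "h \<in> polyfuns I" "\<And>j. j \<in> J \<Longrightarrow> num j \<in> polyfuns I" "h x \<noteq> 0"
    "\<And>z. z \<in> aff_space I \<Longrightarrow> h z \<noteq> 0 \<Longrightarrow> \<psi> z = \<phi> (ratvec J num h z)"
proof -
  have "\<exists>h num. h \<in> polyfuns I \<and> (\<forall>j\<in>J. num j \<in> polyfuns I) \<and> h x \<noteq> 0 \<and>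
          (\<forall>z\<in>aff_space I. h z \<noteq> 0 \<longrightarrow> \<psi> z = \<phi> (ratvec J num h z))"
    using assms(1)[unfolded good_atlas_def, THEN conjunct2, rule_format, of I \<psi> J \<phi> x y] assms(2-)
    by blast
  then show ?thesis using that by blast
qed

text \<open>Openness has to be tested in every chart: there \<open>h\<close> is pulled back along
  the transition, and the result is multiplied by the denominator of the transition to stay where
  the formula holds.\<close>

lemma open_principal:
  assumes A: "good_atlas \<A>" and I: "(I, \<psi>) \<in> \<A>" and h: "h \<in> polyfuns I"
  shows "zariski_open \<A> (\<psi> ` {x \<in> aff_space I. h x \<noteq> 0})"
proof (rule zariski_open_localI)
  show "\<psi> ` {x \<in> aff_space I. h x \<noteq> 0} \<subseteq> atlas_points \<A>"
    using atlas_pointsI[OF I] by blast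
  fix J \<phi> y assume J: "(J, \<phi>) \<in> \<A>" "y \<in> aff_space J" "\<phi> y \<in> \<psi> ` {x \<in> aff_space I. h x \<noteq> 0}"
  then obtain x where x: "x \<in> aff_space I" "h x \<noteq> 0" "\<phi> y = \<psi> x" by blast
  obtain k num where k: "k \<in> polyfuns J" "\<forall>i\<in>I. num i \<in> polyfuns J" "k y \<noteq> 0"
    and eq: "\<And>z. z \<in> aff_space J \<Longrightarrow> k z \<noteq> 0 \<Longrightarrow> \<phi> z = \<psi> (ratvec I num k z)"
    using good_atlas_transition[OF A J(1) I J(2) x(1,3)] by metis
  obtain N g where g: "g \<in> polyfuns J"
    and hg: "\<And>z. k z \<noteq> 0 \<Longrightarrow> h (ratvec I num k z) = g z / k z ^ N"
    by (rule polyfuns_ratvec[OF h k(2,1)]) (rule that)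
  have "x = ratvec I num k y"
    using good_atlas_inj[OF A I] x(1,3) eq[OF J(2) k(3)] ratvec_aff_space by (metis inj_onD)
  then have "g y \<noteq> 0" using x(2) hg[OF k(3)] by auto
  moreover have "\<phi> z \<in> \<psi> ` {x \<in> aff_space I. h x \<noteq> 0}" if "z \<in> aff_space J" "g z * k z \<noteq> 0" for z
  proof -
    have "k z \<noteq> 0" "g z \<noteq> 0" using that by auto
    then show ?thesis
      using hg[of z] eq[OF that(1)] by (auto intro!: imageI ratvec_aff_space)
  qed
  ultimately show "\<exists>l\<in>polyfuns J. l y \<noteq> 0 \<and>
      (\<forall>z\<in>aff_space J. l z \<noteq> 0 \<longrightarrow> \<phi> z \<in> \<psi> ` {x \<in> aff_space I. h x \<noteq> 0})"
    using g k(1,3) by (intro bexI[of _ "\<lambda>z. g z * k z"]) (auto intro: polyfuns.intros)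
qed

lemma regular_onE:
  assumes "regular_on \<A> U f" "p \<in> U"
  obtains I \<psi> x g h where "(I, \<psi>) \<in> \<A>" "x \<in> aff_space I" "\<psi> x = p" "g \<in> polyfuns I"
    "h \<in> polyfuns I" "h x \<noteq> 0"
    "\<And>y. y \<in> aff_space I \<Longrightarrow> \<psi> y \<in> U \<Longrightarrow> h y \<noteq> 0 \<Longrightarrow> f (\<psi> y) = g y / h y"
  using assms unfolding regular_on_def by (fastforce split: prod.splits)

lemma regular_onI:
  assumes "\<And>p. p \<in> U \<Longrightarrow> \<exists>I \<psi> x g h. (I, \<psi>) \<in> \<A> \<and> x \<in> aff_space I \<and> \<psi> x = p \<and> g \<in> polyfuns I \<and>
    h \<in> polyfuns I \<and> h x \<noteq> 0 \<and> (\<forall>y\<in>aff_space I. \<psi> y \<in> U \<and> h y \<noteq> 0 \<longrightarrow> f (\<psi> y) = g y / h y)"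
  shows "regular_on \<A> U f"
  unfolding regular_on_def
proof
  fix p assume "p \<in> U"
  then obtain I \<psi> x g h where *: "(I, \<psi>) \<in> \<A>" "x \<in> aff_space I \<and> \<psi> x = p" "g \<in> polyfuns I"
    "h \<in> polyfuns I" "h x \<noteq> 0 \<and> (\<forall>y\<in>aff_space I. \<psi> y \<in> U \<and> h y \<noteq> 0 \<longrightarrow> f (\<psi> y) = g y / h y)"
    using assms by metis
  show "\<exists>(I, \<psi>)\<in>\<A>. \<exists>x\<in>aff_space I. \<psi> x = p \<and>
        (\<exists>g\<in>polyfuns I. \<exists>h\<in>polyfuns I. h x \<noteq> 0 \<and>
           (\<forall>y\<in>aff_space I. \<psi> y \<in> U \<and> h y \<noteq> 0 \<longrightarrow> f (\<psi> y) = g y / h y))"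
    by (rule bexI[OF _ *(1)]) (use * in blast)
qed

text \<open>
  Regular functions on the target are only given in some chart around each point, hence \<open>f\<close> has to
  be rational with respect to every chart of \<open>\<B>\<close>.
\<close>

definition rational_at ::
  "('i, 'p) atlas \<Rightarrow> 'p set \<Rightarrow> ('j, 'q) atlas \<Rightarrow> ('p \<Rightarrow> 'q) \<Rightarrow> 'p \<Rightarrow> bool" where
  "rational_at \<A> X \<B> f p \<longleftrightarrow>
     (\<forall>J \<theta> y. (J, \<theta>) \<in> \<B> \<and> y \<in> aff_space J \<and> \<theta> y = f p \<longrightarrow>
       (\<exists>I \<psi> x h num. (I, \<psi>) \<in> \<A> \<and> x \<in> aff_space I \<and> \<psi> x = p \<and> h \<in> polyfuns I \<and>
          (\<forall>j\<in>J. num j \<in> polyfuns I) \<and> h x \<noteq> 0 \<and>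
          (\<forall>z\<in>aff_space I. h z \<noteq> 0 \<and> \<psi> z \<in> X \<longrightarrow> f (\<psi> z) = \<theta> (ratvec J num h z))))"

text \<open>Both halves of the definition come from substituting a local rational expression of
  \<open>f\<close> into polynomials of the target chart and clearing denominators.\<close>

lemma var_morphismI:
  assumes A: "good_atlas \<A>" and B: "good_atlas \<B>"
    and X: "X \<subseteq> atlas_points \<A>" and Y: "Y \<subseteq> atlas_points \<B>" and f: "f ` X \<subseteq> Y"
    and rat: "\<And>p. p \<in> X \<Longrightarrow> rational_at \<A> X \<B> f p"
  shows "var_morphism \<A> X \<B> Y f"
  unfolding var_morphism_def
proof (intro conjI allI impI)
  have topX: "topspace (subtopology (zariski \<A>) X) = X"
    using X by (auto simp: topspace_zariski)
  have topY: "topspace (subtopology (zariski \<B>) Y) = Y"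
    using Y by (auto simp: topspace_zariski)
  \<comment> \<open>Injectivity of the target chart identifies the value of the rational expression
    at \<open>x\<close> with the given coordinates \<open>y\<close>, so polynomials nonzero at
    \<open>y\<close> stay nonzero after substitution.\<close>
  have pull: thesis
    if p: "p \<in> X" and J: "(J, \<theta>) \<in> \<B>" "y \<in> aff_space J" "\<theta> y = f p"
      and that: "\<And>I \<psi> x h num. (I, \<psi>) \<in> \<A> \<Longrightarrow> x \<in> aff_space I \<Longrightarrow> \<psi> x = p \<Longrightarrow> h \<in> polyfuns I \<Longrightarrow>
          \<forall>j\<in>J. num j \<in> polyfuns I \<Longrightarrow> h x \<noteq> 0 \<Longrightarrow> ratvec J num h x = y \<Longrightarrow>
          \<forall>z\<in>aff_space I. h z \<noteq> 0 \<and> \<psi> z \<in> X \<longrightarrow> f (\<psi> z) = \<theta> (ratvec J num h z) \<Longrightarrow> thesis"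
    for p J \<theta> y thesis
  proof -
    obtain I \<psi> x h num where *: "(I, \<psi>) \<in> \<A>" "x \<in> aff_space I" "\<psi> x = p" "h \<in> polyfuns I"
          "\<forall>j\<in>J. num j \<in> polyfuns I" "h x \<noteq> 0"
          "\<forall>z\<in>aff_space I. h z \<noteq> 0 \<and> \<psi> z \<in> X \<longrightarrow> f (\<psi> z) = \<theta> (ratvec J num h z)"
      using rat[OF p, unfolded rational_at_def, rule_format, of J \<theta> y, OF conjI[OF J(1) conjI[OF J(2,3)]]]
      by (elim exE conjE) (rule that)
    have "\<theta> y = \<theta> (ratvec J num h x)" using * J(3) p by metis
    then have "ratvec J num h x = y"
      using good_atlas_inj[OF B J(1)] J(2) ratvec_aff_space by (metis inj_onD)
    with * show ?thesis by (intro that[of I \<psi> x h num])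
  qed
  show "continuous_map (subtopology (zariski \<A>) X) (subtopology (zariski \<B>) Y) f"
    unfolding continuous_map_def topX topY
  proof (intro conjI allI impI)
    show "f \<in> X \<rightarrow> Y" using f by blast
    fix V assume "openin (subtopology (zariski \<B>) Y) V"
    then obtain V' where V': "zariski_open \<B> V'" "V = V' \<inter> Y"
      by (auto simp: openin_subtopology openin_zariski)
    show "openin (subtopology (zariski \<A>) X) {x \<in> X. f x \<in> V}"
    proof (subst openin_subopen, intro ballI)
      fix p assume "p \<in> {x \<in> X. f x \<in> V}"
      then have p: "p \<in> X" "f p \<in> V" by auto
      obtain J \<theta> y where J: "(J, \<theta>) \<in> \<B>" "y \<in> aff_space J" "\<theta> y = f p"
        using atlas_pointsE[of "f p" \<B>] p f Y by blast
      obtain I \<psi> x h num where I: "(I, \<psi>) \<in> \<A>" "x \<in> aff_space I" "\<psi> x = p" "h \<in> polyfuns I"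
          "\<forall>j\<in>J. num j \<in> polyfuns I" "h x \<noteq> 0" "ratvec J num h x = y"
          "\<forall>z\<in>aff_space I. h z \<noteq> 0 \<and> \<psi> z \<in> X \<longrightarrow> f (\<psi> z) = \<theta> (ratvec J num h z)"
        by (rule pull[of p J \<theta> y, OF p(1) J]) (rule that, assumption+)
      have "\<theta> y \<in> V'" using p J V' by auto
      then obtain \<phi> where \<phi>: "\<phi> \<in> polyfuns J" "\<phi> y \<noteq> 0"
          "\<And>z. z \<in> aff_space J \<Longrightarrow> \<phi> z \<noteq> 0 \<Longrightarrow> \<theta> z \<in> V'"
        using zariski_open_localD[OF V'(1) J(1,2)] by blast
      obtain N g where g: "g \<in> polyfuns I"
        and \<phi>g: "\<And>z. h z \<noteq> 0 \<Longrightarrow> \<phi> (ratvec J num h z) = g z / h z ^ N"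
        by (rule polyfuns_ratvec[OF \<phi>(1) I(5) I(4)]) (rule that)
      define D where "D = \<psi> ` {z \<in> aff_space I. g z * h z \<noteq> 0}"
      have D: "zariski_open \<A> D"
        unfolding D_def using I(1,4) g by (intro open_principal[OF A] polyfuns.mult)
      have "g x \<noteq> 0" using \<phi>g[OF I(6)] I(7) \<phi>(2) by auto
      then have "p \<in> D" using I by (auto simp: D_def)
      moreover have "f q \<in> V" if "q \<in> D" "q \<in> X" for q
      proof -
        obtain z where z: "z \<in> aff_space I" "g z \<noteq> 0" "h z \<noteq> 0" "q = \<psi> z"
          using \<open>q \<in> D\<close> by (auto simp: D_def)
        then have "f q = \<theta> (ratvec J num h z)" using I(8) that by auto
        moreover have "\<phi> (ratvec J num h z) \<noteq> 0" using \<phi>g[of z] z by auto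
        ultimately have "f q \<in> V'" using \<phi>(3)[OF ratvec_aff_space] by metis
        then show ?thesis using f \<open>q \<in> X\<close> V'(2) by blast
      qed
      ultimately show "\<exists>T. openin (subtopology (zariski \<A>) X) T \<and> p \<in> T \<and> T \<subseteq> {x \<in> X. f x \<in> V}"
        using D p(1)
        by (intro exI[of _ "D \<inter> X"]) (auto simp: openin_subtopology openin_zariski)
    qed
  qed
  fix V \<phi> assume "openin (subtopology (zariski \<B>) Y) V \<and> regular_on \<B> V \<phi>"
  then have V: "regular_on \<B> V \<phi>" by blast
  show "regular_on \<A> {p \<in> X. f p \<in> V} (\<phi> \<circ> f)"
  proof (rule regular_onI)
    fix p assume "p \<in> {p \<in> X. f p \<in> V}"
    then have p: "p \<in> X" "f p \<in> V" by auto
    obtain J \<theta> y a b where J: "(J, \<theta>) \<in> \<B>" "y \<in> aff_space J" "\<theta> y = f p" and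
      ab: "a \<in> polyfuns J" "b \<in> polyfuns J" "b y \<noteq> 0"
        "\<And>z. z \<in> aff_space J \<Longrightarrow> \<theta> z \<in> V \<Longrightarrow> b z \<noteq> 0 \<Longrightarrow> \<phi> (\<theta> z) = a z / b z"
      using regular_onE[OF V p(2)] by metis
    obtain I \<psi> x h num where I: "(I, \<psi>) \<in> \<A>" "x \<in> aff_space I" "\<psi> x = p" "h \<in> polyfuns I"
        "\<forall>j\<in>J. num j \<in> polyfuns I" "h x \<noteq> 0" "ratvec J num h x = y"
        "\<forall>z\<in>aff_space I. h z \<noteq> 0 \<and> \<psi> z \<in> X \<longrightarrow> f (\<psi> z) = \<theta> (ratvec J num h z)"
      by (rule pull[of p J \<theta> y, OF p(1) J]) (rule that, assumption+)
    obtain M a' where a': "a' \<in> polyfuns I"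
      and aa: "\<And>z. h z \<noteq> 0 \<Longrightarrow> a (ratvec J num h z) = a' z / h z ^ M"
      by (rule polyfuns_ratvec[OF ab(1) I(5) I(4)]) (rule that)
    obtain N b' where b': "b' \<in> polyfuns I"
      and bb: "\<And>z. h z \<noteq> 0 \<Longrightarrow> b (ratvec J num h z) = b' z / h z ^ N"
      by (rule polyfuns_ratvec[OF ab(2) I(5) I(4)]) (rule that)
    have "b' x \<noteq> 0" using bb[OF I(6)] I(7) ab(3) by auto
    \<comment> \<open>The extra factor \<open>h z\<close> makes the denominator vanish wherever the
      expression for \<open>f\<close> is invalid, even if \<open>M\<close> is 0.\<close>
    moreover have "(\<phi> \<circ> f) (\<psi> z) = (a' z * h z ^ N * h z) / (b' z * h z ^ M * h z)"
      if "z \<in> aff_space I" "\<psi> z \<in> {p \<in> X. f p \<in> V}" "b' z * h z ^ M * h z \<noteq> 0" for z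
    proof -
      have nz: "h z \<noteq> 0" "b' z \<noteq> 0" using that by auto
      then have fz: "f (\<psi> z) = \<theta> (ratvec J num h z)" using I(8) that by auto
      have "b (ratvec J num h z) \<noteq> 0" using bb nz by auto
      then have "\<phi> (f (\<psi> z)) = a (ratvec J num h z) / b (ratvec J num h z)"
        using ab(4)[OF ratvec_aff_space, of num h z] fz that by simp
      then show ?thesis using nz by (simp add: aa bb field_simps)
    qed
    ultimately show "\<exists>I \<psi> x g h. (I, \<psi>) \<in> \<A> \<and> x \<in> aff_space I \<and> \<psi> x = p \<and> g \<in> polyfuns I \<and>
        h \<in> polyfuns I \<and> h x \<noteq> 0 \<and> (\<forall>y\<in>aff_space I. \<psi> y \<in> {p \<in> X. f p \<in> V} \<and> h y \<noteq> 0 \<longrightarrow>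
          (\<phi> \<circ> f) (\<psi> y) = g y / h y)"
      using I(1-6) a' b'
      by (intro exI[of _ I] exI[of _ \<psi>] exI[of _ x] exI[of _ "\<lambda>z. a' z * h z ^ N * h z"]
          exI[of _ "\<lambda>z. b' z * h z ^ M * h z"]) (auto intro!: polyfuns_intros)
  qed
qed

text \<open>A converse of \<open>var_morphismI\<close> for affine sources: the chart coordinates are
  regular functions on an open part of the target, so their pullbacks are local quotients, which are
  then brought to one denominator.\<close>

lemma affine_morphism_rational:
  assumes B: "good_atlas \<B>" and Y: "Y \<subseteq> atlas_points \<B>"
    and g: "var_morphism (affine_atlas J) Z \<B> Y g" and Z: "Z \<subseteq> aff_space J"
    and z: "z \<in> Z" and I: "(I, \<theta>) \<in> \<B>" "x \<in> aff_space I" "\<theta> x = g z"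
  obtains h num where "h \<in> polyfuns J" "\<And>i. i \<in> I \<Longrightarrow> num i \<in> polyfuns J" "h z \<noteq> 0"
    "\<And>y. y \<in> Z \<Longrightarrow> h y \<noteq> 0 \<Longrightarrow> g y = \<theta> (ratvec I num h y)"
proof -
  define V where "V = Y \<inter> \<theta> ` aff_space I"
  have "zariski_open \<B> (\<theta> ` {x \<in> aff_space I. 1 \<noteq> (0::complex)})"
    by (rule open_principal[OF B I(1)]) (rule polyfuns.const)
  then have V: "openin (subtopology (zariski \<B>) Y) V"
    by (auto simp: V_def openin_subtopology openin_zariski Int_commute)
  have topZ: "topspace (subtopology (zariski (affine_atlas J)) Z) = Z"
    using Z by (auto simp: topspace_zariski atlas_points_def affine_atlas_def)
  have cont: "continuous_map (subtopology (zariski (affine_atlas J)) Z) (subtopology (zariski \<B>) Y) g"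
    using g by (simp add: var_morphism_def)
  then have "g z \<in> Y"
    using z cont[THEN continuous_map_funspace] unfolding topZ by auto
  then have zV: "g z \<in> V" using imageI[OF I(2), of \<theta>] I(3) by (simp add: V_def)
  \<comment> \<open>The coordinate function \<open>c\<close> of the chart, meaningful on its
    image.\<close>
  define \<phi> where "\<phi> c q = inv_into (aff_space I) \<theta> q c" for c q
  have \<phi>: "\<phi> c (\<theta> y) = y c" if "y \<in> aff_space I" for c y
    using good_atlas_inj[OF B I(1)] that by (simp add: \<phi>_def)
  have "regular_on \<B> V (\<phi> c)" if "c \<in> I" for c
  proof (rule regular_onI)
    fix p assume "p \<in> V"
    then obtain y where "y \<in> aff_space I" "p = \<theta> y" by (auto simp: V_def)
    then show "\<exists>K \<psi> x g h. (K, \<psi>) \<in> \<B> \<and> x \<in> aff_space K \<and> \<psi> x = p \<and> g \<in> polyfuns K \<and>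
      h \<in> polyfuns K \<and> h x \<noteq> 0 \<and> (\<forall>y\<in>aff_space K. \<psi> y \<in> V \<and> h y \<noteq> 0 \<longrightarrow> \<phi> c (\<psi> y) = g y / h y)"
      using I(1) that \<phi>
      by (intro exI[of _ I] exI[of _ \<theta>] exI[of _ y] exI[of _ "\<lambda>x. x c"] exI[of _ "\<lambda>_. 1"])
        (auto intro: polyfuns.intros)
  qed
  then have reg: "regular_on (affine_atlas J) {z \<in> Z. g z \<in> V} (\<phi> c \<circ> g)" if "c \<in> I" for c
    using g V that unfolding var_morphism_def by blast
  have "\<exists>n d. n \<in> polyfuns J \<and> d \<in> polyfuns J \<and> d z \<noteq> 0 \<and>
      (\<forall>y\<in>Z. g y \<in> V \<and> d y \<noteq> 0 \<longrightarrow> \<phi> c (g y) = n y / d y)" if c: "c \<in> I" for c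
  proof -
    have "z \<in> {z \<in> Z. g z \<in> V}" using z zV by simp
    obtain K \<psi> x n d where *: "(K, \<psi>) \<in> affine_atlas J"
      "x \<in> aff_space K" "\<psi> x = z" "n \<in> polyfuns K" "d \<in> polyfuns K" "d x \<noteq> 0"
      "\<And>y. y \<in> aff_space K \<Longrightarrow> \<psi> y \<in> {z \<in> Z. g z \<in> V} \<Longrightarrow> d y \<noteq> 0 \<Longrightarrow> (\<phi> c \<circ> g) (\<psi> y) = n y / d y"
      by (rule regular_onE[OF reg[OF c] \<open>z \<in> {z \<in> Z. g z \<in> V}\<close>]) (rule that)
    then have "K = J" "\<psi> = (\<lambda>x. x)" by (auto simp: affine_atlas_def)
    with * show ?thesis using Z by auto
  qed
  then obtain n d where nd: "\<And>c. c \<in> I \<Longrightarrow> n c \<in> polyfuns J" "\<And>c. c \<in> I \<Longrightarrow> d c \<in> polyfuns J"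
    "\<And>c. c \<in> I \<Longrightarrow> d c z \<noteq> 0"
    "\<And>c y. c \<in> I \<Longrightarrow> y \<in> Z \<Longrightarrow> g y \<in> V \<Longrightarrow> d c y \<noteq> 0 \<Longrightarrow> \<phi> c (g y) = n c y / d c y"
    by metis
  have "openin (subtopology (zariski (affine_atlas J)) Z) {y \<in> Z. g y \<in> V}"
    using openin_continuous_map_preimage[OF cont V] unfolding topZ .
  then obtain T where T: "zariski_open (affine_atlas J) T" "{y \<in> Z. g y \<in> V} = T \<inter> Z"
    by (auto simp: openin_subtopology openin_zariski)
  have "z \<in> T" using T(2) z zV by blast
  then obtain k where k: "k \<in> polyfuns J" "k z \<noteq> 0" "\<And>y. y \<in> aff_space J \<Longrightarrow> k y \<noteq> 0 \<Longrightarrow> y \<in> T"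
    using zariski_open_localD[OF T(1), of J "\<lambda>x. x" z] z Z by (auto simp: affine_atlas_def)
  \<comment> \<open>\<open>k\<close> confines \<open>y\<close> to points whose image lies in the
    chart; it enters \<open>num\<close> as well and cancels in the quotient.\<close>
  define h where "h y = k y * (\<Prod>c\<in>I. d c y)" for y
  define num where "num c y = k y * (n c y * (\<Prod>c'\<in>I-{c}. d c' y))" for c y
  have fin: "finite I" by (rule good_atlas_finite[OF B I(1)])
  show ?thesis
  proof (rule that[of h num])
    show "h \<in> polyfuns J" unfolding h_def using k nd by (intro polyfuns_intros)
    show "num i \<in> polyfuns J" if "i \<in> I" for i
      unfolding num_def using k nd that by (intro polyfuns_intros) auto
    show "h z \<noteq> 0" using k nd fin by (simp add: h_def)
    fix y assume y: "y \<in> Z" "h y \<noteq> 0"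
    then have ky: "k y \<noteq> 0" "\<And>c. c \<in> I \<Longrightarrow> d c y \<noteq> 0" using fin by (auto simp: h_def)
    then have gV: "g y \<in> V" using k(3) T(2) y Z by blast
    then obtain u where u: "u \<in> aff_space I" "g y = \<theta> u" by (auto simp: V_def)
    have "u c = ratvec I num h y c" for c
    proof (cases "c \<in> I")
      case True
      have "(\<Prod>c\<in>I. d c y) = d c y * (\<Prod>c'\<in>I-{c}. d c' y)"
        using fin True by (rule prod.remove)
      moreover have "(\<Prod>c'\<in>I-{c}. d c' y) \<noteq> 0" using ky fin by simp
      ultimately have "num c y / h y = n c y / d c y"
        using ky True by (simp add: num_def h_def)
      also have "\<dots> = u c" using nd(4)[OF True y(1) gV] ky(2)[OF True] \<phi>[OF u(1)] u(2) by simp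
      finally show ?thesis using True by (simp add: ratvec_def)
    next
      case False
      then show ?thesis using u(1) by (simp add: aff_space_def ratvec_def)
    qed
    then have "u = ratvec I num h y" by blast
    then show "g y = \<theta> (ratvec I num h y)" using u(2) by simp
  qed
qed

section \<open>Graphs of polynomial maps are smooth\<close>

text \<open>Modulo the equations of the graph a polynomial equals its restriction to the graph. For
  products this is the identity \<open>f * g - f' * g' = (f - f') * g + f' * (g - g')\<close>,
  primes denoting the restriction.\<close>

lemma polyfun_diff_graph:
  assumes e: "bij_betw e {0..<c} (I - J)" and q: "\<And>i. i \<in> I - J \<Longrightarrow> q i \<in> polyfuns I"
    and g: "g \<in> polyfuns I"
  shows "\<exists>a. (\<forall>k<(c::nat). a k \<in> polyfuns I) \<and>
    (\<forall>y. g y - g (\<lambda>i. if i \<in> I - J then q i y else y i) = (\<Sum>k<c. a k y * (y (e k) - q (e k) y)))"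
  using g
proof induction
  case (const r)
  show ?case by (rule exI[of _ "\<lambda>_ _. 0"]) (auto intro: polyfuns.intros)
next
  case (coord i)
  show ?case
  proof (cases "i \<in> J")
    case True
    then show ?thesis by (intro exI[of _ "\<lambda>_ _. 0"]) (auto intro: polyfuns.intros)
  next
    case False
    then have "i \<in> e ` {0..<c}"
      using bij_betw_imp_surj_on[OF e] coord by simp
    then obtain k0 where k0: "k0 < c" "e k0 = i" by auto
    have "(\<Sum>k<c. (if k = k0 then 1 else 0) * (y (e k) - q (e k) y)) = y i - q i y" for y
      using k0 by (simp add: if_distrib[of "\<lambda>x. x * _"] cong: if_cong)
    then show ?thesis
      using False coord by (intro exI[of _ "\<lambda>k _. if k = k0 then 1 else 0"]) (auto intro: polyfuns.intros)
  qed
next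
  case (add f g)
  obtain a b where ab: "\<forall>k<c. a k \<in> polyfuns I" "\<forall>k<c. b k \<in> polyfuns I"
    "\<forall>y. f y - f (\<lambda>i. if i \<in> I - J then q i y else y i) = (\<Sum>k<c. a k y * (y (e k) - q (e k) y))"
    "\<forall>y. g y - g (\<lambda>i. if i \<in> I - J then q i y else y i) = (\<Sum>k<c. b k y * (y (e k) - q (e k) y))"
    using add.IH by blast
  have "f y + g y - (f (\<lambda>i. if i \<in> I - J then q i y else y i) + g (\<lambda>i. if i \<in> I - J then q i y else y i))
      = (\<Sum>k<c. (a k y + b k y) * (y (e k) - q (e k) y))" for y
    using ab(3,4)[rule_format, of y] by (simp add: distrib_right sum.distrib add_diff_add)
  then show ?case
    using ab(1,2) by (intro exI[of _ "\<lambda>k y. a k y + b k y"]) (auto intro: polyfuns.intros)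
next
  case (mult f g)
  obtain a b where ab: "\<forall>k<c. a k \<in> polyfuns I" "\<forall>k<c. b k \<in> polyfuns I"
    "\<forall>y. f y - f (\<lambda>i. if i \<in> I - J then q i y else y i) = (\<Sum>k<c. a k y * (y (e k) - q (e k) y))"
    "\<forall>y. g y - g (\<lambda>i. if i \<in> I - J then q i y else y i) = (\<Sum>k<c. b k y * (y (e k) - q (e k) y))"
    using mult.IH by blast
  define f' where "f' y = f (\<lambda>i. if i \<in> I - J then q i y else y i)" for y
  have f': "f' \<in> polyfuns I"
    unfolding f'_def
  proof (rule polyfuns_compose[OF mult.hyps(1)])
    show "(\<lambda>y. if i \<in> I - J then q i y else y i) \<in> polyfuns I" if "i \<in> I" for i
      using that q by (cases "i \<in> J") (auto intro: polyfuns.coord)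
  qed
  have "f y * g y - f' y * g (\<lambda>i. if i \<in> I - J then q i y else y i)
      = (\<Sum>k<c. (a k y * g y + f' y * b k y) * (y (e k) - q (e k) y))" for y
  proof -
    have "(\<Sum>k<c. (a k y * g y + f' y * b k y) * (y (e k) - q (e k) y)) =
        g y * (f y - f' y) + f' y * (g y - g (\<lambda>i. if i \<in> I - J then q i y else y i))"
      unfolding f'_def ab(3)[rule_format] ab(4)[rule_format] sum_distrib_left sum.distrib[symmetric]
      by (simp add: algebra_simps)
    then show ?thesis by (simp add: algebra_simps)
  qed
  then show ?case
    unfolding f'_def[symmetric] using ab(1,2) f' mult.hyps
    by (intro exI[of _ "\<lambda>k y. a k y * g y + f' y * b k y"]) (auto intro!: polyfuns_intros)
qed

text \<open>Already \<open>h = 1\<close> and \<open>m = 0\<close> work. The Jacobian contains an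
  identity block, since the right-hand sides \<open>q i\<close> involve only the coordinates in
  \<open>J\<close>.\<close>

lemma smooth_at_graph:
  assumes I: "(I, \<psi>) \<in> \<A>" "finite I" and x: "x \<in> aff_space I" and J: "J \<subseteq> I"
    and q: "\<And>i. i \<in> I - J \<Longrightarrow> q i \<in> polyfuns J"
    and X: "\<And>y. y \<in> aff_space I \<Longrightarrow> \<psi> y \<in> X \<longleftrightarrow> (\<forall>i\<in>I - J. y i = q i y)"
  shows "smooth_at \<A> X (\<psi> x)"
proof -
  have qI: "q i \<in> polyfuns I" if "i \<in> I - J" for i
    using q[OF that] J by (rule polyfuns_mono)
  obtain e where e: "bij_betw e {0..<card (I - J)} (I - J)"
    using ex_bij_betw_nat_finite I(2) by blast
  define c where "c = card (I - J)"
  note e = e[folded c_def]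
  have e': "e k \<in> I - J" if "k < c" for k using e that by (auto simp: bij_betw_def)
  define f where "f k y = y (e k) - q (e k) y" for k y
  have Xf: "\<psi> y \<in> X \<longleftrightarrow> (\<forall>k<c. f k y = 0)" if "y \<in> aff_space I" for y
  proof -
    have "(\<forall>i\<in>e ` {0..<c}. y i = q i y) \<longleftrightarrow> (\<forall>k<c. f k y = 0)" by (auto simp: f_def)
    then show ?thesis unfolding X[OF that] bij_betw_imp_surj_on[OF e] .
  qed
  have ideal: "\<exists>(m::nat) a. (\<forall>k<c. a k \<in> polyfuns I) \<and>
      (\<forall>y\<in>aff_space I. (1::complex) ^ m * g y = (\<Sum>k<c. a k y * f k y))"
    if g: "g \<in> polyfuns I" "\<forall>y\<in>aff_space I. (1::complex) \<noteq> 0 \<and> \<psi> y \<in> X \<longrightarrow> g y = 0" for g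
  proof -
    obtain a where a: "\<forall>k<c. a k \<in> polyfuns I"
      "\<forall>y. g y - g (\<lambda>i. if i \<in> I - J then q i y else y i) = (\<Sum>k<c. a k y * (y (e k) - q (e k) y))"
      using polyfun_diff_graph[OF e, of q g] qI g(1) by blast
    have "g (\<lambda>i. if i \<in> I - J then q i y else y i) = 0" if y: "y \<in> aff_space I" for y
    proof -
      let ?z = "\<lambda>i. if i \<in> I - J then q i y else y i"
      have z: "?z \<in> aff_space I" using y by (auto simp: aff_space_def)
      \<comment> \<open>\<open>q i\<close> sees only coordinates in \<open>J\<close>, which the
        substitution leaves alone.\<close>
      have "q i ?z = q i y" if "i \<in> I - J" for i
        by (rule polyfuns_cong[OF q[OF that]]) simp
      then have "\<psi> ?z \<in> X" unfolding X[OF z] by simp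
      then show ?thesis using g(2) z by auto
    qed
    then have "1 ^ 0 * g y = (\<Sum>k<c. a k y * f k y)" if "y \<in> aff_space I" for y
      using a(2)[rule_format, of y] that by (simp add: f_def)
    then show ?thesis using a(1) by blast
  qed
  have jac: "\<forall>k<c. b k = 0" if b: "\<forall>i\<in>I. (\<Sum>k<c. b k * pderiv_at (f k) i x) = 0" for b
  proof (intro allI impI)
    fix k0 assume k0: "k0 < c"
    have "pderiv_at (f k) (e k0) x = (if k = k0 then 1 else 0)" if "k < c" for k
    proof -
      have const: "q (e k) (x(e k0 := t)) = q (e k) x" for t
        by (rule polyfuns_cong[OF q[OF e'[OF that]]]) (use e'[OF k0] in auto)
      show ?thesis
      proof (cases "k = k0")
        case True
        have "((\<lambda>t. t - q (e k) x) has_field_derivative 1) (at (x (e k0)))"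
          by (auto intro!: derivative_eq_intros)
        then show ?thesis
          using True const by (simp add: pderiv_at_def f_def DERIV_imp_deriv)
      next
        case False
        then have "e k \<noteq> e k0" using e k0 that by (auto simp: bij_betw_def inj_on_def)
        then show ?thesis using False const by (simp add: pderiv_at_def f_def)
      qed
    qed
    then have "(\<Sum>k<c. b k * pderiv_at (f k) (e k0) x) = (\<Sum>k<c. b k * (if k = k0 then 1 else 0))"
      by (intro sum.cong) auto
    also have "\<dots> = (\<Sum>k<c. if k = k0 then b k0 else 0)" by (intro sum.cong) auto
    also have "\<dots> = b k0" using k0 by simp
    finally show "b k0 = 0" using b e'[OF k0] by auto
  qed
  have "\<exists>x'\<in>aff_space I. \<psi> x' = \<psi> x \<and>
       (\<exists>h\<in>polyfuns I. \<exists>(c::nat) f. h x' \<noteq> 0 \<and> (\<forall>k<c. f k \<in> polyfuns I) \<and>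
          (\<forall>y\<in>aff_space I. h y \<noteq> 0 \<longrightarrow> (\<psi> y \<in> X \<longleftrightarrow> (\<forall>k<c. f k y = 0))) \<and>
          (\<forall>g\<in>polyfuns I. (\<forall>y\<in>aff_space I. h y \<noteq> 0 \<and> \<psi> y \<in> X \<longrightarrow> g y = 0) \<longrightarrow>
             (\<exists>(m::nat) a. (\<forall>k<c. a k \<in> polyfuns I) \<and>
                (\<forall>y\<in>aff_space I. h y ^ m * g y = (\<Sum>k<c. a k y * f k y)))) \<and>
          (\<forall>b :: nat \<Rightarrow> complex. (\<forall>i\<in>I. (\<Sum>k<c. b k * pderiv_at (f k) i x') = 0) \<longrightarrow>
             (\<forall>k<c. b k = 0)))"
  proof (rule bexI[OF _ x], intro conjI refl bexI[of _ "\<lambda>_. 1"] exI[of _ c] exI[of _ f])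
    show "\<forall>k<c. f k \<in> polyfuns I"
      unfolding f_def using e' qI by (auto intro!: polyfuns_intros)
  qed (use Xf ideal jac in \<open>auto intro: polyfuns.const\<close>)
  then show ?thesis unfolding smooth_at_def using I(1) by (intro bexI[OF _ I(1)]) simp
qed


section \<open>Elimination theory on the projective line\<close>

lemma polyfuns_det:
  assumes "\<And>i j. i < N \<Longrightarrow> j < N \<Longrightarrow> (\<lambda>y. A y i j) \<in> polyfuns I"
  shows "(\<lambda>y. Determinant.det (Matrix.mat N N (\<lambda>(i, j). A y i j))) \<in> polyfuns I"
proof -
  have "Determinant.det (Matrix.mat N N (\<lambda>(i, j). A y i j)) =
      (\<Sum>p\<in>{p. p permutes {0..<N}}. signof p * (\<Prod>i\<in>{0..<N}. A y i (p i)))" for y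
    unfolding det_def'[OF mat_carrier]
  proof (intro sum.cong refl arg_cong2[of _ _ _ _ "(*)"] prod.cong)
    fix p i assume "p \<in> {p. p permutes {0..<N}}" "i \<in> {0..<N}"
    then have "i < N" "p i < N" by (auto dest: permutes_in_image)
    then show "Matrix.mat N N (\<lambda>(i, j). A y i j) $$ (i, p i) = A y i (p i)" by simp
  qed
  moreover have "(\<lambda>y. \<Sum>p\<in>{p. p permutes {0..<N}}. signof p * (\<Prod>i\<in>{0..<N}. A y i (p i))) \<in> polyfuns I"
    using assms permutes_in_image by (intro polyfuns_intros) fastforce
  ultimately show ?thesis by simp
qed

text \<open>The witness is the determinant of the Sylvester matrix.\<close>

lemma common_root_polyfun:
  fixes G F :: "('i \<Rightarrow> complex) \<Rightarrow> complex poly"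
  assumes G: "\<And>k. (\<lambda>y. coeff (G y) k) \<in> polyfuns I" "\<And>y. degree (G y) \<le> M"
    and F: "\<And>k. (\<lambda>y. coeff (F y) k) \<in> polyfuns I" "\<And>y. degree (F y) \<le> D"
    and y0: "coeff (G y0) M \<noteq> 0" "\<And>l. poly (G y0) l = 0 \<Longrightarrow> poly (F y0) l \<noteq> 0"
  shows "\<exists>h\<in>polyfuns I. h y0 \<noteq> 0 \<and> (\<forall>y l. poly (G y) l = 0 \<and> poly (F y) l = 0 \<longrightarrow> h y = 0)"
proof -
  \<comment> \<open>One shift of \<open>G\<close> more than usual, so that \<open>F\<close> counts
    as having degree \<open>Suc D\<close>. The matrix is then never empty, and invertibility asks
    only for a nonzero top coefficient of \<open>G y0\<close> besides the absence of common
    roots.\<close>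
  define N where "N = Suc D + M"
  define r where "r y i = (if i \<le> D then monom 1 i * G y else monom 1 (i - Suc D) * F y)" for y i
  define h where "h y = Determinant.det (Matrix.mat N N (\<lambda>(i, j). coeff (r y i) j))" for y
  have deg: "degree (r y i) < N" if "i < N" for y i
  proof (cases "i \<le> D")
    case True
    have "degree (monom 1 i * G y) \<le> i + M"
      using G(2) by (metis add_mono degree_monom_le degree_mult_le order_trans)
    with True show ?thesis by (simp add: r_def N_def)
  next
    case False
    have "degree (monom 1 (i - Suc D) * F y) \<le> (i - Suc D) + D"
      using F(2) by (metis add_mono degree_monom_le degree_mult_le order_trans)
    with False that show ?thesis by (simp add: r_def N_def)
  qed
  have "h \<in> polyfuns I"
    unfolding h_def
  proof (rule polyfuns_det)
    fix i j
    have 1: "(\<lambda>y. if j < i then 0 else coeff (G y) (j - i)) \<in> polyfuns I"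
      by (cases "j < i") (simp_all add: G polyfuns.const)
    have 2: "(\<lambda>y. if j < i - Suc D then 0 else coeff (F y) (j - (i - Suc D))) \<in> polyfuns I"
      by (cases "j < i - Suc D") (simp_all add: F polyfuns.const)
    show "(\<lambda>y. coeff (r y i) j) \<in> polyfuns I"
      using 1 2 by (cases "i \<le> D") (simp_all add: r_def coeff_monom_mult cong: if_cong)
  qed
  moreover have "h y0 \<noteq> 0"
  proof
    assume "h y0 = 0"
    define A where "A = Matrix.mat N N (\<lambda>(i, j). coeff (r y0 i) j)"
    have A: "A \<in> carrier_mat N N" by (simp add: A_def)
    have "Determinant.det (transpose_mat A) = 0"
      using \<open>h y0 = 0\<close> det_transpose[OF A] by (simp add: h_def A_def)
    \<comment> \<open>A linear relation among the rows is a relation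
      \<open>\<alpha> * G y0 + \<beta> * F y0 = 0\<close> in which \<open>\<alpha>\<close> has
      degree at most \<open>D\<close> and \<open>\<beta>\<close> is 0 or of degree below
      \<open>M\<close>.\<close>
    then obtain v where v: "v \<in> carrier_vec N" "v \<noteq> 0\<^sub>v N" "transpose_mat A *\<^sub>v v = 0\<^sub>v N"
      using det_0_iff_vec_prod_zero[of "transpose_mat A" N] A by auto
    define \<alpha> where "\<alpha> = (\<Sum>i<Suc D. monom (vec_index v i) i)"
    define \<beta> where "\<beta> = (\<Sum>i<M. monom (vec_index v (Suc D + i)) i)"
    have "coeff (\<Sum>i<N. Polynomial.smult (vec_index v i) (r y0 i)) j = 0" for j
    proof (cases "j < N")
      case True
      have "vec_index (transpose_mat A *\<^sub>v v) j = (\<Sum>i<N. vec_index v i * coeff (r y0 i) j)"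
        using True v(1) A by (auto simp: A_def scalar_prod_def lessThan_atLeast0 mult.commute intro!: sum.cong)
      then show ?thesis using v(3) True by (simp add: coeff_sum)
    next
      case False
      have "coeff (r y0 i) j = 0" if "i < N" for i
        by (rule coeff_eq_0) (use deg[OF that, of y0] False in linarith)
      then show ?thesis by (simp add: coeff_sum)
    qed
    then have "0 = (\<Sum>i<N. Polynomial.smult (vec_index v i) (r y0 i))"
      by (simp add: poly_eq_iff)
    also have "\<dots> = (\<Sum>i<Suc D. Polynomial.smult (vec_index v i) (r y0 i)) +
        (\<Sum>i<M. Polynomial.smult (vec_index v (Suc D + i)) (r y0 (Suc D + i)))"
      unfolding N_def by (induction M) (simp_all add: add.assoc)
    also have "\<dots> = \<alpha> * G y0 + \<beta> * F y0"
      unfolding \<alpha>_def \<beta>_def sum_distrib_right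
      by (intro arg_cong2[of _ _ _ _ "(+)"] sum.cong)
        (auto simp: r_def smult_monom simp flip: mult_smult_left)
    finally have eq: "\<alpha> * G y0 = - (\<beta> * F y0)" by (simp add: eq_neg_iff_add_eq_0)
    \<comment> \<open>Over the complex numbers coprimality is the absence of common roots. Hence
      \<open>G y0\<close> divides \<open>\<beta>\<close>, whose degree is too small unless it is
      0.\<close>
    have "coprime (G y0) (F y0)"
    proof (rule coprimeI)
      fix p assume p: "p dvd G y0" "p dvd F y0"
      have "degree p = 0"
      proof (rule ccontr)
        assume "degree p \<noteq> 0"
        then obtain l where "poly p l = 0" using alg_closed_imp_poly_has_root[of p] by blast
        then show False using p y0(2)[of l] by (metis dvdE mult_zero_left poly_mult)
      qed
      moreover have "p \<noteq> 0" using p y0(1) by auto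
      ultimately show "is_unit p" by (simp add: is_unit_iff_degree)
    qed
    moreover have "G y0 dvd \<beta> * F y0" using eq by (metis dvd_minus_iff dvd_triv_right)
    ultimately have "G y0 dvd \<beta>" by (simp add: coprime_dvd_mult_left_iff)
    moreover have "degree (G y0) = M" using G(2) y0(1) by (simp add: le_antisym le_degree)
    moreover have "\<beta> = 0 \<or> degree \<beta> < M"
    proof (cases "M = 0")
      case False
      then have "degree \<beta> \<le> M - 1"
        unfolding \<beta>_def by (intro degree_sum_le) (auto intro: order_trans[OF degree_monom_le])
      with False show ?thesis by auto
    qed (simp add: \<beta>_def)
    ultimately have \<beta>: "\<beta> = 0" by (meson dvd_imp_degree_le not_le)
    then have \<alpha>: "\<alpha> = 0" using eq y0(1) by auto
    have "vec_index v i = 0" if "i < N" for i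
    proof (cases "i \<le> D")
      case True
      then show ?thesis using arg_cong[OF \<alpha>, of "\<lambda>p. coeff p i"]
        by (simp add: \<alpha>_def coeff_sum del: sum.lessThan_Suc)
    next
      case False
      then have i: "i - Suc D < M" "Suc D + (i - Suc D) = i" using that by (auto simp: N_def)
      have "coeff \<beta> (i - Suc D) = vec_index v i"
        using i by (simp add: \<beta>_def coeff_sum)
      then show ?thesis using \<beta> by simp
    qed
    then show False using v(1,2) by auto
  qed
  moreover have "h y = 0" if l: "poly (G y) l = 0" "poly (F y) l = 0" for y l
  proof -
    define A where "A = Matrix.mat N N (\<lambda>(i, j). coeff (r y i) j)"
    have A: "A \<in> carrier_mat N N" by (simp add: A_def)
    \<comment> \<open>The powers of a common root form a kernel vector; its entry at 0 is 1.\<close>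
    define v where "v = Matrix.vec N (\<lambda>j. l ^ j)"
    have "A *\<^sub>v v = 0\<^sub>v N"
    proof (rule eq_vecI)
      fix i assume "i < dim_vec (0\<^sub>v N :: complex Matrix.vec)"
      then have i: "i < N" by simp
      have "vec_index (A *\<^sub>v v) i = (\<Sum>j<N. coeff (r y i) j * l ^ j)"
        using i by (auto simp: A_def v_def scalar_prod_def lessThan_atLeast0 intro!: sum.cong)
      also have "\<dots> = (\<Sum>j\<le>degree (r y i). coeff (r y i) j * l ^ j)"
        using deg[OF i, of y] by (intro sum.mono_neutral_right) (auto intro: coeff_eq_0)
      also have "\<dots> = poly (r y i) l" by (simp add: poly_altdef)
      also have "\<dots> = 0" using l by (simp add: r_def)
      finally show "vec_index (A *\<^sub>v v) i = vec_index (0\<^sub>v N) i" using i by simp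
    qed (simp add: A_def)
    moreover have "v \<noteq> 0\<^sub>v N"
    proof
      assume "v = 0\<^sub>v N"
      then have "vec_index v 0 = vec_index (0\<^sub>v N) 0" by simp
      then show False by (simp add: v_def N_def)
    qed
    moreover have "v \<in> carrier_vec N" by (simp add: v_def)
    ultimately show ?thesis
      unfolding h_def A_def[symmetric] det_0_iff_vec_prod_zero[OF A] by blast
  qed
  ultimately show ?thesis by blast
qed

text \<open>Points of \<open>Z\<close> outside \<open>aff_space I\<close> are disregarded, so that
  sets can be given by a condition on arbitrary functions.\<close>

definition zclosed :: "'i set \<Rightarrow> ('i \<Rightarrow> complex) set \<Rightarrow> bool" where
  "zclosed I Z \<longleftrightarrow> (\<forall>y\<in>aff_space I - Z. \<exists>h\<in>polyfuns I. h y \<noteq> 0 \<and> (\<forall>z\<in>aff_space I \<inter> Z. h z = 0))"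

text \<open>Induction on \<open>B\<close>: if \<open>f\<close> vanishes at the new point, it is
  corrected by a function that is nonzero there but vanishes at the old points, thanks to a product
  of differences of the coordinate \<open>q\<close>.\<close>

lemma zclosed_nonvanishing:
  assumes Z: "zclosed I Z" and "finite B" and "B \<subseteq> aff_space I - Z" and inj: "inj_on (\<lambda>y. y q) B" and q: "q \<in> I"
  shows "\<exists>f\<in>polyfuns I. (\<forall>y\<in>B. f y \<noteq> 0) \<and> (\<forall>z\<in>aff_space I \<inter> Z. f z = 0)"
  using assms(2,3,4)
proof (induction B)
  case empty
  show ?case by (rule bexI[of _ "\<lambda>_. 0"]) (auto intro: polyfuns.const)
next
  case (insert b B)
  obtain f where f: "f \<in> polyfuns I" "\<forall>y\<in>B. f y \<noteq> 0" "\<forall>z\<in>aff_space I \<inter> Z. f z = 0"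
    using insert by auto
  obtain g where g: "g \<in> polyfuns I" "g b \<noteq> 0" "\<forall>z\<in>aff_space I \<inter> Z. g z = 0"
    using Z insert.prems(1) unfolding zclosed_def by blast
  define k where "k y = (\<Prod>c\<in>B. y q - c q) * g y" for y
  have k: "k \<in> polyfuns I" unfolding k_def using q g by (intro polyfuns_intros)
  have "k b \<noteq> 0"
    using insert.hyps insert.prems(2) g(2) by (auto simp: k_def)
  moreover have "k y = 0" if "y \<in> B" for y using that insert.hyps(1) by (auto simp: k_def)
  ultimately have "\<forall>y\<in>insert b B. f y + (if f b = 0 then 1 else 0) * k y \<noteq> 0"
    using f(2) by auto
  moreover have "(\<lambda>y. f y + (if f b = 0 then 1 else 0) * k y) \<in> polyfuns I"
    using f(1) k by (intro polyfuns_intros)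
  ultimately show ?case
    using f(3) g(3) by (intro bexI[of _ "\<lambda>y. f y + (if f b = 0 then 1 else 0) * k y"])
      (auto simp: k_def)
qed

text \<open>
  The projective line over the affine space with coordinates \<open>I\<close> is glued from two affine lines with
  coordinate \<open>q\<close>; a closed subset is given by its traces \<open>Z\<^sub>0\<close> and \<open>Z\<^sub>1\<close> on them.
\<close>

lemma zclosed_proj_line:
  assumes q: "q \<notin> I" and Z0: "zclosed (insert q I) Z0" and Z1: "zclosed (insert q I) Z1"
    and glue: "\<And>y l. y \<in> aff_space I \<Longrightarrow> l \<noteq> 0 \<Longrightarrow> y(q := l) \<in> Z0 \<longleftrightarrow> y(q := inverse l) \<in> Z1"
  shows "zclosed I {y. (\<exists>l. y(q := l) \<in> Z0) \<or> y(q := 0) \<in> Z1}"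
  unfolding zclosed_def
proof
  have upd: "y(q := l) \<in> aff_space (insert q I)" if "y \<in> aff_space I" for y l
    using that by (auto simp: aff_space_def)
  fix y0 assume "y0 \<in> aff_space I - {y. (\<exists>l. y(q := l) \<in> Z0) \<or> y(q := 0) \<in> Z1}"
  then have y0: "y0 \<in> aff_space I" "\<And>l. y0(q := l) \<notin> Z0" "y0(q := 0) \<notin> Z1" by auto
  \<comment> \<open>\<open>Z1\<close> misses the point at infinity over \<open>y0\<close>.\<close>
  obtain f1 where f1: "f1 \<in> polyfuns (insert q I)" "f1 (y0(q := 0)) \<noteq> 0"
    "\<And>z. z \<in> aff_space (insert q I) \<Longrightarrow> z \<in> Z1 \<Longrightarrow> f1 z = 0"
    using Z1 y0(3) upd[OF y0(1)] unfolding zclosed_def by (metis DiffI IntI)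
  obtain N P where P: "\<And>y. degree (P y) \<le> N" "\<And>k. (\<lambda>y. coeff (P y) k) \<in> polyfuns I"
    "\<And>y l. f1 (y(q := l)) = poly (P y) l"
    using polyfuns_univariate[OF f1(1)] by blast
  \<comment> \<open>The reversed polynomial \<open>l ^ Suc N * poly (P y) (inverse l)\<close>. Its
    top coefficient is the value of \<open>f1\<close> at infinity, and the exponent
    \<open>Suc N\<close> in place of \<open>N\<close> adds the root 0, where \<open>glue\<close>
    says nothing.\<close>
  define G where "G y = (\<Sum>k\<le>N. monom (coeff (P y) k) (Suc N - k))" for y
  have Gdeg: "degree (G y) \<le> Suc N" for y
    unfolding G_def by (intro degree_sum_le) (auto intro: order_trans[OF degree_monom_le])
  have Gpoly: "(\<lambda>y. coeff (G y) j) \<in> polyfuns I" for j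
    unfolding G_def coeff_sum coeff_monom
  proof (rule polyfuns_sum)
    show "(\<lambda>y. if Suc N - k = j then coeff (P y) k else 0) \<in> polyfuns I" for k
      using P(2) by (cases "Suc N - k = j") (simp_all add: polyfuns.const)
  qed
  have "coeff (G y) (Suc N) = (\<Sum>k\<le>N. if k = 0 then coeff (P y) 0 else 0)" for y
    unfolding G_def coeff_sum coeff_monom by (intro sum.cong) auto
  then have Glead: "coeff (G y) (Suc N) = f1 (y(q := 0))" for y
    by (simp add: P(3) poly_0_coeff_0)
  have Groot: "poly (G y) l = 0" if y: "y \<in> aff_space I" "y(q := l) \<in> Z0" for y l
  proof (cases "l = 0")
    case True
    then show ?thesis by (auto simp: G_def poly_sum poly_monom intro!: sum.neutral)
  next
    case False
    have "poly (P y) (inverse l) = 0"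
      using glue[OF y(1) False] y upd f1(3) by (simp flip: P(3))
    then have "0 = l ^ Suc N * (\<Sum>k\<le>N. coeff (P y) k * inverse l ^ k)"
      unfolding poly_altdef
      by (subst sum.mono_neutral_right[of "{..N}" "{..degree (P y)}"]) (auto simp: P(1) coeff_eq_0)
    also have "\<dots> = poly (G y) l"
      unfolding G_def poly_sum poly_monom sum_distrib_left
    proof (rule sum.cong)
      fix k assume "k \<in> {..N}"
      then have "l ^ Suc N = l ^ (Suc N - k) * l ^ k"
        by (metis atMost_iff le_SucI le_add_diff_inverse2 power_add)
      then show "l ^ Suc N * (coeff (P y) k * inverse l ^ k) = coeff (P y) k * l ^ (Suc N - k)"
        using False by (simp add: power_inverse)
    qed simp
    finally show ?thesis by simp
  qed
  \<comment> \<open>Over \<open>y0\<close> only finitely many points are roots of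
    \<open>G y0\<close>; a function vanishing on \<open>Z0\<close> but at none of them leaves no
    common root.\<close>
  define B where "B = (\<lambda>l. y0(q := l)) ` {l. poly (G y0) l = 0}"
  have "G y0 \<noteq> 0" using Glead[of y0] f1(2) by auto
  then have "finite B" unfolding B_def by (intro finite_imageI poly_roots_finite)
  moreover have "B \<subseteq> aff_space (insert q I) - Z0" "inj_on (\<lambda>y. y q) B"
    using y0 upd by (auto simp: B_def inj_on_def)
  ultimately obtain f where f: "f \<in> polyfuns (insert q I)" "\<forall>y\<in>B. f y \<noteq> 0"
    "\<forall>z\<in>aff_space (insert q I) \<inter> Z0. f z = 0"
    using zclosed_nonvanishing[OF Z0] by blast
  obtain D F where F: "\<And>y. degree (F y) \<le> D" "\<And>k. (\<lambda>y. coeff (F y) k) \<in> polyfuns I"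
    "\<And>y l. f (y(q := l)) = poly (F y) l"
    using polyfuns_univariate[OF f(1)] by blast
  have nocommon: "poly (F y0) l \<noteq> 0" if "poly (G y0) l = 0" for l
    using f(2) that by (auto simp: B_def simp flip: F(3))
  obtain h where h: "h \<in> polyfuns I" "h y0 \<noteq> 0"
    "\<And>y l. poly (G y) l = 0 \<Longrightarrow> poly (F y) l = 0 \<Longrightarrow> h y = 0"
    using common_root_polyfun[OF Gpoly Gdeg F(2,1), of y0] Glead[of y0] f1(2) nocommon by metis
  \<comment> \<open>The top coefficient of \<open>G\<close> takes care of points at infinity,
    \<open>h\<close> of the finite ones.\<close>
  have "(\<lambda>y. coeff (G y) (Suc N) * h y) \<in> polyfuns I" using Gpoly h(1) by (intro polyfuns_intros)
  moreover have "coeff (G y) (Suc N) * h y = 0"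
    if "y \<in> aff_space I" "(\<exists>l. y(q := l) \<in> Z0) \<or> y(q := 0) \<in> Z1" for y
    using that(2)
  proof
    assume "\<exists>l. y(q := l) \<in> Z0"
    then obtain l where l: "y(q := l) \<in> Z0" by blast
    then have "poly (F y) l = 0" using f(3) upd[OF that(1)] by (simp flip: F(3))
    then show ?thesis using h(3) Groot[OF that(1) l] by simp
  next
    assume "y(q := 0) \<in> Z1"
    then show ?thesis using f1(3) upd[OF that(1)] by (simp add: Glead)
  qed
  ultimately show "\<exists>h\<in>polyfuns I. h y0 \<noteq> 0 \<and>
      (\<forall>z\<in>aff_space I \<inter> {y. (\<exists>l. y(q := l) \<in> Z0) \<or> y(q := 0) \<in> Z1}. h z = 0)"
    using h(2) f1(2) by (intro bexI[of _ "\<lambda>y. coeff (G y) (Suc N) * h y"]) (auto simp: Glead)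
qed

section \<open>Composition of rational maps and products of atlases\<close>

lemma ratvec_compose:
  assumes J: "finite J" and num: "\<forall>j\<in>J. num j \<in> polyfuns K" and h: "h \<in> polyfuns K"
    and p: "\<forall>k\<in>K. p k \<in> polyfuns I" and d: "d \<in> polyfuns I"
    and x: "d x \<noteq> 0" "h (ratvec K p d x) \<noteq> 0"
  obtains h' num' where "h' \<in> polyfuns I" "\<forall>j\<in>J. num' j \<in> polyfuns I" "h' x \<noteq> 0"
    "\<And>z. h' z \<noteq> 0 \<Longrightarrow> d z \<noteq> 0" "\<And>z. h' z \<noteq> 0 \<Longrightarrow> h (ratvec K p d z) \<noteq> 0"
    "\<And>z. h' z \<noteq> 0 \<Longrightarrow> ratvec J num h (ratvec K p d z) = ratvec J num' h' z"
proof -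
  obtain N0 g0 where g0: "g0 \<in> polyfuns I" "\<And>z. d z \<noteq> 0 \<Longrightarrow> h (ratvec K p d z) = g0 z / d z ^ N0"
    by (rule polyfuns_ratvec[OF h p d]) (rule that)
  have "\<forall>j\<in>J. \<exists>N g. g \<in> polyfuns I \<and> (\<forall>z. d z \<noteq> 0 \<longrightarrow> num j (ratvec K p d z) = g z / d z ^ N)"
  proof
    fix j assume j: "j \<in> J"
    obtain N g where "g \<in> polyfuns I" "\<And>z. d z \<noteq> 0 \<Longrightarrow> num j (ratvec K p d z) = g z / d z ^ N"
      by (rule polyfuns_ratvec[OF bspec[OF num j] p d]) (rule that)
    then show "\<exists>N g. g \<in> polyfuns I \<and> (\<forall>z. d z \<noteq> 0 \<longrightarrow> num j (ratvec K p d z) = g z / d z ^ N)"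
      by blast
  qed
  then obtain N g where g: "\<And>j. j \<in> J \<Longrightarrow> g j \<in> polyfuns I"
    "\<And>j z. j \<in> J \<Longrightarrow> d z \<noteq> 0 \<Longrightarrow> num j (ratvec K p d z) = g j z / d z ^ N j"
    by (simp only: bchoice_iff) blast
  \<comment> \<open>The numerators come with different powers of \<open>d\<close>; \<open>E\<close>
    bounds them all. The exponent \<open>Suc E\<close> below is positive, so that \<open>h'\<close>
    is nonzero only where the inner denominator is.\<close>
  define E where "E = sum N J"
  have E: "N j \<le> E" if "j \<in> J" for j unfolding E_def by (rule member_le_sum[OF that _ J]) simp
  define h' where "h' z = g0 z * d z ^ Suc E" for z
  define num' where "num' j z = g j z * d z ^ N0 * d z ^ (Suc E - N j)" for j z
  have nz: "d z \<noteq> 0" "g0 z \<noteq> 0" if "h' z \<noteq> 0" for z using that by (auto simp: h'_def)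
  show ?thesis
  proof (rule that[of h' num'])
    show "h' \<in> polyfuns I" unfolding h'_def using g0 d by (intro polyfuns_intros)
    show "\<forall>j\<in>J. num' j \<in> polyfuns I" unfolding num'_def using g d by (auto intro!: polyfuns_intros)
    show "h' x \<noteq> 0" using x g0(2)[OF x(1)] by (simp add: h'_def)
    fix z assume z: "h' z \<noteq> 0"
    show "d z \<noteq> 0" using nz z by blast
    show "h (ratvec K p d z) \<noteq> 0" using nz[OF z] g0(2) by simp
    have "num j (ratvec K p d z) / h (ratvec K p d z) = num' j z / h' z" if "j \<in> J" for j
    proof -
      have "d z ^ Suc E = d z ^ (Suc E - N j) * d z ^ N j"
        using E[OF that] by (simp flip: power_add)
      then show ?thesis
        unfolding g(2)[OF that nz(1)[OF z]] g0(2)[OF nz(1)[OF z]] num'_def h'_def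
        using nz[OF z] by (simp del: power_Suc)
    qed
    then show "ratvec J num h (ratvec K p d z) = ratvec J num' h' z"
      by (auto simp: ratvec_def)
  qed
qed

text \<open>Transitions are taken factor by factor; the product of their denominators serves as the
  common one.\<close>

lemma good_pi_atlas:
  assumes A: "finite A" and good: "\<And>a. a \<in> A \<Longrightarrow> good_atlas (\<A> a)"
  shows "good_atlas (pi_atlas A \<A>)"
  unfolding good_atlas_def
proof (intro conjI ballI allI impI)
  fix c' assume "c' \<in> pi_atlas A \<A>"
  then obtain c where c: "c \<in> (\<Pi>\<^sub>E a\<in>A. \<A> a)"
    and c': "c' = (SIGMA a:A. fst (c a), \<lambda>x. \<lambda>a\<in>A. snd (c a) (\<lambda>i. x (a, i)))"
    by (auto simp: pi_atlas_def)
  have ca: "(fst (c a), snd (c a)) \<in> \<A> a" if "a \<in> A" for a using c that by auto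
  have "finite (SIGMA a:A. fst (c a))"
    using A good_atlas_finite[OF good ca] by auto
  moreover have "inj_on (\<lambda>x. \<lambda>a\<in>A. snd (c a) (\<lambda>i. x (a, i))) (aff_space (SIGMA a:A. fst (c a)))"
  proof (rule inj_onI)
    fix x y assume xy: "x \<in> aff_space (SIGMA a:A. fst (c a))" "y \<in> aff_space (SIGMA a:A. fst (c a))"
      and eq: "(\<lambda>a\<in>A. snd (c a) (\<lambda>i. x (a, i))) = (\<lambda>a\<in>A. snd (c a) (\<lambda>i. y (a, i)))"
    have "x (a, i) = y (a, i)" for a i
    proof (cases "a \<in> A")
      case True
      have "snd (c a) (\<lambda>i. x (a, i)) = snd (c a) (\<lambda>i. y (a, i))"
        using fun_cong[OF eq, of a] True by simp
      moreover have "(\<lambda>i. x (a, i)) \<in> aff_space (fst (c a))" "(\<lambda>i. y (a, i)) \<in> aff_space (fst (c a))"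
        using xy True by (auto simp: aff_space_def)
      ultimately have "(\<lambda>i. x (a, i)) = (\<lambda>i. y (a, i))"
        by (rule inj_onD[OF good_atlas_inj[OF good[OF True] ca[OF True]]])
      then show ?thesis by (rule fun_cong)
    next
      case False
      then show ?thesis using xy by (auto simp: aff_space_def)
    qed
    then show "x = y" by auto
  qed
  ultimately show "case c' of (I, \<psi>) \<Rightarrow> finite I \<and> inj_on \<psi> (aff_space I)"
    by (simp add: c')
next
  fix I \<psi> J \<phi> x y
  assume "(I, \<psi>) \<in> pi_atlas A \<A> \<and> (J, \<phi>) \<in> pi_atlas A \<A> \<and> x \<in> aff_space I \<and> y \<in> aff_space J \<and> \<psi> x = \<phi> y"
  then obtain c b where c: "c \<in> (\<Pi>\<^sub>E a\<in>A. \<A> a)" and b: "b \<in> (\<Pi>\<^sub>E a\<in>A. \<A> a)"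
    and I: "I = (SIGMA a:A. fst (c a))" "\<psi> = (\<lambda>x. \<lambda>a\<in>A. snd (c a) (\<lambda>i. x (a, i)))"
    and J: "J = (SIGMA a:A. fst (b a))" "\<phi> = (\<lambda>x. \<lambda>a\<in>A. snd (b a) (\<lambda>i. x (a, i)))"
    and xy: "x \<in> aff_space I" "y \<in> aff_space J" "\<psi> x = \<phi> y"
    by (auto simp: pi_atlas_def)
  have "\<exists>h num. h \<in> polyfuns (fst (c a)) \<and> (\<forall>j\<in>fst (b a). num j \<in> polyfuns (fst (c a))) \<and>
      h (\<lambda>i. x (a, i)) \<noteq> 0 \<and> (\<forall>z\<in>aff_space (fst (c a)). h z \<noteq> 0 \<longrightarrow>
        snd (c a) z = snd (b a) (ratvec (fst (b a)) num h z))" if a: "a \<in> A" for a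
  proof -
    have "(fst (c a), snd (c a)) \<in> \<A> a" "(fst (b a), snd (b a)) \<in> \<A> a" using c b a by auto
    moreover have "(\<lambda>i. x (a, i)) \<in> aff_space (fst (c a))" "(\<lambda>i. y (a, i)) \<in> aff_space (fst (b a))"
      using xy a by (auto simp: aff_space_def I J)
    moreover have "snd (c a) (\<lambda>i. x (a, i)) = snd (b a) (\<lambda>i. y (a, i))"
      using fun_cong[OF xy(3), of a] a by (simp add: I J)
    ultimately show ?thesis
      using good[OF a, unfolded good_atlas_def, THEN conjunct2, rule_format,
          of "fst (c a)" "snd (c a)" "fst (b a)" "snd (b a)" "\<lambda>i. x (a, i)" "\<lambda>i. y (a, i)"]
      by simp
  qed
  then have "\<forall>a\<in>A. \<exists>h num. h \<in> polyfuns (fst (c a)) \<and> (\<forall>j\<in>fst (b a). num j \<in> polyfuns (fst (c a))) \<and>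
      h (\<lambda>i. x (a, i)) \<noteq> 0 \<and> (\<forall>z\<in>aff_space (fst (c a)). h z \<noteq> 0 \<longrightarrow>
        snd (c a) z = snd (b a) (ratvec (fst (b a)) num h z))" by (rule ballI)
  from bchoice[OF this] obtain h where "\<forall>a\<in>A. \<exists>num. h a \<in> polyfuns (fst (c a)) \<and>
      (\<forall>j\<in>fst (b a). num j \<in> polyfuns (fst (c a))) \<and>
      h a (\<lambda>i. x (a, i)) \<noteq> 0 \<and> (\<forall>z\<in>aff_space (fst (c a)). h a z \<noteq> 0 \<longrightarrow>
        snd (c a) z = snd (b a) (ratvec (fst (b a)) num (h a) z))" by (rule exE)
  from bchoice[OF this] obtain num where "\<forall>a\<in>A. h a \<in> polyfuns (fst (c a)) \<and>
      (\<forall>j\<in>fst (b a). num a j \<in> polyfuns (fst (c a))) \<and>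
      h a (\<lambda>i. x (a, i)) \<noteq> 0 \<and> (\<forall>z\<in>aff_space (fst (c a)). h a z \<noteq> 0 \<longrightarrow>
        snd (c a) z = snd (b a) (ratvec (fst (b a)) (num a) (h a) z))" by (rule exE)
  then have h: "\<And>a. a \<in> A \<Longrightarrow> h a \<in> polyfuns (fst (c a))"
    "\<And>a j. a \<in> A \<Longrightarrow> j \<in> fst (b a) \<Longrightarrow> num a j \<in> polyfuns (fst (c a))"
    "\<And>a. a \<in> A \<Longrightarrow> h a (\<lambda>i. x (a, i)) \<noteq> 0"
    "\<And>a z. a \<in> A \<Longrightarrow> z \<in> aff_space (fst (c a)) \<Longrightarrow> h a z \<noteq> 0 \<Longrightarrow>
        snd (c a) z = snd (b a) (ratvec (fst (b a)) (num a) (h a) z)"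
    by blast+
  have slice: "(\<lambda>z. f (\<lambda>i. z (a, i))) \<in> polyfuns I" if "a \<in> A" "f \<in> polyfuns (fst (c a))" for f a
    using that by (intro polyfuns_compose[OF that(2)]) (auto simp: I intro: polyfuns.coord)
  define H where "H z = (\<Prod>a\<in>A. h a (\<lambda>i. z (a, i)))" for z
  define M where "M p z = num (fst p) (snd p) (\<lambda>i. z (fst p, i)) * (\<Prod>a\<in>A - {fst p}. h a (\<lambda>i. z (a, i)))"
    for p z
  show "\<exists>h num. h \<in> polyfuns I \<and> (\<forall>j\<in>J. num j \<in> polyfuns I) \<and> h x \<noteq> 0 \<and>
          (\<forall>z\<in>aff_space I. h z \<noteq> 0 \<longrightarrow> \<psi> z = \<phi> (ratvec J num h z))"
  proof (intro exI[of _ H] exI[of _ M] conjI ballI impI)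
    show "H \<in> polyfuns I" unfolding H_def using h(1) slice by (intro polyfuns_prod) blast
    show "M j \<in> polyfuns I" if "j \<in> J" for j
    proof -
      have "fst j \<in> A" "snd j \<in> fst (b (fst j))" using that by (auto simp: J)
      then have "(\<lambda>z. num (fst j) (snd j) (\<lambda>i. z (fst j, i))) \<in> polyfuns I"
        using slice h(2) by blast
      moreover have "(\<lambda>z. \<Prod>a\<in>A - {fst j}. h a (\<lambda>i. z (a, i))) \<in> polyfuns I"
        using h(1) slice by (intro polyfuns_prod) blast
      ultimately show ?thesis unfolding M_def by (rule polyfuns.mult)
    qed
    show "H x \<noteq> 0" unfolding H_def using h(3) A by simp
    fix z assume z: "z \<in> aff_space I" "H z \<noteq> 0"
    then have nz: "h a (\<lambda>i. z (a, i)) \<noteq> 0" if "a \<in> A" for a using that A by (auto simp: H_def)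
    have "snd (c a) (\<lambda>i. z (a, i)) = snd (b a) (\<lambda>i. ratvec J M H z (a, i))" if a: "a \<in> A" for a
    proof -
      have "H z = h a (\<lambda>i. z (a, i)) * (\<Prod>a\<in>A - {a}. h a (\<lambda>i. z (a, i)))"
        unfolding H_def using A a by (rule prod.remove)
      moreover have "(\<Prod>a\<in>A - {a}. h a (\<lambda>i. z (a, i))) \<noteq> 0" using A nz by simp
      ultimately have "M (a, i) z / H z = num a i (\<lambda>i. z (a, i)) / h a (\<lambda>i. z (a, i))" for i
        by (simp add: M_def)
      then have "ratvec (fst (b a)) (num a) (h a) (\<lambda>i. z (a, i)) = (\<lambda>i. ratvec J M H z (a, i))"
        using a by (auto simp: ratvec_def J)
      moreover have "(\<lambda>i. z (a, i)) \<in> aff_space (fst (c a))" using z(1) a by (auto simp: aff_space_def I)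
      ultimately show ?thesis using h(4)[OF a] nz[OF a] by metis
    qed
    then show "\<psi> z = \<phi> (ratvec J M H z)" unfolding I J by (intro restrict_ext) blast
  qed
qed


section \<open>Coordinates and charts of Grassmannians\<close>

declare One_nat_def [simp del]

sublocale based_vector_space \<subseteq> finite_dimensional_vector_space scale "w ` {1..n}"
  by standard (simp_all add: w_independent w_span)

context based_vector_space
begin

definition co :: "nat \<Rightarrow> 'w \<Rightarrow> complex" where
  "co t v = representation (w ` {1..n}) v (w t)"

lemma co_zero [simp]: "co t 0 = 0"
  by (simp add: co_def representation_zero)

lemma co_add [simp]: "co t (u + v) = co t u + co t v"
  unfolding co_def by (subst representation_add) (simp_all add: w_independent w_span)

lemma co_diff [simp]: "co t (u - v) = co t u - co t v"
  unfolding co_def by (subst representation_diff) (simp_all add: w_independent w_span)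

lemma co_scale [simp]: "co t (c *\<^sub>W v) = c * co t v"
  unfolding co_def by (subst representation_scale) (simp_all add: w_independent w_span)

lemma co_sum [simp]: "co t (\<Sum>a\<in>A. f a) = (\<Sum>a\<in>A. co t (f a))"
  by (induction A rule: infinite_finite_induct) auto

lemma co_w: "s \<in> {1..n} \<Longrightarrow> t \<in> {1..n} \<Longrightarrow> co t (w s) = (if t = s then 1 else 0)"
  unfolding co_def using w_inj by (auto simp: representation_basis[OF w_independent] dest: inj_onD)

lemma co_sum_w: "t \<in> {1..n} \<Longrightarrow> B \<subseteq> {1..n} \<Longrightarrow>
    co t (\<Sum>i\<in>B. c i *\<^sub>W w i) = (if t \<in> B then c t else 0)"
  using finite_subset[of B "{1..n}"] by (simp add: co_w subset_iff if_distrib cong: if_cong sum.cong)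

lemma w_expansion: "(\<Sum>i\<in>{1..n}. co i v *\<^sub>W w i) = v"
proof -
  have "(\<Sum>b\<in>w ` {1..n}. representation (w ` {1..n}) v b *\<^sub>W b) = v"
    by (rule sum_representation_eq) (simp_all add: w_independent w_span)
  then show ?thesis unfolding co_def by (subst (asm) sum.reindex[OF w_inj]) simp
qed

lemma co_ext: "(\<And>t. t \<in> {1..n} \<Longrightarrow> co t u = co t v) \<Longrightarrow> u = v"
  using w_expansion[of u] w_expansion[of v] by (metis (no_types, lifting) sum.cong)

lemma co_pr: "t \<in> {1..n} \<Longrightarrow> co t (pr e v) = (if t = e then 0 else co t v)"
  unfolding pr_def co_def[symmetric] by (subst co_sum_w) auto

text \<open>The chart with index set \<open>S\<close> as a solution set of linear equations: the
  graph over the coordinates in \<open>S\<close>. Equations turn inclusions into identities of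
  matrix entries; \<open>span_rows\<close> identifies the set with the span in
  \<open>gr_atlas\<close>.\<close>

definition cell :: "nat set \<Rightarrow> (nat \<times> nat \<Rightarrow> complex) \<Rightarrow> 'w set" where
  "cell S x = {v. \<forall>t\<in>{1..n} - S. co t v = (\<Sum>s\<in>S. co s v * x (s, t))}"

definition row :: "nat set \<Rightarrow> (nat \<times> nat \<Rightarrow> complex) \<Rightarrow> nat \<Rightarrow> 'w" where
  "row S x s = w s + (\<Sum>t\<in>{1..n} - S. x (s, t) *\<^sub>W w t)"

lemma cell_cong:
  "S = S' \<Longrightarrow> (\<And>s t. s \<in> S \<Longrightarrow> t \<in> {1..n} - S \<Longrightarrow> x (s, t) = y (s, t)) \<Longrightarrow> cell S x = cell S' y"
  unfolding cell_def by simp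

lemma cellD: "v \<in> cell S x \<Longrightarrow> t \<in> {1..n} \<Longrightarrow> t \<notin> S \<Longrightarrow> co t v = (\<Sum>s\<in>S. co s v * x (s, t))"
  unfolding cell_def by blast

lemma subspace_cell: "subspace (cell S x)"
  unfolding subspace_def cell_def
  by (auto simp: distrib_right sum.distrib sum_distrib_left mult.assoc)

lemma co_row:
  assumes "S \<subseteq> {1..n}" "s \<in> S" "t \<in> {1..n}"
  shows "co t (row S x s) = (if t \<in> S then (if t = s then 1 else 0) else x (s, t))"
  using assms unfolding row_def co_add by (subst co_sum_w) (auto simp: co_w)

lemma sum_co_row:
  assumes "S \<subseteq> {1..n}" "s \<in> S"
  shows "(\<Sum>s'\<in>S. co s' (row S x s) * f s') = f s"
proof -
  have "(\<Sum>s'\<in>S. co s' (row S x s) * f s') = (\<Sum>s'\<in>S. if s' = s then f s' else 0)"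
    using assms by (intro sum.cong) (auto simp: co_row subset_iff)
  then show ?thesis using assms finite_subset[of S "{1..n}"] by simp
qed

lemma row_in_cell: "S \<subseteq> {1..n} \<Longrightarrow> s \<in> S \<Longrightarrow> row S x s \<in> cell S x"
  unfolding cell_def by (auto simp: sum_co_row co_row)

lemma cell_eqI:
  assumes "u \<in> cell S x" "v \<in> cell S x" "\<And>s. s \<in> S \<Longrightarrow> co s u = co s v"
  shows "u = v"
proof (rule co_ext)
  fix t assume "t \<in> {1..n}"
  then show "co t u = co t v"
    using cellD[OF assms(1)] cellD[OF assms(2)] assms(3) by (cases "t \<in> S") auto
qed

lemma cell_expansion:
  assumes "S \<subseteq> {1..n}" "v \<in> cell S x"
  shows "v = (\<Sum>s\<in>S. co s v *\<^sub>W row S x s)"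
proof (rule cell_eqI[OF assms(2)])
  show "(\<Sum>s\<in>S. co s v *\<^sub>W row S x s) \<in> cell S x"
    using assms(1) by (intro subspace_sum subspace_scale subspace_cell row_in_cell)
  fix s assume s: "s \<in> S"
  have "(\<Sum>s'\<in>S. co s' v * co s (row S x s')) = (\<Sum>s'\<in>S. if s' = s then co s' v else 0)"
    using assms(1) s by (intro sum.cong) (auto simp: co_row subset_iff)
  then show "co s v = co s (\<Sum>s\<in>S. co s v *\<^sub>W row S x s)"
    using s assms(1) finite_subset[of S "{1..n}"] by simp
qed

lemma cell_subset:
  assumes "S \<subseteq> {1..n}" "subspace V" "\<And>s. s \<in> S \<Longrightarrow> row S x s \<in> V"
  shows "cell S x \<subseteq> V"
proof
  fix v assume "v \<in> cell S x"
  then have "v = (\<Sum>s\<in>S. co s v *\<^sub>W row S x s)" by (rule cell_expansion[OF assms(1)])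
  moreover have "(\<Sum>s\<in>S. co s v *\<^sub>W row S x s) \<in> V"
    using assms by (intro subspace_sum subspace_scale)
  ultimately show "v \<in> V" by (rule ssubst)
qed

lemma cell_vector:
  assumes "S \<subseteq> {1..n}"
  obtains v where "v \<in> cell S x" "\<And>s. s \<in> S \<Longrightarrow> co s v = c s"
proof -
  define v where "v = (\<Sum>s\<in>S. c s *\<^sub>W row S x s)"
  have "v \<in> cell S x"
    unfolding v_def using assms by (intro subspace_sum subspace_scale subspace_cell row_in_cell)
  moreover have "co s v = c s" if s: "s \<in> S" for s
  proof -
    have "co s v = (\<Sum>s'\<in>S. if s' = s then c s' else 0)"
      unfolding v_def using assms s by (auto simp: co_row subset_iff intro!: sum.cong)
    then show ?thesis using s assms finite_subset[of S "{1..n}"] by simp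
  qed
  ultimately show ?thesis by (rule that)
qed

lemma span_rows: "S \<subseteq> {1..n} \<Longrightarrow> span (row S x ` S) = cell S x"
proof (rule span_unique)
  assume S: "S \<subseteq> {1..n}"
  show "row S x ` S \<subseteq> cell S x" using S row_in_cell by blast
  show "cell S x \<subseteq> T" if "row S x ` S \<subseteq> T" "subspace T" for T
    using that S by (intro cell_subset) auto
qed (rule subspace_cell)

lemma dim_cell:
  assumes S: "S \<subseteq> {1..n}"
  shows "dim (cell S x) = card S"
proof -
  have fin: "finite S" using S finite_subset by blast
  have inj: "inj_on (row S x) S"
  proof (rule inj_onI)
    fix s s' assume *: "s \<in> S" "s' \<in> S" "row S x s = row S x s'"
    have "s \<in> {1..n}" using * S by blast
    then have "co s (row S x s) = 1" "co s (row S x s') = (if s = s' then 1 else 0)"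
      using *(1,2) by (simp_all add: co_row[OF S])
    then show "s = s'" unfolding *(3) by (metis zero_neq_one)
  qed
  have "independent (row S x ` S)"
  proof (rule independent_if_scalars_zero)
    fix f b assume f: "(\<Sum>b\<in>row S x ` S. f b *\<^sub>W b) = 0" and "b \<in> row S x ` S"
    then obtain s where s: "s \<in> S" "b = row S x s" by blast
    have "0 = co s (\<Sum>s\<in>S. f (row S x s) *\<^sub>W row S x s)"
      using f by (simp add: sum.reindex[OF inj])
    also have "\<dots> = (\<Sum>s'\<in>S. if s' = s then f (row S x s') else 0)"
      using S s by (auto simp: co_row subset_iff intro!: sum.cong)
    also have "\<dots> = f b" using s fin by simp
    finally show "f b = 0" by simp
  qed (use fin in simp)
  then have "dim (span (row S x ` S)) = card S"
    by (metis dim_span_eq_card_independent card_image inj)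
  then show ?thesis by (simp only: span_rows[OF S])
qed

lemma cell_in_Gr: "S \<subseteq> {1..n} \<Longrightarrow> card S = m \<Longrightarrow> cell S x \<in> Gr m"
  by (simp add: Gr_def subspace_cell dim_cell)

lemma Gr_eqI: "U \<in> Gr m \<Longrightarrow> V \<in> Gr m \<Longrightarrow> U \<subseteq> V \<Longrightarrow> U = V"
  by (rule subspace_dim_equal) (auto simp: Gr_def)

lemma cell_inj:
  assumes "cell S x = cell S y" "S \<subseteq> {1..n}" "s \<in> S" "t \<in> {1..n} - S"
  shows "x (s, t) = y (s, t)"
proof -
  have "row S x s \<in> cell S y" using assms row_in_cell by blast
  then have "co t (row S x s) = (\<Sum>s'\<in>S. co s' (row S x s) * y (s', t))"
    using assms by (intro cellD) auto
  then show ?thesis using assms by (simp add: co_row sum_co_row)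
qed

lemma gr_atlas_eq:
  "gr_atlas m = {(S \<times> ({1..n} - S), cell S) | S. S \<subseteq> {1..n} \<and> card S = m}"
proof -
  have eq: "(\<lambda>x. span ((\<lambda>s. w s + (\<Sum>t\<in>{1..n} - S. x (s, t) *\<^sub>W w t)) ` S)) = cell S"
    if "S \<subseteq> {1..n}" for S
    by (intro ext span_rows[OF that, unfolded row_def[abs_def]])
  show ?thesis
    unfolding gr_atlas_def
  proof (intro Collect_cong ex_cong1)
    fix c S
    show "(c = (S \<times> ({1..n} - S),
          \<lambda>x. span ((\<lambda>s. w s + (\<Sum>t\<in>{1..n} - S. x (s, t) *\<^sub>W w t)) ` S)) \<and> S \<subseteq> {1..n} \<and> card S = m) =
        (c = (S \<times> ({1..n} - S), cell S) \<and> S \<subseteq> {1..n} \<and> card S = m)"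
    proof (cases "S \<subseteq> {1..n}")
      case True
      show ?thesis unfolding eq[OF True] by (rule refl)
    qed (simp only: simp_thms)
  qed
qed

text \<open>Numerators, over the common denominator \<open>x (a, b)\<close>, of the matrix after
  \<open>b\<close> has replaced \<open>a\<close> in the index set.\<close>

definition pivot_num :: "nat \<Rightarrow> nat \<Rightarrow> nat \<times> nat \<Rightarrow> (nat \<times> nat \<Rightarrow> complex) \<Rightarrow> complex" where
  "pivot_num a b = (\<lambda>(s, t) x.
     if s = b then (if t = a then 1 else x (a, t))
     else if t = a then - x (s, b) else x (s, t) * x (a, b) - x (s, b) * x (a, t))"

text \<open>One step of Gauss--Jordan elimination, with pivot \<open>x (a, b)\<close>.\<close>

lemma cell_pivot:
  assumes S: "S \<subseteq> {1..n}" and a: "a \<in> S" and b: "b \<in> {1..n} - S" and x: "x (a, b) \<noteq> 0"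
  defines "S' \<equiv> insert b (S - {a})"
  shows "cell S x = cell S' (ratvec (S' \<times> ({1..n} - S')) (pivot_num a b) (\<lambda>x. x (a, b)) x)"
    (is "_ = cell S' ?y")
proof (rule Gr_eqI)
  have fin: "finite S" using S finite_subset by blast
  have S': "S' \<subseteq> {1..n}" using S b by (auto simp: S'_def)
  have ab: "a \<noteq> b" using a b by auto
  have "card S' = Suc (card (S - {a}))"
    unfolding S'_def using b fin by (intro card_insert_disjoint) auto
  also have "\<dots> = card S" using a fin by (rule card.remove[symmetric, rotated])
  finally show "cell S' ?y \<in> Gr (card S)" by (intro cell_in_Gr[OF S'])
  show "cell S x \<in> Gr (card S)" by (intro cell_in_Gr[OF S]) simp
  show "cell S x \<subseteq> cell S' ?y"
  proof
    fix v assume v: "v \<in> cell S x"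
    have split: "(\<Sum>s\<in>S. co s v * x (s, t)) = co a v * x (a, t) + (\<Sum>s\<in>S - {a}. co s v * x (s, t))" for t
      using fin a by (rule sum.remove)
    have split': "(\<Sum>s\<in>S'. co s v * y (s, t)) = co b v * y (b, t) + (\<Sum>s\<in>S - {a}. co s v * y (s, t))"
      for t y
      unfolding S'_def using fin b by (intro sum.insert) auto
    \<comment> \<open>The equation for column \<open>b\<close> is solved for the coordinate
      \<open>a\<close>, which is then eliminated from the other equations.\<close>
    have cb: "co b v = co a v * x (a, b) + (\<Sum>s\<in>S - {a}. co s v * x (s, b))"
      using cellD[OF v] b split by auto
    then have ca: "co a v = (co b v - (\<Sum>s\<in>S - {a}. co s v * x (s, b))) / x (a, b)"
      using x by (simp add: field_simps)
    have y: "?y (b, a) = 1 / x (a, b)" using a b S ab by (auto simp: ratvec_def pivot_num_def S'_def)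
    have ya: "?y (s, a) = - x (s, b) / x (a, b)" if "s \<in> S - {a}" for s
      using a b S ab that by (auto simp: ratvec_def pivot_num_def S'_def)
    have yt: "?y (b, t) = x (a, t) / x (a, b)" if "t \<in> {1..n} - S" "t \<noteq> b" for t
      using a that by (auto simp: ratvec_def pivot_num_def S'_def)
    have yst: "?y (s, t) = x (s, t) - x (s, b) * x (a, t) / x (a, b)"
      if "s \<in> S - {a}" "t \<in> {1..n} - S" "t \<noteq> b" for s t
      using a b that x by (auto simp: ratvec_def pivot_num_def S'_def field_simps)
    show "v \<in> cell S' ?y"
      unfolding cell_def
    proof (intro CollectI ballI)
      fix t assume t: "t \<in> {1..n} - S'"
      show "co t v = (\<Sum>s\<in>S'. co s v * ?y (s, t))"
      proof (cases "t = a")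
        case True
        have "(\<Sum>s\<in>S - {a}. co s v * ?y (s, a)) = - (\<Sum>s\<in>S - {a}. co s v * x (s, b)) / x (a, b)"
          unfolding sum_negf[symmetric] sum_divide_distrib by (intro sum.cong) (simp_all add: ya)
        then show ?thesis unfolding split' True y ca by (simp add: diff_divide_distrib)
      next
        case False
        then have t': "t \<in> {1..n} - S" "t \<noteq> b" using t by (auto simp: S'_def)
        have sum: "(\<Sum>s\<in>S - {a}. co s v * ?y (s, t)) =
            (\<Sum>s\<in>S - {a}. co s v * x (s, t)) - (\<Sum>s\<in>S - {a}. co s v * x (s, b)) * (x (a, t) / x (a, b))"
          by (simp add: yst[OF _ t'] right_diff_distrib sum_subtractf sum_distrib_right sum_divide_distrib mult.assoc)
        have cot: "co t v = co a v * x (a, t) + (\<Sum>s\<in>S - {a}. co s v * x (s, t))"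
          using cellD[OF v] t' split by auto
        have "p * r + A = (p * q + B) * (r / q) + (A - B * (r / q))" if "q \<noteq> 0"
          for p q r A B :: complex
          using that by (simp add: distrib_right add_divide_distrib)
        from this[OF x] show ?thesis unfolding split' yt[OF t'] cb sum cot .
      qed
    qed
  qed
qed

text \<open>Exchange of indices as in Steinitz: each pivot step brings one element of
  \<open>S'\<close> into \<open>S\<close> in place of one outside \<open>S'\<close>, and the
  rational transitions are composed.\<close>

lemma cell_transition:
  assumes "S \<subseteq> {1..n}" "S' \<subseteq> {1..n}" "card S = card S'" "cell S x = cell S' y"
  defines "I \<equiv> S \<times> ({1..n} - S)" and "J \<equiv> S' \<times> ({1..n} - S')"
  shows "\<exists>h num. h \<in> polyfuns I \<and> (\<forall>j\<in>J. num j \<in> polyfuns I) \<and> h x \<noteq> 0 \<and>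
          (\<forall>z. h z \<noteq> 0 \<longrightarrow> cell S z = cell S' (ratvec J num h z))"
  using assms(1,3,4) unfolding I_def
proof (induction "card (S' - S)" arbitrary: S x rule: less_induct)
  case less
  let ?I = "S \<times> ({1..n} - S)"
  have fin: "finite S" "finite S'" using less.prems(1) assms(2) finite_subset by blast+
  show ?case
  proof (cases "S' \<subseteq> S")
    case True
    then have S: "S = S'" using fin less.prems by (metis card_subset_eq)
    have "cell S' z = cell S' (ratvec J (\<lambda>j z. z j) (\<lambda>_. 1) z)" for z
      by (rule cell_cong) (auto simp: ratvec_def J_def)
    then show ?thesis
      unfolding S J_def[symmetric]
      by (intro exI[of _ "\<lambda>_. 1"] exI[of _ "\<lambda>j z. z j"]) (auto intro: polyfuns.intros)
  next
    case False
    then obtain b where b: "b \<in> S'" "b \<notin> S" by blast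
    have bn: "b \<in> {1..n} - S" using b assms(2) by auto
    \<comment> \<open>This vector has coordinate 1 at \<open>b\<close> and 0 elsewhere on
      \<open>S'\<close>. The equation of the old chart for column \<open>b\<close> then yields a
      nonzero entry \<open>x (a, b)\<close> with \<open>co a v \<noteq> 0\<close>, which excludes
      \<open>a\<close> from \<open>S'\<close>.\<close>
    define v where "v = row S' y b"
    have v: "v \<in> cell S x" unfolding v_def less.prems(3) using row_in_cell assms(2) b by blast
    have cov: "co s v = (if s = b then 1 else 0)" if "s \<in> S'" for s
      using that assms(2) b by (auto simp: v_def co_row subset_iff)
    have "(\<Sum>s\<in>S. co s v * x (s, b)) \<noteq> 0" using cellD[OF v, of b] bn b cov by auto
    then obtain a where a: "a \<in> S" "co a v * x (a, b) \<noteq> 0" by (meson sum.neutral)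
    then have a': "a \<notin> S'" "x (a, b) \<noteq> 0" using cov[of a] b by (auto split: if_splits)
    define T where "T = insert b (S - {a})"
    let ?K = "T \<times> ({1..n} - T)"
    define x' where "x' = ratvec ?K (pivot_num a b) (\<lambda>x. x (a, b)) x"
    have piv: "cell S z = cell T (ratvec ?K (pivot_num a b) (\<lambda>x. x (a, b)) z)" if "z (a, b) \<noteq> 0" for z
      unfolding T_def by (rule cell_pivot[where x = z, OF less.prems(1) a(1) bn that])
    have T: "T \<subseteq> {1..n}" using less.prems(1) bn by (auto simp: T_def)
    have "card T = card S'"
      using dim_cell[OF less.prems(1), of x] dim_cell[OF T, of x'] piv[of x] a'(2) less.prems(2)
      by (simp add: x'_def)
    moreover have "card (S' - T) < card (S' - S)"
    proof (rule psubset_card_mono)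
      show "S' - T \<subset> S' - S" using b a' a by (auto simp: T_def)
    qed (use fin in simp)
    moreover have "cell T x' = cell S' y" using piv[of x] a'(2) less.prems(3) by (simp add: x'_def)
    ultimately obtain h num where h: "h \<in> polyfuns ?K" "\<forall>j\<in>J. num j \<in> polyfuns ?K" "h x' \<noteq> 0"
      "\<forall>z. h z \<noteq> 0 \<longrightarrow> cell T z = cell S' (ratvec J num h z)"
      using less.hyps[OF _ T, of x'] by blast
    have "\<forall>k\<in>?K. pivot_num a b k \<in> polyfuns ?I"
    proof
      fix k assume k: "k \<in> ?K"
      obtain s t where st: "k = (s, t)" by fastforce
      have "(\<lambda>x. if s = b then (if t = a then 1 else x (a, t))
         else if t = a then - x (s, b) else x (s, t) * x (a, b) - x (s, b) * x (a, t)) \<in> polyfuns ?I"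
      proof (cases "s = b")
        case True
        then show ?thesis using k st a bn
          by (cases "t = a") (auto intro!: polyfuns_intros simp: T_def)
      next
        case False
        then show ?thesis using k st a bn
          by (cases "t = a") (auto intro!: polyfuns_intros simp: T_def)
      qed
      then show "pivot_num a b k \<in> polyfuns ?I" by (simp add: pivot_num_def st)
    qed
    moreover have "(\<lambda>x. x (a, b)) \<in> polyfuns ?I" using a bn by (intro polyfuns.coord) auto
    moreover have "finite J" using fin by (simp add: J_def)
    moreover have "h (ratvec ?K (pivot_num a b) (\<lambda>x. x (a, b)) x) \<noteq> 0" using h(3) by (simp add: x'_def)
    ultimately obtain h' num' where h': "h' \<in> polyfuns ?I" "\<forall>j\<in>J. num' j \<in> polyfuns ?I" "h' x \<noteq> 0"
      "\<And>z. h' z \<noteq> 0 \<Longrightarrow> z (a, b) \<noteq> 0"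
      "\<And>z. h' z \<noteq> 0 \<Longrightarrow> h (ratvec ?K (pivot_num a b) (\<lambda>x. x (a, b)) z) \<noteq> 0"
      "\<And>z. h' z \<noteq> 0 \<Longrightarrow>
        ratvec J num h (ratvec ?K (pivot_num a b) (\<lambda>x. x (a, b)) z) = ratvec J num' h' z"
      using h(1,2) a'(2) by - (rule ratvec_compose, assumption+, rule that, assumption+)
    have "cell S z = cell S' (ratvec J num' h' z)" if "h' z \<noteq> 0" for z
      using piv[of z] h'(4)[OF that] h(4) h'(5,6)[OF that] by simp
    then show ?thesis using h'(1-3) by blast
  qed
qed

lemma good_gr_atlas: "good_atlas (gr_atlas m)"
  unfolding good_atlas_def
proof (intro conjI ballI allI impI)
  fix c assume "c \<in> gr_atlas m"
  then obtain S where S: "S \<subseteq> {1..n}" "c = (S \<times> ({1..n} - S), cell S)" by (auto simp: gr_atlas_eq)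
  have "inj_on (cell S) (aff_space (S \<times> ({1..n} - S)))"
  proof (rule inj_onI, rule ext)
    fix x y i assume *: "x \<in> aff_space (S \<times> ({1..n} - S))" "y \<in> aff_space (S \<times> ({1..n} - S))"
      "cell S x = cell S y"
    show "x i = y i"
    proof (cases "i \<in> S \<times> ({1..n} - S)")
      case True
      then show ?thesis using cell_inj[OF *(3) S(1)] by auto
    next
      case False
      then show ?thesis using *(1,2) unfolding aff_space_def mem_Collect_eq by metis
    qed
  qed
  then show "case c of (I, \<psi>) \<Rightarrow> finite I \<and> inj_on \<psi> (aff_space I)"
    using S finite_subset[OF S(1)] by simp
next
  fix I \<psi> J \<phi> x y
  assume "(I, \<psi>) \<in> gr_atlas m \<and> (J, \<phi>) \<in> gr_atlas m \<and> x \<in> aff_space I \<and> y \<in> aff_space J \<and> \<psi> x = \<phi> y"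
  then obtain S S' where *: "S \<subseteq> {1..n}" "card S = m" "I = S \<times> ({1..n} - S)" "\<psi> = cell S"
    "S' \<subseteq> {1..n}" "card S' = m" "J = S' \<times> ({1..n} - S')" "\<phi> = cell S'" "\<psi> x = \<phi> y"
    by (auto simp: gr_atlas_eq)
  then have "card S = card S'" "cell S x = cell S' y" by simp_all
  from cell_transition[OF *(1,5) this]
  obtain h num where hn: "h \<in> polyfuns (S \<times> ({1..n} - S))"
    "\<forall>j\<in>S' \<times> ({1..n} - S'). num j \<in> polyfuns (S \<times> ({1..n} - S))" "h x \<noteq> 0"
    "\<forall>z. h z \<noteq> 0 \<longrightarrow> cell S z = cell S' (ratvec (S' \<times> ({1..n} - S')) num h z)"
    by (elim exE conjE) (rule that)
  show "\<exists>h num. h \<in> polyfuns I \<and> (\<forall>j\<in>J. num j \<in> polyfuns I) \<and> h x \<noteq> 0 \<and>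
          (\<forall>z\<in>aff_space I. h z \<noteq> 0 \<longrightarrow> \<psi> z = \<phi> (ratvec J num h z))"
    unfolding *(3,4,7,8) 
    by (rule exI[of _ h], rule exI[of _ num], intro conjI hn(1,2,3) ballI impI) (rule hn(4)[rule_format])
qed

definition fam_index :: "'a set \<Rightarrow> ('a \<Rightarrow> nat set) \<Rightarrow> ('a \<times> nat \<times> nat) set" where
  "fam_index A S = (SIGMA a:A. S a \<times> ({1..n} - S a))"

definition fam :: "'a set \<Rightarrow> ('a \<Rightarrow> nat set) \<Rightarrow> ('a \<times> nat \<times> nat \<Rightarrow> complex) \<Rightarrow> 'a \<Rightarrow> 'w set" where
  "fam A S x = (\<lambda>a\<in>A. cell (S a) (\<lambda>i. x (a, i)))"

lemma fam_apply: "a \<in> A \<Longrightarrow> fam A S x a = cell (S a) (\<lambda>i. x (a, i))"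
  by (simp add: fam_def)

lemma fam_extensional: "fam A S x \<in> extensional A"
  by (simp add: fam_def)

lemma fam_cong: "(\<And>a s t. a \<in> A \<Longrightarrow> s \<in> S a \<Longrightarrow> t \<in> {1..n} - S a \<Longrightarrow> x (a, s, t) = y (a, s, t)) \<Longrightarrow>
    fam A S x = fam A S y"
  unfolding fam_def by (intro restrict_ext cell_cong) auto

text \<open>Both ambient spaces have this form, with dimensions \<open>fst\<close> on pairs and
  \<open>d\<close> on levels.\<close>

definition fam_atlas :: "'a set \<Rightarrow> ('a \<Rightarrow> nat) \<Rightarrow> ('a \<times> nat \<times> nat, 'a \<Rightarrow> 'w set) atlas" where
  "fam_atlas A m = pi_atlas A (\<lambda>a. gr_atlas (m a))"

lemma good_fam_atlas: "finite A \<Longrightarrow> good_atlas (fam_atlas A m)"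
  unfolding fam_atlas_def by (intro good_pi_atlas good_gr_atlas)

lemma fam_atlasE:
  assumes "(I, \<psi>) \<in> fam_atlas A m"
  obtains S where "\<And>a. a \<in> A \<Longrightarrow> S a \<subseteq> {1..n}" "\<And>a. a \<in> A \<Longrightarrow> card (S a) = m a"
    "I = fam_index A S" "\<psi> = fam A S"
proof -
  obtain c where c: "c \<in> (\<Pi>\<^sub>E a\<in>A. gr_atlas (m a))" "I = (SIGMA a:A. fst (c a))"
    "\<psi> = (\<lambda>x. \<lambda>a\<in>A. snd (c a) (\<lambda>i. x (a, i)))"
    using assms by (auto simp: fam_atlas_def pi_atlas_def)
  have "\<forall>a\<in>A. \<exists>S. S \<subseteq> {1..n} \<and> card S = m a \<and> c a = (S \<times> ({1..n} - S), cell S)"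
    using c(1) by (auto simp: gr_atlas_eq dest!: PiE_mem)
  then obtain S where S: "\<forall>a\<in>A. S a \<subseteq> {1..n} \<and> card (S a) = m a \<and> c a = (S a \<times> ({1..n} - S a), cell (S a))"
    by metis
  show ?thesis
  proof (rule that[of S])
    show "I = fam_index A S" using S by (auto simp: c(2) fam_index_def)
    show "\<psi> = fam A S" unfolding c(3) fam_def using S by (intro ext restrict_ext) simp
  qed (use S in auto)
qed

lemma fam_atlasI:
  assumes "\<And>a. a \<in> A \<Longrightarrow> S a \<subseteq> {1..n}" "\<And>a. a \<in> A \<Longrightarrow> card (S a) = m a"
  shows "(fam_index A S, fam A S) \<in> fam_atlas A m"
proof -
  define c where "c = (\<lambda>a\<in>A. (S a \<times> ({1..n} - S a), cell (S a)))"
  have "c \<in> (\<Pi>\<^sub>E a\<in>A. gr_atlas (m a))" using assms by (auto simp: c_def gr_atlas_eq)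
  moreover have "fam_index A S = (SIGMA a:A. fst (c a))" by (auto simp: fam_index_def c_def)
  moreover have "fam A S = (\<lambda>x. \<lambda>a\<in>A. snd (c a) (\<lambda>i. x (a, i)))"
    by (auto simp: fam_def c_def fun_eq_iff)
  ultimately show ?thesis
    unfolding fam_atlas_def pi_atlas_def by (intro CollectI exI[of _ c] conjI) simp_all
qed

lemma finite_fam_index: "finite A \<Longrightarrow> (\<And>a. a \<in> A \<Longrightarrow> S a \<subseteq> {1..n}) \<Longrightarrow> finite (fam_index A S)"
  unfolding fam_index_def by (intro finite_SigmaI finite_cartesian_product) (auto dest: finite_subset)

lemma fam_in_PiE: "(\<And>a. a \<in> A \<Longrightarrow> S a \<subseteq> {1..n}) \<Longrightarrow> (\<And>a. a \<in> A \<Longrightarrow> card (S a) = m a) \<Longrightarrow>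
    fam A S x \<in> (\<Pi>\<^sub>E a\<in>A. Gr (m a))"
  unfolding fam_def by (simp add: cell_in_Gr)

end

section \<open>One step of the tower\<close>

context based_vector_space
begin

definition stepx :: "nat \<Rightarrow> nat \<Rightarrow> (nat \<times> nat \<Rightarrow> complex) \<Rightarrow> (nat \<times> nat \<Rightarrow> complex) \<Rightarrow> complex \<Rightarrow>
    nat \<times> nat \<Rightarrow> complex" where
  "stepx a b x1 e l = (\<lambda>(s, t).
     let xa = (if t = b then l else e (a, t) + l * e (b, t))
     in if s = a then xa else x1 (s, t) - x1 (s, a) * xa)"

text \<open>
  A subspace between \<open>cell S x1\<close> and \<open>cell (S \<union> {a, b}) e\<close>, of one dimension more than the former, is
  spanned by \<open>cell S x1\<close> and a line in the plane of the rows \<open>a\<close> and \<open>b\<close> of \<open>e\<close>. In the chart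
  \<open>S \<union> {a}\<close> the line is that of row \<open>a\<close> plus \<open>l\<close> times row \<open>b\<close>, and \<open>stepx\<close> is the matrix of the
  subspace: the rows of \<open>x1\<close> are reduced by this new row.
\<close>

lemma stepx_a: "stepx a b x1 e l (a, t) = (if t = b then l else e (a, t) + l * e (b, t))"
  by (simp add: stepx_def)

lemma stepx_other: "s \<noteq> a \<Longrightarrow> stepx a b x1 e l (s, t) = x1 (s, t) - x1 (s, a) * stepx a b x1 e l (a, t)"
  by (simp add: stepx_def)

text \<open>An inclusion of cells is tested on rows. Row \<open>a\<close> of the middle space must
  lie in the large one, which leaves its entry at \<open>b\<close> free; the rows of the small space
  must lie in the middle one, which fixes the remaining rows.\<close>

lemma cell_step_iff:
  assumes T: "insert b (insert a S) \<subseteq> {1..n}" and a: "a \<notin> S" and b: "b \<notin> insert a S"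
    and sub: "cell S x1 \<subseteq> cell (insert b (insert a S)) e"
  shows "cell S x1 \<subseteq> cell (insert a S) x \<and> cell (insert a S) x \<subseteq> cell (insert b (insert a S)) e \<longleftrightarrow>
    (\<forall>s\<in>insert a S. \<forall>t\<in>{1..n} - insert a S. x (s, t) = stepx a b x1 e (x (a, b)) (s, t))"
    (is "?L1 \<and> ?L2 \<longleftrightarrow> ?R")
proof -
  let ?S = "insert a S" and ?T = "insert b (insert a S)"
  have fin: "finite S" by (rule finite_subset[of _ "{1..n}"]) (use T in auto)
  have S: "S \<subseteq> {1..n}" "?S \<subseteq> {1..n}" using T by auto
  have sumS: "(\<Sum>s\<in>?S. co s v * y (s, t)) = co a v * y (a, t) + (\<Sum>s\<in>S. co s v * y (s, t))" for v y t
    using fin a by simp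
  have sumT: "(\<Sum>s\<in>?T. co s v * y (s, t)) = co b v * y (b, t) + (\<Sum>s\<in>?S. co s v * y (s, t))" for v y t
    using fin b by simp
  have row_a: "(\<forall>t\<in>{1..n} - ?S. x (a, t) = stepx a b x1 e (x (a, b)) (a, t)) \<longleftrightarrow>
      row ?S x a \<in> cell ?T e"
  proof -
    have "(\<Sum>s\<in>?T. co s (row ?S x a) * e (s, t)) = e (a, t) + x (a, b) * e (b, t)" for t
      unfolding sumT using sum_co_row[OF S(2), of a x "\<lambda>s. e (s, t)"] T b
      by (simp add: co_row[OF S(2)])
    moreover have "co t (row ?S x a) = x (a, t)" if "t \<in> {1..n} - ?S" for t
      using that by (simp add: co_row[OF S(2)])
    ultimately have "row ?S x a \<in> cell ?T e \<longleftrightarrow> (\<forall>t\<in>{1..n} - ?T. x (a, t) = e (a, t) + x (a, b) * e (b, t))"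
      unfolding cell_def by auto
    also have "\<dots> \<longleftrightarrow> (\<forall>t\<in>{1..n} - ?S. x (a, t) = stepx a b x1 e (x (a, b)) (a, t))"
      by (auto simp: stepx_a)
    finally show ?thesis by simp
  qed
  have row_s: "(\<forall>t\<in>{1..n} - ?S. x (s, t) = x1 (s, t) - x1 (s, a) * x (a, t)) \<longleftrightarrow>
      row S x1 s \<in> cell ?S x" if s: "s \<in> S" for s
  proof -
    have "(\<Sum>s'\<in>?S. co s' (row S x1 s) * x (s', t)) = x1 (s, a) * x (a, t) + x (s, t)" for t
      unfolding sumS using sum_co_row[OF S(1) s, of x1 "\<lambda>s. x (s, t)"] T a s
      by (simp add: co_row[OF S(1)])
    moreover have "co t (row S x1 s) = x1 (s, t)" if "t \<in> {1..n} - ?S" for t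
      using that s by (simp add: co_row[OF S(1)])
    ultimately have "row S x1 s \<in> cell ?S x \<longleftrightarrow>
        (\<forall>t\<in>{1..n} - ?S. x1 (s, t) = x1 (s, a) * x (a, t) + x (s, t))"
      unfolding cell_def by auto
    also have "\<dots> \<longleftrightarrow> (\<forall>t\<in>{1..n} - ?S. x (s, t) = x1 (s, t) - x1 (s, a) * x (a, t))"
      by (intro ball_cong refl) (auto simp: algebra_simps)
    finally show ?thesis by simp
  qed
  show ?thesis
  proof
    assume L: "?L1 \<and> ?L2"
    have ra: "x (a, t) = stepx a b x1 e (x (a, b)) (a, t)" if "t \<in> {1..n} - ?S" for t
      using row_a L row_in_cell[OF S(2), of a x] that by blast
    show ?R
    proof (intro ballI)
      fix s t assume st: "s \<in> ?S" "t \<in> {1..n} - ?S"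
      show "x (s, t) = stepx a b x1 e (x (a, b)) (s, t)"
      proof (cases "s = a")
        case True
        then show ?thesis using ra st by simp
      next
        case False
        then have s: "s \<in> S" using st by simp
        have "x (s, t) = x1 (s, t) - x1 (s, a) * x (a, t)"
          using row_s[OF s] L row_in_cell[OF S(1) s, of x1] st by blast
        then show ?thesis using ra[OF st(2)] by (simp add: stepx_other[OF False])
      qed
    qed
  next
    assume R: ?R
    then have ra: "x (a, t) = stepx a b x1 e (x (a, b)) (a, t)" if "t \<in> {1..n} - ?S" for t
      using that by blast
    then have rowa: "row ?S x a \<in> cell ?T e" using row_a by blast
    have "row S x1 s \<in> cell ?S x" if s: "s \<in> S" for s
    proof -
      have "s \<noteq> a" using s a by auto
      have "x (s, t) = x1 (s, t) - x1 (s, a) * x (a, t)" if t: "t \<in> {1..n} - ?S" for t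
        using R s t stepx_other[OF \<open>s \<noteq> a\<close>, of b x1 e "x (a, b)" t] ra[OF t] by auto
      then show ?thesis using row_s[OF s] by blast
    qed
    then have L1: ?L1 by (intro cell_subset[OF S(1) subspace_cell])
    have "row ?S x s \<in> cell ?T e" if s: "s \<in> S" for s
    proof -
      let ?u = "row S x1 s"
      \<comment> \<open>Each further row of the middle space is a row of the small one minus a
        multiple of row \<open>a\<close>, hence lies in the large space.\<close>
      have "?u - co a ?u *\<^sub>W row ?S x a = row ?S x s"
      proof (rule cell_eqI)
        show "?u - co a ?u *\<^sub>W row ?S x a \<in> cell ?S x"
          using L1 s by (intro subspace_diff subspace_scale subspace_cell row_in_cell[OF S(2)])
            (auto intro: row_in_cell[OF S(1)])
        show "row ?S x s \<in> cell ?S x" using s row_in_cell[OF S(2)] by simp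
        fix s' assume "s' \<in> ?S"
        then show "co s' (?u - co a ?u *\<^sub>W row ?S x a) = co s' (row ?S x s)"
          using s a S by (auto simp: co_row subset_iff)
      qed
      moreover have "?u - co a ?u *\<^sub>W row ?S x a \<in> cell ?T e"
        using sub rowa row_in_cell[OF S(1) s, of x1] by (intro subspace_diff subspace_scale subspace_cell) auto
      ultimately show ?thesis by simp
    qed
    then have ?L2 using rowa by (intro cell_subset[OF S(2) subspace_cell]) auto
    with L1 show "?L1 \<and> ?L2" ..
  qed
qed

lemma stepx_ab: "stepx a b x1 e l (a, b) = l"
  by (simp add: stepx_a)

lemma cell_step:
  assumes "insert b (insert a S) \<subseteq> {1..n}" "a \<notin> S" "b \<notin> insert a S"
    and "cell S x1 \<subseteq> cell (insert b (insert a S)) e"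
  shows "cell S x1 \<subseteq> cell (insert a S) (stepx a b x1 e l)"
    and "cell (insert a S) (stepx a b x1 e l) \<subseteq> cell (insert b (insert a S)) e"
  using cell_step_iff[OF assms, of "stepx a b x1 e l"] by (simp_all add: stepx_ab)

text \<open>The normalized vector \<open>v\<close> is row \<open>a\<close> of the matrix of
  \<open>V\<close>, so its coordinate at \<open>b\<close> is the parameter on the line.\<close>

lemma cell_step_eq:
  assumes T: "insert b (insert a S) \<subseteq> {1..n}" and a: "a \<notin> S" and b: "b \<notin> insert a S"
    and sub: "cell S x1 \<subseteq> V" "V \<subseteq> cell (insert b (insert a S)) e" and V: "V \<in> Gr (Suc (card S))"
    and v: "v \<in> V" "\<And>s. s \<in> S \<Longrightarrow> co s v = 0" "co a v = 1"
  shows "V = cell (insert a S) (stepx a b x1 e (co b v))"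
proof -
  let ?S = "insert a S" and ?x = "stepx a b x1 e (co b v)"
  have fin: "finite S" by (rule finite_subset[of _ "{1..n}"]) (use T in auto)
  have S: "S \<subseteq> {1..n}" "?S \<subseteq> {1..n}" using T by auto
  have subT: "cell S x1 \<subseteq> cell (insert b ?S) e" using sub by blast
  note step = cell_step[OF T a b subT, of "co b v"]
  have subV: "subspace V" using V by (simp add: Gr_def)
  have row_a: "row ?S ?x a = v"
  proof (rule cell_eqI)
    show "row ?S ?x a \<in> cell (insert b ?S) e" using step(2) row_in_cell[OF S(2)] by blast
    show "v \<in> cell (insert b ?S) e" using v(1) sub(2) by blast
    fix s assume s: "s \<in> insert b ?S"
    show "co s (row ?S ?x a) = co s v"
    proof (cases "s = b")
      case True
      then show ?thesis using b T by (simp add: co_row[OF S(2)] stepx_ab)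
    next
      case False
      then have "s \<in> ?S" "s \<in> {1..n}" using s S by auto
      then show ?thesis using v(2,3) by (auto simp: co_row[OF S(2)])
    qed
  qed
  have "cell ?S ?x \<subseteq> V"
  proof (rule cell_subset[OF S(2) subV])
    fix s assume s: "s \<in> ?S"
    show "row ?S ?x s \<in> V"
    proof (cases "s = a")
      case True
      then show ?thesis using row_a v by simp
    next
      case False
      then have sS: "s \<in> S" using s by simp
      let ?u = "row S x1 s"
      have u: "?u \<in> cell S x1" by (rule row_in_cell[OF S(1) sS])
      have "?u - co a ?u *\<^sub>W row ?S ?x a = row ?S ?x s"
      proof (rule cell_eqI)
        show "?u - co a ?u *\<^sub>W row ?S ?x a \<in> cell ?S ?x"
          using step(1) u by (intro subspace_diff subspace_scale subspace_cell row_in_cell[OF S(2)]) auto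
        show "row ?S ?x s \<in> cell ?S ?x" using s row_in_cell[OF S(2)] by simp
        fix s' assume "s' \<in> ?S"
        then show "co s' (?u - co a ?u *\<^sub>W row ?S ?x a) = co s' (row ?S ?x s)"
          using sS a S by (auto simp: co_row subset_iff)
      qed
      moreover have "?u - co a ?u *\<^sub>W row ?S ?x a \<in> V"
        unfolding row_a using sub(1) u v(1) by (intro subspace_diff subspace_scale subV) auto
      ultimately show ?thesis by simp
    qed
  qed
  moreover have "cell ?S ?x \<in> Gr (Suc (card S))"
    using fin a by (intro cell_in_Gr[OF S(2)]) simp
  ultimately show ?thesis using Gr_eqI V by blast
qed

text \<open>Modulo the small space, \<open>V\<close> is a line in a plane with coordinates
  \<open>a\<close> and \<open>b\<close>. The first case is the affine part of the projective line,
  the second its point at infinity.\<close>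

lemma step_vector:
  assumes T: "insert b (insert a S) \<subseteq> {1..n}" and a: "a \<notin> S" and b: "b \<notin> insert a S"
    and sub: "cell S x1 \<subseteq> V" "V \<subseteq> cell (insert b (insert a S)) e" and V: "V \<in> Gr (Suc (card S))"
  obtains v where "v \<in> V" "\<And>s. s \<in> S \<Longrightarrow> co s v = 0" "co a v = 1"
  | v where "v \<in> V" "\<And>s. s \<in> S \<Longrightarrow> co s v = 0" "co a v = 0" "co b v = 1"
proof -
  have S: "S \<subseteq> {1..n}" using T by auto
  have subV: "subspace V" using V by (simp add: Gr_def)
  have "V \<noteq> cell S x1" using V dim_cell[OF S, of x1] by (auto simp: Gr_def)
  then obtain u where u: "u \<in> V" "u \<notin> cell S x1" using sub(1) by blast
  obtain u' where u': "u' \<in> cell S x1" "\<And>s. s \<in> S \<Longrightarrow> co s u' = co s u"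
    by (rule cell_vector[OF S, of x1 "\<lambda>s. co s u"]) (rule that)
  define v where "v = u - u'"
  have v: "v \<in> V" "v \<noteq> 0" "\<And>s. s \<in> S \<Longrightarrow> co s v = 0"
    using u u' sub(1) by (auto simp: v_def intro: subspace_diff[OF subV])
  have "co a v \<noteq> 0 \<or> co b v \<noteq> 0"
  proof (rule ccontr)
    assume *: "\<not> ?thesis"
    have "v = 0"
    proof (rule cell_eqI)
      show "v \<in> cell (insert b (insert a S)) e" using v(1) sub(2) by blast
      show "0 \<in> cell (insert b (insert a S)) e" by (rule subspace_0[OF subspace_cell])
    qed (use * v(3) in auto)
    then show False using v(2) by simp
  qed
  then consider "co a v \<noteq> 0" | "co a v = 0" "co b v \<noteq> 0" by blast
  then show ?thesis
  proof cases
    case 1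
    then show ?thesis
      using v by (intro that(1)[of "inverse (co a v) *\<^sub>W v"]) (auto intro: subspace_scale[OF subV])
  next
    case 2
    then show ?thesis
      using v by (intro that(2)[of "inverse (co b v) *\<^sub>W v"]) (auto intro: subspace_scale[OF subV])
  qed
qed


section \<open>The tower of projective lines\<close>

text \<open>
  With the conventions \<open>V\<^bsub>0,j\<^esub> = 0\<close> and \<open>V\<^bsub>i,n\<^esub> = span (w\<^sub>1, \<dots>, w\<^sub>i)\<close> all conditions on
  \<open>V\<^bsub>i,j\<^esub>\<close> become \<open>V\<^bsub>i-1,j\<^esub> \<subseteq> V\<^bsub>i,j\<^esub>\<close> and \<open>pr\<^bsub>j+1\<^esub> V\<^bsub>i,j\<^esub> \<subseteq> V\<^bsub>i,j+1\<^esub>\<close>.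
\<close>

definition ext_space :: "(nat \<times> nat \<Rightarrow> 'w set) \<Rightarrow> nat \<Rightarrow> nat \<Rightarrow> 'w set" where
  "ext_space V i j = (if i = 0 \<or> j = n then cell {1..i} (\<lambda>_. 0) else V (i, j))"

definition ext_set :: "(nat \<times> nat \<Rightarrow> nat set) \<Rightarrow> nat \<Rightarrow> nat \<Rightarrow> nat set" where
  "ext_set S i j = (if i = 0 \<or> j = n then {1..i} else S (i, j))"

text \<open>Closed under the two moves towards the boundary, so that the conditions on a space refer
  only to spaces that are present or conventional.\<close>

definition tower_index :: "(nat \<times> nat) set \<Rightarrow> bool" where
  "tower_index Q \<longleftrightarrow> (\<forall>i j. (i, j) \<in> Q \<longrightarrow> 1 \<le> i \<and> i \<le> j \<and> j < n \<and>
     (i = 1 \<or> (i - 1, j) \<in> Q) \<and> (j + 1 = n \<or> (i, j + 1) \<in> Q))"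

definition tower :: "(nat \<times> nat) set \<Rightarrow> (nat \<times> nat \<Rightarrow> 'w set) set" where
  "tower Q = {V \<in> (\<Pi>\<^sub>E q\<in>Q. Gr (fst q)). \<forall>i j. (i, j) \<in> Q \<longrightarrow>
     ext_space V (i - 1) j \<subseteq> V (i, j) \<and> pr (j + 1) ` V (i, j) \<subseteq> ext_space V i (j + 1)}"

definition admissible :: "(nat \<times> nat) set \<Rightarrow> (nat \<times> nat \<Rightarrow> nat set) \<Rightarrow> bool" where
  "admissible Q S \<longleftrightarrow> (\<forall>i j. (i, j) \<in> Q \<longrightarrow> ext_set S (i - 1) j \<subseteq> S (i, j) \<and>
     S (i, j) \<subseteq> insert (j + 1) (ext_set S i (j + 1)) \<and> card (S (i, j)) = i)"

text \<open>
  Since \<open>V\<^bsub>i-1,j\<^esub> \<subseteq> V\<^bsub>i,j\<^esub> \<subseteq> V\<^bsub>i,j+1\<^esub> + span w\<^bsub>j+1\<^esub>\<close>, a chart for \<open>V\<^bsub>i,j\<^esub>\<close> is obtained from one for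
  \<open>V\<^bsub>i-1,j\<^esub>\<close> by adding one of two indices; the matrix entry at the added and the omitted index is the
  coordinate \<open>y (i, j)\<close> on the projective line, and \<open>crd S y i j\<close> is the whole matrix of \<open>V\<^bsub>i,j\<^esub>\<close>.
\<close>

definition new_elt :: "(nat \<times> nat \<Rightarrow> nat set) \<Rightarrow> nat \<Rightarrow> nat \<Rightarrow> nat" where
  "new_elt S i j = the_elem (S (i, j) - ext_set S (i - 1) j)"

definition left_out :: "(nat \<times> nat \<Rightarrow> nat set) \<Rightarrow> nat \<Rightarrow> nat \<Rightarrow> nat" where
  "left_out S i j = the_elem (insert (j + 1) (ext_set S i (j + 1)) - S (i, j))"

text \<open>The matrix of a preimage under \<open>pr r\<close>: the index \<open>r\<close> joins the
  chart set, and its row is zero because \<open>w r\<close> itself lies in the preimage.\<close>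

definition extend_row :: "nat \<Rightarrow> (nat \<times> nat \<Rightarrow> complex) \<Rightarrow> nat \<times> nat \<Rightarrow> complex" where
  "extend_row r x = (\<lambda>(s, t). if s = r then 0 else x (s, t))"

function crd :: "(nat \<times> nat \<Rightarrow> nat set) \<Rightarrow> (nat \<times> nat \<Rightarrow> complex) \<Rightarrow> nat \<Rightarrow> nat \<Rightarrow> nat \<times> nat \<Rightarrow> complex"
  where
  \<comment> \<open>The guard \<open>n \<le> j\<close> makes \<open>i + (n - j)\<close> decrease in
    both recursive calls.\<close>
  "crd S y i j = (if i = 0 \<or> n \<le> j then (\<lambda>_. 0)
     else stepx (new_elt S i j) (left_out S i j) (crd S y (i - 1) j)
       (extend_row (j + 1) (crd S y i (j + 1))) (y (i, j)))"
  by pat_completeness auto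
termination
  by (relation "Wellfounded.measure (\<lambda>(S, y, i, j). i + (n - j))") auto

declare crd.simps [simp del]

lemma crd_boundary: "i = 0 \<or> j = n \<Longrightarrow> crd S y i j = (\<lambda>_. 0)"
  by (subst crd.simps) auto

lemma tower_indexD:
  assumes "tower_index Q" "(i, j) \<in> Q"
  shows "1 \<le> i" "i \<le> j" "j < n" "i - 1 = 0 \<or> (i - 1, j) \<in> Q" "j + 1 = n \<or> (i, j + 1) \<in> Q"
  using assms unfolding tower_index_def by fastforce+

lemma tower_index_finite: "tower_index Q \<Longrightarrow> finite Q"
  by (rule finite_subset[of _ "{1..n} \<times> {1..n}"]) (use tower_indexD in fastforce)+

text \<open>The moves to (i - 1, j) and (i, j + 1) decrease \<open>i + (n - j)\<close>; they end
  where the spaces are prescribed by convention.\<close>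

lemma tower_induct [consumes 2, case_names boundary step]:
  assumes "tower_index Q" "(i, j) \<in> Q \<or> (i = 0 \<or> j = n) \<and> i \<le> j \<and> j \<le> n"
    and "\<And>i j. i = 0 \<or> j = n \<Longrightarrow> i \<le> j \<Longrightarrow> j \<le> n \<Longrightarrow> P i j"
    and "\<And>i j. (i, j) \<in> Q \<Longrightarrow> P (i - 1) j \<Longrightarrow> P i (j + 1) \<Longrightarrow>
      (i - 1 \<noteq> 0 \<Longrightarrow> j + 1 \<noteq> n \<Longrightarrow> P (i - 1) (j + 1)) \<Longrightarrow> P i j"
  shows "P i j"
  using assms(2)
proof (induction "i + (n - j)" arbitrary: i j rule: less_induct)
  case less
  show ?case
  proof (cases "(i, j) \<in> Q")
    case True
    note Q = tower_indexD[OF assms(1) True]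
    show ?thesis
    proof (rule assms(4)[OF True])
      show "P (i - 1) j" using Q by (intro less.hyps) auto
      show "P i (j + 1)" using Q by (intro less.hyps) auto
      show "P (i - 1) (j + 1)" if "i - 1 \<noteq> 0" "j + 1 \<noteq> n"
      proof -
        have "(i - 1, j) \<in> Q" using Q that by auto
        then have "(i - 1, j + 1) \<in> Q" using tower_indexD(5)[OF assms(1)] that by auto
        then show ?thesis using Q by (intro less.hyps) auto
      qed
    qed
  next
    case False
    then show ?thesis using less.prems assms(3) by blast
  qed
qed

lemma ext_space_Q: "tower_index Q \<Longrightarrow> (i, j) \<in> Q \<Longrightarrow> ext_space V i j = V (i, j)"
  using tower_indexD[of Q i j] by (auto simp: ext_space_def)

lemma ext_set_Q: "tower_index Q \<Longrightarrow> (i, j) \<in> Q \<Longrightarrow> ext_set S i j = S (i, j)"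
  using tower_indexD[of Q i j] by (auto simp: ext_set_def)

lemma ext_set_boundary: "i = 0 \<or> j = n \<Longrightarrow> ext_set S i j = {1..i}"
  by (auto simp: ext_set_def)

lemma ext_space_boundary: "i = 0 \<or> j = n \<Longrightarrow> ext_space V i j = cell (ext_set S i j) (crd S y i j)"
  by (auto simp: ext_space_def ext_set_def crd_boundary)

text \<open>The combinatorial counterpart of containment in \<open>Wij\<close>: passing from
  \<open>j + 1\<close> to \<open>j\<close> allows only the index \<open>j + 1\<close> to come
  in.\<close>

lemma ext_set_bound:
  assumes Q: "tower_index Q" and S: "admissible Q S"
    and "(i, j) \<in> Q \<or> (i = 0 \<or> j = n) \<and> i \<le> j \<and> j \<le> n"
  shows "ext_set S i j \<subseteq> {1..i} \<union> {j + 1..n} \<and> card (ext_set S i j) = i \<and> i \<le> n"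
  using Q assms(3)
proof (induction rule: tower_induct)
  case (boundary i j)
  then show ?case by (auto simp: ext_set_boundary)
next
  case (step i j)
  have "S (i, j) \<subseteq> insert (j + 1) (ext_set S i (j + 1))" "card (S (i, j)) = i"
    using S step.hyps by (auto simp: admissible_def)
  then show ?case
    using step.IH(2) tower_indexD(1-3)[OF Q step.hyps] unfolding ext_set_Q[OF Q step.hyps]
    by (auto dest!: subsetD)
qed

text \<open>The three nested sets have \<open>i - 1\<close>, \<open>i\<close> and
  \<open>i + 1\<close> elements, so both differences are singletons and \<open>the_elem\<close>
  returns their elements.\<close>

lemma step_sets:
  assumes Q: "tower_index Q" and S: "admissible Q S" and ij: "(i, j) \<in> Q"
  defines "a \<equiv> new_elt S i j" and "b \<equiv> left_out S i j" and "S1 \<equiv> ext_set S (i - 1) j"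
  shows "S (i, j) = insert a S1" "a \<notin> S1" "b \<notin> insert a S1" "insert b (insert a S1) \<subseteq> {1..n}"
    "insert (j + 1) (ext_set S i (j + 1)) = insert b (insert a S1)" "j + 1 \<notin> ext_set S i (j + 1)"
    "card S1 = i - 1"
proof -
  note ijQ = tower_indexD[OF Q ij]
  have adm: "S1 \<subseteq> S (i, j)" "S (i, j) \<subseteq> insert (j + 1) (ext_set S i (j + 1))" "card (S (i, j)) = i"
    using S ij by (auto simp: admissible_def S1_def)
  have 1: "S1 \<subseteq> {1..i - 1} \<union> {j + 1..n}" "card S1 = i - 1"
    using ext_set_bound[OF Q S, of "i - 1" j] ijQ unfolding S1_def by linarith+
  have "(i, j + 1) \<in> Q \<or> (i = 0 \<or> j + 1 = n) \<and> i \<le> j + 1 \<and> j + 1 \<le> n" using ijQ by auto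
  from ext_set_bound[OF Q S this]
  have 2: "ext_set S i (j + 1) \<subseteq> {1..i} \<union> {j + 2..n}" "card (ext_set S i (j + 1)) = i"
    by (simp_all add: add.assoc)
  have fin: "finite S1" "finite (ext_set S i (j + 1))"
    using 1(1) 2(1) by (auto intro: finite_subset)
  have finS: "finite (S (i, j))" using adm(2) fin by (auto intro: finite_subset)
  show j: "j + 1 \<notin> ext_set S i (j + 1)" using 2(1) ijQ by auto
  show "card S1 = i - 1" by (rule 1)
  have "card (S (i, j) - S1) = 1"
    using card_Diff_subset[OF fin(1) adm(1)] adm(3) 1(2) ijQ by simp
  then obtain a' where a': "S (i, j) - S1 = {a'}" by (rule card_1_singletonE)
  then have a: "a = a'" by (simp add: a_def new_elt_def S1_def)
  show Sa: "S (i, j) = insert a S1" "a \<notin> S1" using a a' adm(1) by auto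
  have "card (insert (j + 1) (ext_set S i (j + 1)) - S (i, j)) = 1"
    using card_Diff_subset[OF finS adm(2)] adm(3) 2(2) fin j by simp
  then obtain b' where b': "insert (j + 1) (ext_set S i (j + 1)) - S (i, j) = {b'}"
    by (rule card_1_singletonE)
  then have b: "b = b'" by (simp add: b_def left_out_def)
  show "b \<notin> insert a S1" using b b' Sa by auto
  show eq: "insert (j + 1) (ext_set S i (j + 1)) = insert b (insert a S1)" using b b' Sa adm(2) by auto
  show "insert b (insert a S1) \<subseteq> {1..n}" unfolding eq[symmetric] using 2(1) ijQ by auto
qed

lemma crd_step:
  assumes "tower_index Q" "(i, j) \<in> Q"
  shows "crd S y i j = stepx (new_elt S i j) (left_out S i j) (crd S y (i - 1) j)
       (extend_row (j + 1) (crd S y i (j + 1))) (y (i, j))"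
  using tower_indexD[OF assms] by (subst crd.simps) auto

text \<open>\<open>Wij\<close> described by vanishing coordinates; the two agree for
  \<open>i \<le> j\<close> and \<open>j \<le> n\<close>.\<close>

definition Wco :: "nat \<Rightarrow> nat \<Rightarrow> 'w set" where
  "Wco i j = {v. \<forall>t. i < t \<and> t \<le> j \<longrightarrow> co t v = 0}"

text \<open>Since column \<open>r\<close> of the matrix vanishes, the cell lies in the image of
  \<open>pr r\<close>, and the preimage gains exactly the direction \<open>w r\<close>.\<close>

lemma pr_preimage_cell:
  assumes S: "S \<subseteq> {1..n}" and r: "r \<in> {1..n} - S" and x: "\<And>s. s \<in> S \<Longrightarrow> x (s, r) = 0"
  shows "{u. pr r u \<in> cell S x} = cell (insert r S) (extend_row r x)"
proof -
  have fin: "finite S" by (rule finite_subset[OF S]) simp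
  have "(\<Sum>s\<in>insert r S. co s u * extend_row r x (s, t)) = (\<Sum>s\<in>S. co s u * x (s, t))" for u t
    using fin r by (simp add: extend_row_def if_distrib sum.If_cases cong: if_cong)
      (auto intro!: sum.cong)
  moreover have "(\<Sum>s\<in>S. co s (pr r u) * x (s, t)) = (\<Sum>s\<in>S. co s u * x (s, t))" for u t
    using S r by (intro sum.cong) (auto simp: co_pr subset_iff)
  ultimately show ?thesis
    using r x unfolding cell_def by (auto simp: co_pr)
qed

text \<open>The claims must be proved together: containment in \<open>Wco\<close> makes column
  \<open>j + 1\<close> vanish, so the preimage is a cell; the inclusion for (i, j + 1) puts the
  space at (i - 1, j) into it; then \<open>cell_step\<close> applies, and containment in
  \<open>Wco\<close> is passed on. The clause for \<open>j = n\<close> supplies that inclusion at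
  the boundary.\<close>

lemma crd_chain:
  assumes Q: "tower_index Q" and S: "admissible Q S"
    and "(i, j) \<in> Q \<or> (i = 0 \<or> j = n) \<and> i \<le> j \<and> j \<le> n"
  shows "cell (ext_set S i j) (crd S y i j) \<subseteq> Wco i j \<and>
    ((i, j) \<in> Q \<or> j = n \<and> 1 \<le> i \<longrightarrow>
      cell (ext_set S (i - 1) j) (crd S y (i - 1) j) \<subseteq> cell (ext_set S i j) (crd S y i j)) \<and>
    ((i, j) \<in> Q \<longrightarrow>
      cell (ext_set S i j) (crd S y i j) \<subseteq> {u. pr (j + 1) u \<in> cell (ext_set S i (j + 1)) (crd S y i (j + 1))} \<and>
      cell (ext_set S (i - 1) j) (crd S y (i - 1) j) \<subseteq>
        {u. pr (j + 1) u \<in> cell (ext_set S i (j + 1)) (crd S y i (j + 1))} \<and>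
      {u. pr (j + 1) u \<in> cell (ext_set S i (j + 1)) (crd S y i (j + 1))} =
        cell (insert (j + 1) (ext_set S i (j + 1))) (extend_row (j + 1) (crd S y i (j + 1))))"
  using Q assms(3)
proof (induction rule: tower_induct)
  case (boundary i j)
  have "(i, j) \<notin> Q" using boundary tower_indexD[OF Q, of i j] by auto
  moreover have "cell {1..i} (\<lambda>_. 0) \<subseteq> Wco i j"
    using boundary by (auto simp: Wco_def cell_def)
  moreover have "cell {1..i - 1} (\<lambda>_. 0) \<subseteq> cell {1..i} (\<lambda>_. 0)" if "1 \<le> i"
    using that by (auto simp: cell_def)
  ultimately show ?case using boundary(1) by (auto simp: ext_set_boundary crd_boundary)
next
  case (step i j)
  note ijQ = tower_indexD[OF Q step.hyps]
  note sets = step_sets[OF Q S step.hyps]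
  define x1 x2 where "x1 = crd S y (i - 1) j" and "x2 = crd S y i (j + 1)"
  define S1 S2 where "S1 = ext_set S (i - 1) j" and "S2 = ext_set S i (j + 1)"
  define E where "E = {u. pr (j + 1) u \<in> cell S2 x2}"
  have S2: "S2 \<subseteq> {1..n}" using sets(4) unfolding sets(5)[symmetric] S2_def by simp
  have r: "j + 1 \<in> {1..n} - S2" using sets(6) ijQ by (auto simp: S2_def)
  have W2: "cell S2 x2 \<subseteq> Wco i (j + 1)" using step.IH(2) by (simp add: S2_def x2_def)
  have "x2 (s, j + 1) = 0" if "s \<in> S2" for s
  proof -
    have "row S2 x2 s \<in> Wco i (j + 1)" using W2 row_in_cell[OF S2 that] by blast
    then have "co (j + 1) (row S2 x2 s) = 0" using ijQ by (auto simp: Wco_def)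
    then show ?thesis using r that by (simp add: co_row[OF S2])
  qed
  then have E: "E = cell (insert (j + 1) S2) (extend_row (j + 1) x2)"
    unfolding E_def by (rule pr_preimage_cell[OF S2 r])
  \<comment> \<open>The detour over (i - 1, j + 1): project first, then include.\<close>
  have sub: "cell S1 x1 \<subseteq> E"
  proof (cases "i - 1 = 0")
    case True
    have "cell S1 x1 \<subseteq> {0}"
      unfolding S1_def x1_def True using co_ext[of _ 0]
      by (auto simp: ext_set_boundary crd_boundary cell_def)
    moreover have "0 \<in> E" unfolding E by (rule subspace_0[OF subspace_cell])
    ultimately show ?thesis by blast
  next
    case False
    then have Q1: "(i - 1, j) \<in> Q" using ijQ by auto
    have "cell S1 x1 \<subseteq> {u. pr (j + 1) u \<in> cell (ext_set S (i - 1) (j + 1)) (crd S y (i - 1) (j + 1))}"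
      using step.IH(1)[THEN conjunct2, THEN conjunct2] Q1 unfolding S1_def x1_def by blast
    moreover have "cell (ext_set S (i - 1) (j + 1)) (crd S y (i - 1) (j + 1)) \<subseteq> cell S2 x2"
      using step.IH(2) ijQ by (auto simp: S2_def x2_def)
    ultimately show ?thesis unfolding E_def by blast
  qed
  let ?a = "new_elt S i j" and ?b = "left_out S i j"
  have T: "insert (j + 1) S2 = insert ?b (insert ?a S1)" using sets(5) by (simp add: S1_def S2_def)
  have "cell S1 x1 \<subseteq> cell (insert ?b (insert ?a S1)) (extend_row (j + 1) x2)"
    using sub unfolding E T .
  note st = cell_step[OF sets(4,2,3)[folded S1_def] this, of "y (i, j)"]
  have eq: "cell (ext_set S i j) (crd S y i j) =
      cell (insert ?a S1) (stepx ?a ?b x1 (extend_row (j + 1) x2) (y (i, j)))"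
    unfolding ext_set_Q[OF Q step.hyps] crd_step[OF Q step.hyps] sets(1) x1_def x2_def S1_def ..
  have subE: "cell (ext_set S i j) (crd S y i j) \<subseteq> E"
    unfolding eq E T by (rule st)
  moreover have "cell S1 x1 \<subseteq> cell (ext_set S i j) (crd S y i j)"
    unfolding eq by (rule st)
  moreover have "cell (ext_set S i j) (crd S y i j) \<subseteq> Wco i j"
  proof
    fix u assume "u \<in> cell (ext_set S i j) (crd S y i j)"
    then have "pr (j + 1) u \<in> Wco i (j + 1)" using subE W2 unfolding E_def by blast
    moreover have "co t (pr (j + 1) u) = co t u" if "i < t" "t \<le> j" for t
      using that ijQ by (subst co_pr) auto
    ultimately show "u \<in> Wco i j" by (auto simp: Wco_def)
  qed
  ultimately show ?case
    using sub E by (simp add: S1_def S2_def x1_def x2_def E_def)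
qed

text \<open>Affine pieces of the tower: one free coordinate for each index, all matrices computed by
  \<open>crd\<close>.\<close>

definition phi :: "(nat \<times> nat) set \<Rightarrow> (nat \<times> nat \<Rightarrow> nat set) \<Rightarrow> (nat \<times> nat \<Rightarrow> complex) \<Rightarrow>
    nat \<times> nat \<Rightarrow> 'w set" where
  "phi Q S y = (\<lambda>q\<in>Q. cell (S q) (crd S y (fst q) (snd q)))"

lemma ext_space_phi:
  assumes Q: "tower_index Q" and "(i, j) \<in> Q \<or> i = 0 \<or> j = n"
  shows "ext_space (phi Q S y) i j = cell (ext_set S i j) (crd S y i j)"
proof (cases "(i, j) \<in> Q")
  case True
  then show ?thesis by (simp add: ext_space_Q[OF Q] ext_set_Q[OF Q] phi_def)
next
  case False
  then show ?thesis using assms(2) ext_space_boundary by blast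
qed

lemma admissible_sets:
  assumes "tower_index Q" "admissible Q S" "q \<in> Q"
  shows "S q \<subseteq> {1..n}" "card (S q) = fst q"
  using step_sets(1,4)[OF assms(1,2), of "fst q" "snd q"] assms(2,3)
  by (auto simp: admissible_def simp del: fst_conv) (metis prod.collapse)+

lemma phi_in_tower:
  assumes Q: "tower_index Q" and S: "admissible Q S"
  shows "phi Q S y \<in> tower Q"
proof -
  have "phi Q S y \<in> (\<Pi>\<^sub>E q\<in>Q. Gr (fst q))"
    unfolding phi_def by (intro restrict_PiE_iff[THEN iffD2] ballI cell_in_Gr admissible_sets[OF Q S])
  moreover have "ext_space (phi Q S y) (i - 1) j \<subseteq> phi Q S y (i, j) \<and>
      pr (j + 1) ` phi Q S y (i, j) \<subseteq> ext_space (phi Q S y) i (j + 1)" if ij: "(i, j) \<in> Q" for i j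
  proof -
    note ijQ = tower_indexD[OF Q ij]
    have "ext_space (phi Q S y) (i - 1) j = cell (ext_set S (i - 1) j) (crd S y (i - 1) j)"
      using ijQ by (intro ext_space_phi[OF Q]) auto
    moreover have "ext_space (phi Q S y) i (j + 1) = cell (ext_set S i (j + 1)) (crd S y i (j + 1))"
      using ijQ by (intro ext_space_phi[OF Q]) auto
    moreover have "phi Q S y (i, j) = cell (ext_set S i j) (crd S y i j)"
      using ij by (simp add: phi_def ext_set_Q[OF Q])
    ultimately show ?thesis using crd_chain[OF Q S, of i j y] ij by auto
  qed
  ultimately show ?thesis unfolding tower_def by blast
qed

text \<open>Inside an ambient chart with admissible sets the tower is a graph over the entries at
  \<open>new_elt\<close> and \<open>left_out\<close>. From the boundary inwards,
  \<open>cell_step_iff\<close> determines every other entry.\<close>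

lemma fam_in_tower_iff:
  assumes Q: "tower_index Q" and S: "admissible Q S"
  defines "y x \<equiv> \<lambda>(i, j). x ((i, j), new_elt S i j, left_out S i j)"
  shows "fam Q S x \<in> tower Q \<longleftrightarrow> (\<forall>i j. (i, j) \<in> Q \<longrightarrow>
    (\<forall>s\<in>S (i, j). \<forall>t\<in>{1..n} - S (i, j). x ((i, j), s, t) = crd S (y x) i j (s, t)))"
proof
  assume R: "\<forall>i j. (i, j) \<in> Q \<longrightarrow>
    (\<forall>s\<in>S (i, j). \<forall>t\<in>{1..n} - S (i, j). x ((i, j), s, t) = crd S (y x) i j (s, t))"
  have "fam Q S x = phi Q S (y x)"
    unfolding fam_def phi_def using R by (intro restrict_ext cell_cong) auto
  then show "fam Q S x \<in> tower Q" using phi_in_tower[OF Q S] by simp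
next
  assume V: "fam Q S x \<in> tower Q"
  have main: "ext_space (fam Q S x) i j = cell (ext_set S i j) (crd S (y x) i j) \<and>
     ((i, j) \<in> Q \<longrightarrow> (\<forall>s\<in>S (i, j). \<forall>t\<in>{1..n} - S (i, j). x ((i, j), s, t) = crd S (y x) i j (s, t)))"
    if "(i, j) \<in> Q \<or> (i = 0 \<or> j = n) \<and> i \<le> j \<and> j \<le> n" for i j
    using Q that
  proof (induction rule: tower_induct)
    case (boundary i j)
    then have "(i, j) \<notin> Q" using tower_indexD[OF Q, of i j] by auto
    with boundary show ?case using ext_space_boundary by blast
  next
    case (step i j)
    note sets = step_sets[OF Q S step.hyps]
    let ?a = "new_elt S i j" and ?b = "left_out S i j"
    let ?e = "extend_row (j + 1) (crd S (y x) i (j + 1))"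
    have Vij: "fam Q S x (i, j) = cell (insert ?a (ext_set S (i - 1) j)) (\<lambda>p. x ((i, j), p))"
      using step.hyps sets(1) by (simp add: fam_apply)
    have t: "ext_space (fam Q S x) (i - 1) j \<subseteq> fam Q S x (i, j)"
      "pr (j + 1) ` fam Q S x (i, j) \<subseteq> ext_space (fam Q S x) i (j + 1)"
      using V step.hyps by (auto simp: tower_def)
    have chain: "cell (ext_set S (i - 1) j) (crd S (y x) (i - 1) j) \<subseteq>
        {u. pr (j + 1) u \<in> cell (ext_set S i (j + 1)) (crd S (y x) i (j + 1))}"
      "{u. pr (j + 1) u \<in> cell (ext_set S i (j + 1)) (crd S (y x) i (j + 1))} =
        cell (insert ?b (insert ?a (ext_set S (i - 1) j))) ?e"
      using crd_chain[OF Q S, of i j "y x"] step.hyps sets(5) by auto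
    have "cell (ext_set S (i - 1) j) (crd S (y x) (i - 1) j) \<subseteq> fam Q S x (i, j)"
      using t(1) step.IH(1) by simp
    moreover have "fam Q S x (i, j) \<subseteq> cell (insert ?b (insert ?a (ext_set S (i - 1) j))) ?e"
      using t(2) step.IH(2) unfolding chain(2)[symmetric] by auto
    ultimately have "\<forall>s\<in>S (i, j). \<forall>t\<in>{1..n} - S (i, j).
        x ((i, j), s, t) = stepx ?a ?b (crd S (y x) (i - 1) j) ?e (x ((i, j), ?a, ?b)) (s, t)"
      unfolding Vij sets(1)
      using cell_step_iff[OF sets(4,2,3) chain(1)[unfolded chain(2)], of "\<lambda>p. x ((i, j), p)"] by blast
    then have eq: "\<forall>s\<in>S (i, j). \<forall>t\<in>{1..n} - S (i, j). x ((i, j), s, t) = crd S (y x) i j (s, t)"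
      unfolding crd_step[OF Q step.hyps] by (simp add: y_def)
    then have "fam Q S x (i, j) = cell (S (i, j)) (crd S (y x) i j)"
      unfolding fam_apply[OF step.hyps] by (intro cell_cong) auto
    with eq show ?case by (simp add: ext_space_Q[OF Q step.hyps] ext_set_Q[OF Q step.hyps])
  qed
  then show "\<forall>i j. (i, j) \<in> Q \<longrightarrow>
    (\<forall>s\<in>S (i, j). \<forall>t\<in>{1..n} - S (i, j). x ((i, j), s, t) = crd S (y x) i j (s, t))" by blast
qed

lemma crd_new_elt: "tower_index Q \<Longrightarrow> (i, j) \<in> Q \<Longrightarrow> crd S y i j (new_elt S i j, left_out S i j) = y (i, j)"
  by (simp add: crd_step stepx_ab)

lemma crd_polyfun:
  assumes Q: "tower_index Q" and "(i, j) \<in> Q \<or> (i = 0 \<or> j = n) \<and> i \<le> j \<and> j \<le> n"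
  shows "(\<lambda>y. crd S y i j p) \<in> polyfuns Q"
proof -
  have "\<forall>p. (\<lambda>y. crd S y i j p) \<in> polyfuns Q"
    using assms
  proof (induction rule: tower_induct)
    case (boundary i j)
    then show ?case by (simp add: crd_boundary polyfuns.const)
  next
    case (step i j)
    let ?e = "\<lambda>y. extend_row (j + 1) (crd S y i (j + 1))"
    have e: "(\<lambda>y. ?e y p) \<in> polyfuns Q" for p
      using step.IH(2) by (cases p, cases "fst p = j + 1") (auto simp: extend_row_def polyfuns.const)
    have y: "(\<lambda>y. y (i, j)) \<in> polyfuns Q" using step.hyps by (rule polyfuns.coord)
    have a: "(\<lambda>y. stepx a b (crd S y (i - 1) j) (?e y) (y (i, j)) (a, t)) \<in> polyfuns Q" for a b t
      unfolding stepx_a using e y by (cases "t = b") (auto intro!: polyfuns_intros)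
    have "(\<lambda>y. stepx a b (crd S y (i - 1) j) (?e y) (y (i, j)) (s, t)) \<in> polyfuns Q" for a b s t
    proof (cases "s = a")
      case False
      show ?thesis
        unfolding stepx_other[OF False] using step.IH(1) a by (auto intro!: polyfuns_intros)
    qed (use a in simp)
    then show ?case by (auto simp: crd_step[OF Q step.hyps])
  qed
  then show ?thesis by blast
qed

lemma ext_set_cong:
  "tower_index Q \<Longrightarrow> (\<And>q. q \<in> Q \<Longrightarrow> S q = S' q) \<Longrightarrow> (i, j) \<in> Q \<or> i = 0 \<or> j = n \<Longrightarrow>
    ext_set S i j = ext_set S' i j"
  by (auto simp: ext_set_def)

lemma crd_cong:
  assumes Q: "tower_index Q" and S: "\<And>q. q \<in> Q \<Longrightarrow> S q = S' q" and y: "\<And>q. q \<in> Q \<Longrightarrow> y q = y' q"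
    and "(i, j) \<in> Q \<or> (i = 0 \<or> j = n) \<and> i \<le> j \<and> j \<le> n"
  shows "crd S y i j = crd S' y' i j"
  using Q assms(4)
proof (induction rule: tower_induct)
  case (boundary i j)
  then show ?case by (simp add: crd_boundary)
next
  case (step i j)
  note ijQ = tower_indexD[OF Q step.hyps]
  have "ext_set S (i - 1) j = ext_set S' (i - 1) j" "ext_set S i (j + 1) = ext_set S' i (j + 1)"
    using ijQ by (auto intro!: ext_set_cong[OF Q S])
  then have "new_elt S i j = new_elt S' i j" "left_out S i j = left_out S' i j"
    using S[OF step.hyps] by (simp_all add: new_elt_def left_out_def)
  then show ?case using step.IH(1,2) y[OF step.hyps] by (simp add: crd_step[OF Q step.hyps])
qed

text \<open>The spaces have matrices in the charts \<open>S\<close> by assumption, and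
  \<open>fam_in_tower_iff\<close> forces these to be the ones computed by
  \<open>crd\<close>.\<close>

lemma fam_eq_phi:
  assumes Q: "tower_index Q" and S: "admissible Q S" and V: "V \<in> tower Q"
    and "\<And>q. q \<in> Q \<Longrightarrow> V q \<in> range (cell (S q))"
  obtains y where "V = phi Q S y"
proof -
  have "\<forall>q\<in>Q. \<exists>x. V q = cell (S q) x" using assms(4) by blast
  from bchoice[OF this] obtain x where x: "\<And>q. q \<in> Q \<Longrightarrow> V q = cell (S q) (x q)" by blast
  define x' where "x' = (\<lambda>(q, p). x q p)"
  have "V \<in> extensional Q" using V by (auto simp: tower_def PiE_def)
  then have Vx: "V = fam Q S x'"
    by (intro extensionalityI[OF _ fam_extensional]) (auto simp: fam_apply x x'_def)
  define y where "y = (\<lambda>(i, j). x' ((i, j), new_elt S i j, left_out S i j))"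
  have "fam Q S x' = phi Q S y"
    using fam_in_tower_iff[OF Q S, of x'] V unfolding Vx fam_def phi_def y_def
    by (intro restrict_ext cell_cong) auto
  then show ?thesis using that Vx by blast
qed

end

section \<open>Adding one index to the tower: fibres, gluing and charts\<close>

context based_vector_space
begin

lemma towerD:
  assumes "V \<in> tower Q" "(i, j) \<in> Q"
  shows "V (i, j) \<in> Gr i" "ext_space V (i - 1) j \<subseteq> V (i, j)" "pr (j + 1) ` V (i, j) \<subseteq> ext_space V i (j + 1)"
proof -
  have "V \<in> (\<Pi>\<^sub>E q\<in>Q. Gr (fst q))" using assms(1) unfolding tower_def by blast
  from PiE_mem[OF this assms(2)] show "V (i, j) \<in> Gr i" by simp
qed (use assms in \<open>auto simp: tower_def\<close>)

lemma tower_undefined: "V \<in> tower Q \<Longrightarrow> q \<notin> Q \<Longrightarrow> V q = undefined"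
  unfolding tower_def by (elim CollectE conjE) (rule PiE_arb)

text \<open>A missing index with least \<open>i + (n - j)\<close> has each neighbour in
  \<open>Q\<close> or at the boundary.\<close>

lemma tower_index_insert:
  assumes Q: "tower_index Q" and Q': "tower_index Q'" and sub: "Q \<subset> Q'"
  obtains q where "q \<in> Q' - Q" "tower_index (insert q Q)"
proof -
  define m where "m q = fst q + (n - snd q)" for q :: "nat \<times> nat"
  obtain q where q: "q \<in> Q' - Q" "\<And>p. p \<in> Q' - Q \<Longrightarrow> m q \<le> m p"
    using sub exists_least_iff[of "\<lambda>c. \<exists>q\<in>Q' - Q. m q = c"] by (metis DiffI not_le psubset_imp_ex_mem)
  obtain i j where ij: "q = (i, j)" by fastforce
  have "(i, j) \<in> Q'" using q ij by simp
  note D = tower_indexD[OF Q' this]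
  have "(i - 1, j) \<in> Q" if "i \<noteq> 1"
  proof (rule ccontr)
    assume "(i - 1, j) \<notin> Q"
    then have "m q \<le> m (i - 1, j)" using q(2) D that by auto
    then show False using D(1) by (simp add: m_def ij)
  qed
  moreover have "(i, j + 1) \<in> Q" if "j + 1 \<noteq> n"
  proof (rule ccontr)
    assume "(i, j + 1) \<notin> Q"
    then have "m q \<le> m (i, j + 1)" using q(2) D that by auto
    then show False using D(3) by (simp add: m_def ij)
  qed
  ultimately have "tower_index (insert q Q)"
    using Q D(1-3) unfolding tower_index_def ij by fastforce
  then show ?thesis using that q(1) by blast
qed

lemma ext_space_restrict:
  "(i, j) \<in> Q \<or> i = 0 \<or> j = n \<Longrightarrow> ext_space (restrict V Q) i j = ext_space V i j"
  by (auto simp: ext_space_def)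

lemma tower_restrict:
  assumes Q: "tower_index Q" and V: "V \<in> tower Q'" and sub: "Q \<subseteq> Q'"
  shows "restrict V Q \<in> tower Q"
proof -
  have "restrict V Q \<in> (\<Pi>\<^sub>E q\<in>Q. Gr (fst q))"
    using V sub by (intro restrict_PiE_iff[THEN iffD2]) (auto simp: tower_def)
  moreover have "ext_space (restrict V Q) (i - 1) j \<subseteq> restrict V Q (i, j) \<and>
      pr (j + 1) ` restrict V Q (i, j) \<subseteq> ext_space (restrict V Q) i (j + 1)" if ij: "(i, j) \<in> Q" for i j
  proof -
    have "ext_space (restrict V Q) (i - 1) j = ext_space V (i - 1) j"
      "ext_space (restrict V Q) i (j + 1) = ext_space V i (j + 1)"
      using tower_indexD(4,5)[OF Q ij] by (auto intro!: ext_space_restrict)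
    moreover have "(i, j) \<in> Q'" using ij sub by blast
    ultimately show ?thesis using towerD(2,3)[OF V, of i j] ij by simp
  qed
  ultimately show ?thesis unfolding tower_def by blast
qed

text \<open>The enlarged set at (i, j + 1) has \<open>i + 1\<close> elements and contains the
  \<open>i - 1\<close> elements at (i - 1, j); the two left over label the homogeneous coordinates
  of the new line.\<close>

lemma step_choice:
  assumes Q: "tower_index Q" and Q': "tower_index (insert (i, j) Q)" and new: "(i, j) \<notin> Q"
    and S: "admissible Q S"
  obtains a b where "insert (j + 1) (ext_set S i (j + 1)) = insert b (insert a (ext_set S (i - 1) j))"
    "a \<notin> ext_set S (i - 1) j" "b \<notin> insert a (ext_set S (i - 1) j)"
proof -
  note D = tower_indexD[OF Q', of i j, simplified]
  have D1: "i - 1 = 0 \<or> (i - 1, j) \<in> Q" and D2: "j + 1 = n \<or> (i, j + 1) \<in> Q" using D by auto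
  let ?S1 = "ext_set S (i - 1) j" and ?S2 = "ext_set S i (j + 1)"
  have "(i - 1, j) \<in> Q \<or> (i - 1 = 0 \<or> j = n) \<and> i - 1 \<le> j \<and> j \<le> n" using D D1 by auto
  from ext_set_bound[OF Q S this] have S1: "card ?S1 = i - 1" "?S1 \<subseteq> {1..i - 1} \<union> {j + 1..n}" by auto
  have "(i, j + 1) \<in> Q \<or> (i = 0 \<or> j + 1 = n) \<and> i \<le> j + 1 \<and> j + 1 \<le> n" using D D2 by auto
  from ext_set_bound[OF Q S this] have S2: "card ?S2 = i" "?S2 \<subseteq> {1..i} \<union> {j + 1 + 1..n}" by auto
  have fin: "finite ?S1" "finite ?S2" using S1(2) S2(2) by (auto intro: finite_subset)
  have "?S1 \<subseteq> insert (j + 1) ?S2"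
  proof (cases "i - 1 = 0")
    case True
    then have "i = 1" using D(1) by simp
    then show ?thesis by (simp add: ext_set_def)
  next
    case False
    then have Q1: "(i - 1, j) \<in> Q" using D1 by auto
    then have "?S1 \<subseteq> insert (j + 1) (ext_set S (i - 1) (j + 1))"
      using S by (auto simp: admissible_def ext_set_Q[OF Q])
    moreover have "ext_set S (i - 1) (j + 1) \<subseteq> ?S2"
    proof (cases "j + 1 = n")
      case True
      then show ?thesis by (auto simp: ext_set_boundary)
    next
      case False
      then have "(i, j + 1) \<in> Q" using D2 by auto
      then show ?thesis using S by (auto simp: admissible_def ext_set_Q[OF Q])
    qed
    ultimately show ?thesis by blast
  qed
  moreover have "j + 1 \<notin> ?S2" using S2(2) D(2) by auto
  ultimately have "card (insert (j + 1) ?S2 - ?S1) = 2"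
    using fin S1(1) S2(1) D(1) by (simp add: card_Diff_subset)
  then obtain a b where ab: "insert (j + 1) ?S2 - ?S1 = {a, b}" "a \<noteq> b" by (meson card_2_iff)
  show ?thesis
    by (rule that[of b a]) (use ab \<open>?S1 \<subseteq> insert (j + 1) ?S2\<close> in auto)
qed

context
  fixes Q i j S a b
  assumes Q: "tower_index Q" and Q': "tower_index (insert (i, j) Q)" and new: "(i, j) \<notin> Q"
    and S: "admissible Q S"
    and ab: "insert (j + 1) (ext_set S i (j + 1)) = insert b (insert a (ext_set S (i - 1) j))"
      "a \<notin> ext_set S (i - 1) j" "b \<notin> insert a (ext_set S (i - 1) j)"
begin

private lemma D: "1 \<le> i" "i \<le> j" "j < n" "i - 1 = 0 \<or> (i - 1, j) \<in> Q" "j + 1 = n \<or> (i, j + 1) \<in> Q"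
  using tower_indexD[OF Q', of i j] by auto

private lemma ext_set_new:
  "(p, r) \<in> Q \<or> p = 0 \<or> r = n \<Longrightarrow> ext_set (S((i, j) := A)) p r = ext_set S p r"
  using new by (auto simp: ext_set_def)

text \<open>The hypotheses of the context are symmetric in \<open>a\<close> and \<open>b\<close>, so
  this lemma and those that follow serve both charts of the new line.\<close>

lemma admissible_step: "admissible (insert (i, j) Q) (S((i, j) := insert a (ext_set S (i - 1) j)))"
    (is "admissible _ ?S'")
  unfolding admissible_def
proof (intro allI impI)
  fix p r assume pr: "(p, r) \<in> insert (i, j) Q"
  show "ext_set ?S' (p - 1) r \<subseteq> ?S' (p, r) \<and> ?S' (p, r) \<subseteq> insert (r + 1) (ext_set ?S' p (r + 1)) \<and>
      card (?S' (p, r)) = p"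
  proof (cases "(p, r) = (i, j)")
    case True
    have "(i - 1, j) \<in> Q \<or> (i - 1 = 0 \<or> j = n) \<and> i - 1 \<le> j \<and> j \<le> n" using D by auto
    from ext_set_bound[OF Q S this] have "card (ext_set S (i - 1) j) = i - 1" "finite (ext_set S (i - 1) j)"
      by (auto intro: finite_subset[of _ "{1..i - 1} \<union> {j + 1..n}"])
    moreover have "ext_set ?S' (i - 1) j = ext_set S (i - 1) j" "ext_set ?S' i (j + 1) = ext_set S i (j + 1)"
      using D by (auto intro!: ext_set_new)
    ultimately show ?thesis using True ab D(1) by auto
  next
    case False
    then have Qpr: "(p, r) \<in> Q" using pr by blast
    have "ext_set ?S' (p - 1) r = ext_set S (p - 1) r" "ext_set ?S' p (r + 1) = ext_set S p (r + 1)"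
      using tower_indexD(4,5)[OF Q Qpr] by (auto intro!: ext_set_new)
    then show ?thesis using False S Qpr by (auto simp: admissible_def)
  qed
qed

text \<open>By \<open>crd_cong\<close>, the older matrices see neither the new set nor the new
  coordinate.\<close>

lemma phi_step:
  "phi (insert (i, j) Q) (S((i, j) := insert a (ext_set S (i - 1) j))) (y((i, j) := l)) =
    (phi Q S y)((i, j) := cell (insert a (ext_set S (i - 1) j))
      (stepx a b (crd S y (i - 1) j) (extend_row (j + 1) (crd S y i (j + 1))) l))"
    (is "phi ?Q ?S ?y = _")
proof
  fix q
  have crd: "crd ?S ?y p r = crd S y p r" if "(p, r) \<in> Q \<or> (p = 0 \<or> r = n) \<and> p \<le> r \<and> r \<le> n" for p r
    by (rule crd_cong[OF Q _ _ that]) (use new in auto)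
  have "new_elt ?S i j = a" "left_out ?S i j = b"
  proof -
    have "ext_set ?S (i - 1) j = ext_set S (i - 1) j" "ext_set ?S i (j + 1) = ext_set S i (j + 1)"
      using D by (auto intro!: ext_set_new)
    then have "?S (i, j) - ext_set ?S (i - 1) j = {a}"
      "insert (j + 1) (ext_set ?S i (j + 1)) - ?S (i, j) = {b}"
      using ab by auto
    then show "new_elt ?S i j = a" "left_out ?S i j = b" by (simp_all add: new_elt_def left_out_def)
  qed
  moreover have "crd ?S ?y (i - 1) j = crd S y (i - 1) j" "crd ?S ?y i (j + 1) = crd S y i (j + 1)"
    using D by (auto intro!: crd)
  ultimately have "crd ?S ?y i j =
      stepx a b (crd S y (i - 1) j) (extend_row (j + 1) (crd S y i (j + 1))) l"
    by (simp add: crd_step[OF Q'])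
  moreover have "crd ?S ?y (fst q) (snd q) = crd S y (fst q) (snd q)" if "q \<in> Q"
    using that by (intro crd) simp
  ultimately show "phi ?Q ?S ?y q = ((phi Q S y)((i, j) := cell (insert a (ext_set S (i - 1) j))
      (stepx a b (crd S y (i - 1) j) (extend_row (j + 1) (crd S y i (j + 1))) l))) q"
    using new by (auto simp: phi_def)
qed

text \<open>Read off from \<open>crd_chain\<close> for the enlarged index set; only values at older
  indices occur, and these are unchanged.\<close>

lemma step_subset:
  "cell (ext_set S (i - 1) j) (crd S y (i - 1) j) \<subseteq>
    cell (insert b (insert a (ext_set S (i - 1) j))) (extend_row (j + 1) (crd S y i (j + 1)))"
  "{u. pr (j + 1) u \<in> cell (ext_set S i (j + 1)) (crd S y i (j + 1))} =
    cell (insert b (insert a (ext_set S (i - 1) j))) (extend_row (j + 1) (crd S y i (j + 1)))"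
  "insert b (insert a (ext_set S (i - 1) j)) \<subseteq> {1..n}"
  "Suc (card (ext_set S (i - 1) j)) = i"
proof -
  let ?S = "S((i, j) := insert a (ext_set S (i - 1) j))"
  have crd: "crd ?S y p r = crd S y p r" if "(p, r) \<in> Q \<or> (p = 0 \<or> r = n) \<and> p \<le> r \<and> r \<le> n" for p r
    by (rule crd_cong[OF Q _ _ that]) (use new in auto)
  have "crd ?S y (i - 1) j = crd S y (i - 1) j" "crd ?S y i (j + 1) = crd S y i (j + 1)"
    using D by (auto intro!: crd)
  moreover have e: "ext_set ?S (i - 1) j = ext_set S (i - 1) j" "ext_set ?S i (j + 1) = ext_set S i (j + 1)"
    using D by (auto intro!: ext_set_new)
  ultimately show "cell (ext_set S (i - 1) j) (crd S y (i - 1) j) \<subseteq>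
      cell (insert b (insert a (ext_set S (i - 1) j))) (extend_row (j + 1) (crd S y i (j + 1)))"
    "{u. pr (j + 1) u \<in> cell (ext_set S i (j + 1)) (crd S y i (j + 1))} =
      cell (insert b (insert a (ext_set S (i - 1) j))) (extend_row (j + 1) (crd S y i (j + 1)))"
    using crd_chain[OF Q' admissible_step, of i j y] unfolding ab(1)[symmetric] by auto
  have "insert (j + 1) (ext_set S i (j + 1)) \<subseteq> {1..n}"
    using step_sets(4,5)[OF Q' admissible_step, of i j] e by auto
  then show "insert b (insert a (ext_set S (i - 1) j)) \<subseteq> {1..n}" unfolding ab(1) .
  show "Suc (card (ext_set S (i - 1) j)) = i"
    using step_sets(7)[OF Q' admissible_step, of i j] e D(1) by auto
qed

lemma step_between:
  assumes V: "V \<in> tower (insert (i, j) Q)" and res: "restrict V Q = phi Q S y"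
  shows "cell (ext_set S (i - 1) j) (crd S y (i - 1) j) \<subseteq> V (i, j)"
    "V (i, j) \<subseteq> cell (insert b (insert a (ext_set S (i - 1) j))) (extend_row (j + 1) (crd S y i (j + 1)))"
    "V (i, j) \<in> Gr (Suc (card (ext_set S (i - 1) j)))"
proof -
  have t: "ext_space V (i - 1) j \<subseteq> V (i, j)" "pr (j + 1) ` V (i, j) \<subseteq> ext_space V i (j + 1)"
    using towerD(2,3)[OF V insertI1] .
  have e: "ext_space V p r = cell (ext_set S p r) (crd S y p r)" if "(p, r) \<in> Q \<or> p = 0 \<or> r = n" for p r
    using ext_space_restrict[OF that, of V] ext_space_phi[OF Q that, of S y] unfolding res by simp
  have "ext_space V (i - 1) j = cell (ext_set S (i - 1) j) (crd S y (i - 1) j)"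
    "ext_space V i (j + 1) = cell (ext_set S i (j + 1)) (crd S y i (j + 1))"
    using D by (auto intro!: e)
  then show "cell (ext_set S (i - 1) j) (crd S y (i - 1) j) \<subseteq> V (i, j)"
    "V (i, j) \<subseteq> cell (insert b (insert a (ext_set S (i - 1) j))) (extend_row (j + 1) (crd S y i (j + 1)))"
    using t unfolding step_subset(2)[symmetric] by auto
  show "V (i, j) \<in> Gr (Suc (card (ext_set S (i - 1) j)))"
    unfolding step_subset(4) using towerD[OF V] by blast
qed

text \<open>Normalizing \<open>co a v = 1\<close> makes \<open>co b v\<close> the affine coordinate
  of \<open>V (i, j)\<close> on the new line.\<close>

lemma phi_step_eq:
  assumes V: "V \<in> tower (insert (i, j) Q)" and res: "restrict V Q = phi Q S y"
    and v: "v \<in> V (i, j)" "\<And>s. s \<in> ext_set S (i - 1) j \<Longrightarrow> co s v = 0" "co a v = 1"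
  shows "V = phi (insert (i, j) Q) (S((i, j) := insert a (ext_set S (i - 1) j))) (y((i, j) := co b v))"
  unfolding phi_step
proof -
  have "V (i, j) = cell (insert a (ext_set S (i - 1) j))
      (stepx a b (crd S y (i - 1) j) (extend_row (j + 1) (crd S y i (j + 1))) (co b v))"
    by (rule cell_step_eq[OF step_subset(3) ab(2,3) step_between[OF V res] v])
  moreover have "V q = phi Q S y q" if "q \<noteq> (i, j)" for q
  proof (cases "q \<in> Q")
    case True
    then show ?thesis using fun_cong[OF res, of q] by simp
  next
    case False
    then show ?thesis using tower_undefined[OF V, of q] that by (simp add: phi_def)
  qed
  ultimately show "V = (phi Q S y)((i, j) := cell (insert a (ext_set S (i - 1) j))
      (stepx a b (crd S y (i - 1) j) (extend_row (j + 1) (crd S y i (j + 1))) (co b v)))"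
    by (simp add: fun_eq_iff del: split_paired_All)
qed

end

text \<open>The fibre over a point of the smaller tower is a projective line: the affine line of
  chart \<open>a\<close>, and the origin of chart \<open>b\<close> as the point at infinity.\<close>

lemma phi_extensions:
  assumes Q: "tower_index Q" and Q': "tower_index (insert (i, j) Q)" and new: "(i, j) \<notin> Q"
    and S: "admissible Q S"
    and ab: "insert (j + 1) (ext_set S i (j + 1)) = insert b (insert a (ext_set S (i - 1) j))"
      "a \<notin> ext_set S (i - 1) j" "b \<notin> insert a (ext_set S (i - 1) j)"
    and V: "V \<in> tower (insert (i, j) Q)" and res: "restrict V Q = phi Q S y"
  defines "S' \<equiv> \<lambda>c. S((i, j) := insert c (ext_set S (i - 1) j))"
  shows "(\<exists>l. V = phi (insert (i, j) Q) (S' a) (y((i, j) := l))) \<or>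
    V = phi (insert (i, j) Q) (S' b) (y((i, j) := 0))"
proof -
  have ba: "insert (j + 1) (ext_set S i (j + 1)) = insert a (insert b (ext_set S (i - 1) j))"
    "b \<notin> ext_set S (i - 1) j" "a \<notin> insert b (ext_set S (i - 1) j)"
    using ab by auto
  show ?thesis
  proof (rule step_vector[OF step_subset(3)[OF Q Q' new S ab] ab(2,3)
        step_between[OF Q Q' new S ab V res]])
    fix v assume "v \<in> V (i, j)" "\<And>s. s \<in> ext_set S (i - 1) j \<Longrightarrow> co s v = 0" "co a v = 1"
    from phi_step_eq[OF Q Q' new S ab V res this] show ?thesis unfolding S'_def by blast
  next
    fix v assume "v \<in> V (i, j)" "\<And>s. s \<in> ext_set S (i - 1) j \<Longrightarrow> co s v = 0" "co a v = 0" "co b v = 1"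
    from phi_step_eq[OF Q Q' new S ba V res this(1,2,4)] this(3) show ?thesis unfolding S'_def by simp
  qed
qed

text \<open>Rescaling the spanning vector from coordinates (1, \<open>l\<close>) to
  (\<open>inverse l\<close>, 1) exchanges the roles of \<open>a\<close> and
  \<open>b\<close>.\<close>

lemma phi_glue:
  assumes Q: "tower_index Q" and Q': "tower_index (insert (i, j) Q)" and new: "(i, j) \<notin> Q"
    and S: "admissible Q S"
    and ab: "insert (j + 1) (ext_set S i (j + 1)) = insert b (insert a (ext_set S (i - 1) j))"
      "a \<notin> ext_set S (i - 1) j" "b \<notin> insert a (ext_set S (i - 1) j)"
    and l: "l \<noteq> 0"
  defines "S' \<equiv> \<lambda>c. S((i, j) := insert c (ext_set S (i - 1) j))"
  shows "phi (insert (i, j) Q) (S' a) (y((i, j) := l)) = phi (insert (i, j) Q) (S' b) (y((i, j) := inverse l))"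
proof -
  have ba: "insert (j + 1) (ext_set S i (j + 1)) = insert a (insert b (ext_set S (i - 1) j))"
    "b \<notin> ext_set S (i - 1) j" "a \<notin> insert b (ext_set S (i - 1) j)"
    using ab by auto
  let ?S1 = "ext_set S (i - 1) j"
  let ?x = "stepx a b (crd S y (i - 1) j) (extend_row (j + 1) (crd S y i (j + 1))) l"
  define V where "V = phi (insert (i, j) Q) (S' a) (y((i, j) := l))"
  have V: "V \<in> tower (insert (i, j) Q)"
    unfolding V_def S'_def by (rule phi_in_tower[OF Q' admissible_step[OF Q Q' new S ab]])
  have Veq: "V = (phi Q S y)((i, j) := cell (insert a ?S1) ?x)"
    unfolding V_def S'_def by (rule phi_step[OF Q Q' new S ab])
  have res: "restrict V Q = phi Q S y"
    unfolding Veq using new by (auto simp: phi_def restrict_def fun_eq_iff)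
  have sub: "insert b (insert a ?S1) \<subseteq> {1..n}" by (rule step_subset(3)[OF Q Q' new S ab])
  then have sub': "insert a ?S1 \<subseteq> {1..n}" by auto
  define v where "v = inverse l *\<^sub>W row (insert a ?S1) ?x a"
  have "v \<in> V (i, j)"
    unfolding v_def Veq using row_in_cell[OF sub'] by (simp add: subspace_scale[OF subspace_cell])
  moreover have "co s v = 0" if "s \<in> ?S1" for s
    using that sub' ab(2) by (auto simp: v_def co_row[OF sub'] subset_iff)
  moreover have "co b v = 1"
    using sub ab(3) l by (auto simp: v_def co_row[OF sub'] stepx_ab)
  ultimately have "V = phi (insert (i, j) Q) (S' b) (y((i, j) := co a v))"
    unfolding S'_def by (rule phi_step_eq[OF Q Q' new S ba V res])
  moreover have "co a v = inverse l"
    using sub' by (simp add: v_def co_row[OF sub'])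
  ultimately show ?thesis by (simp add: V_def)
qed

lemma restrict_phi_step:
  assumes "tower_index Q" "tower_index (insert (i, j) Q)" "(i, j) \<notin> Q" "admissible Q S"
    "insert (j + 1) (ext_set S i (j + 1)) = insert b (insert a (ext_set S (i - 1) j))"
    "a \<notin> ext_set S (i - 1) j" "b \<notin> insert a (ext_set S (i - 1) j)"
  shows "restrict (phi (insert (i, j) Q) (S((i, j) := insert a (ext_set S (i - 1) j))) (y((i, j) := l))) Q
    = phi Q S y"
  unfolding phi_step[OF assms] using assms(3) by (auto simp: phi_def restrict_def fun_eq_iff)

text \<open>The charts on \<open>Q\<close> are prescribed and kept; in the density argument they are
  those of the big cell. Each further index chooses between the two charts of its line.\<close>

lemma chart_extension:
  assumes "tower_index Q" and Q': "tower_index Q'" and "Q \<subseteq> Q'" and V: "V \<in> tower Q'"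
    and "admissible Q S" and "\<And>q. q \<in> Q \<Longrightarrow> V q \<in> range (cell (S q))"
  shows "\<exists>S' y. admissible Q' S' \<and> (\<forall>q\<in>Q. S' q = S q) \<and> V = phi Q' S' y"
  using assms(1,3,5,6)
proof (induction "card (Q' - Q)" arbitrary: Q S rule: less_induct)
  case less
  note Q = less.prems(1) and S = less.prems(3)
  show ?case
  proof (cases "Q = Q'")
    case True
    obtain y where "V = phi Q' S y"
      using fam_eq_phi[OF Q S, of V] V less.prems(4) unfolding True by blast
    then show ?thesis using S True by blast
  next
    case False
    then obtain q where q: "q \<in> Q' - Q" "tower_index (insert q Q)"
      using tower_index_insert[OF Q Q'] less.prems(2) by blast
    obtain i j where ij: "q = (i, j)" by fastforce
    have new: "(i, j) \<notin> Q" and Q1: "tower_index (insert (i, j) Q)" using q ij by auto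
    have sub: "insert (i, j) Q \<subseteq> Q'" using q less.prems(2) by (auto simp: ij)
    obtain a b where ab: "insert (j + 1) (ext_set S i (j + 1)) = insert b (insert a (ext_set S (i - 1) j))"
      "a \<notin> ext_set S (i - 1) j" "b \<notin> insert a (ext_set S (i - 1) j)"
      by (rule step_choice[OF Q Q1 new S]) (rule that)
    then have ba: "insert (j + 1) (ext_set S i (j + 1)) = insert a (insert b (ext_set S (i - 1) j))"
      "b \<notin> ext_set S (i - 1) j" "a \<notin> insert b (ext_set S (i - 1) j)" by auto
    obtain y where y: "restrict V Q = phi Q S y"
    proof (rule fam_eq_phi[OF Q S tower_restrict[OF Q V less.prems(2)]])
      show "restrict V Q q \<in> range (cell (S q))" if "q \<in> Q" for q
        using less.prems(4)[OF that] that by simp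
    qed
    have V1: "restrict V (insert (i, j) Q) \<in> tower (insert (i, j) Q)"
      by (rule tower_restrict[OF Q1 V sub])
    have "restrict (restrict V (insert (i, j) Q)) Q = phi Q S y"
      unfolding y[symmetric] by (auto simp: restrict_def fun_eq_iff)
    from phi_extensions[OF Q Q1 new S ab V1 this]
    obtain c y' where c: "c = a \<or> c = b"
      "restrict V (insert (i, j) Q) =
        phi (insert (i, j) Q) (S((i, j) := insert c (ext_set S (i - 1) j))) y'"
      by blast
    let ?S = "S((i, j) := insert c (ext_set S (i - 1) j))"
    have adm: "admissible (insert (i, j) Q) ?S"
      using admissible_step[OF Q Q1 new S ab] admissible_step[OF Q Q1 new S ba] c(1) by blast
    have "V q \<in> range (cell (?S q))" if "q \<in> insert (i, j) Q" for q
      using fun_cong[OF c(2), of q] that by (simp add: phi_def)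
    moreover have "card (Q' - insert (i, j) Q) < card (Q' - Q)"
      using q tower_index_finite[OF Q'] by (intro psubset_card_mono) (auto simp: ij)
    ultimately obtain S' y where S': "admissible Q' S'" "\<forall>q\<in>insert (i, j) Q. S' q = ?S q" "V = phi Q' S' y"
      using less.hyps[OF _ Q1 sub adm] by blast
    then have "\<forall>q\<in>Q. S' q = S q" using new by auto
    with S' show ?thesis by blast
  qed
qed

lemma tower_chart:
  assumes "tower_index Q" "V \<in> tower Q"
  obtains S y where "admissible Q S" "V = phi Q S y"
proof -
  have "tower_index {}" "admissible {} (\<lambda>_. {})" by (simp_all add: tower_index_def admissible_def)
  from chart_extension[OF this(1) assms(1) _ assms(2) this(2)] show ?thesis using that by blast
qed

lemma phi_eq_fam: "phi Q S y = fam Q S (\<lambda>(q, p). crd S y (fst q) (snd q) p)"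
  by (simp add: phi_def fam_def)

lemma fam_aff_space:
  obtains x' where "x' \<in> aff_space (fam_index A S)" "fam A S x = fam A S x'"
    "\<And>i. i \<in> fam_index A S \<Longrightarrow> x' i = x i"
proof (rule that[of "\<lambda>i. if i \<in> fam_index A S then x i else 0"])
  show "fam A S x = fam A S (\<lambda>i. if i \<in> fam_index A S then x i else 0)"
    by (rule fam_cong) (simp add: fam_index_def)
qed (auto simp: aff_space_def)

lemma tower_smooth:
  assumes Q: "tower_index Q"
  shows "smooth_variety (fam_atlas Q fst) (tower Q)"
  unfolding smooth_variety_def
proof
  fix V assume "V \<in> tower Q"
  then obtain S y0 where S: "admissible Q S" and V: "V = phi Q S y0" by (rule tower_chart[OF Q])
  obtain x0 where x0: "x0 \<in> aff_space (fam_index Q S)" "V = fam Q S x0"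
    using fam_aff_space[of Q S "\<lambda>(q, p). crd S y0 (fst q) (snd q) p"] unfolding V phi_eq_fam by metis
  note sets = admissible_sets[OF Q S]
  \<comment> \<open>The entries that remain free, one for each index.\<close>
  define J where "J = (\<lambda>q. (q, new_elt S (fst q) (snd q), left_out S (fst q) (snd q))) ` Q"
  define y where "y x = (\<lambda>(i, j). x ((i, j), new_elt S i j, left_out S i j) :: complex)" for x
  define c where "c i x = crd S (y x) (fst (fst i)) (snd (fst i)) (snd i)" for i x
  have J: "J \<subseteq> fam_index Q S"
  proof
    fix p assume "p \<in> J"
    then obtain i j where "(i, j) \<in> Q" "p = ((i, j), new_elt S i j, left_out S i j)"
      by (auto simp: J_def)
    then show "p \<in> fam_index Q S"
      using step_sets(1,3,4)[OF Q S, of i j] by (auto simp: fam_index_def)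
  qed
  have "smooth_at (fam_atlas Q fst) (tower Q) (fam Q S x0)"
  proof (rule smooth_at_graph[OF fam_atlasI _ x0(1) J])
    show "finite (fam_index Q S)" using sets by (intro finite_fam_index tower_index_finite[OF Q])
    show "c i \<in> polyfuns J" if "i \<in> fam_index Q S - J" for i
    proof -
      have "(fst (fst i), snd (fst i)) \<in> Q" using that by (auto simp: fam_index_def)
      then have "(\<lambda>y. crd S y (fst (fst i)) (snd (fst i)) (snd i)) \<in> polyfuns Q"
        by (intro crd_polyfun[OF Q]) auto
      then have "(\<lambda>x. crd S (y x) (fst (fst i)) (snd (fst i)) (snd i)) \<in> polyfuns J"
        by (rule polyfuns_compose) (auto simp: y_def J_def intro!: polyfuns.coord)
      then show ?thesis by (simp add: c_def[abs_def])
    qed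
    fix x assume "x \<in> aff_space (fam_index Q S)"
    \<comment> \<open>At the free entries the equations hold identically, so restricting them to the
      complement of \<open>J\<close> loses nothing.\<close>
    have "x i = c i x" if "i \<in> J" for i
      using that by (auto simp: J_def c_def crd_new_elt[OF Q] y_def)
    then have "(\<forall>i\<in>fam_index Q S - J. x i = c i x) \<longleftrightarrow> (\<forall>i\<in>fam_index Q S. x i = c i x)"
      using J by blast
    also have "\<dots> \<longleftrightarrow> fam Q S x \<in> tower Q"
      unfolding fam_in_tower_iff[OF Q S] by (auto simp: fam_index_def c_def y_def)
    finally show "fam Q S x \<in> tower Q \<longleftrightarrow> (\<forall>i\<in>fam_index Q S - J. x i = c i x)" by simp
  qed (use sets in auto)
  then show "smooth_at (fam_atlas Q fst) (tower Q) V" by (simp add: x0)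
qed


section \<open>Incidence conditions are closed\<close>

text \<open>Coordinate projections commute and are idempotent, so a composite depends only on the
  set of erased coordinates. Plain inclusions are the case of the empty set.\<close>

definition prs :: "nat set \<Rightarrow> 'w \<Rightarrow> 'w" where
  "prs K v = (\<Sum>i\<in>{1..n} - K. co i v *\<^sub>W w i)"

lemma co_prs: "t \<in> {1..n} \<Longrightarrow> co t (prs K v) = (if t \<in> K then 0 else co t v)"
  unfolding prs_def by (subst co_sum_w) auto

lemma pr_eq_prs: "pr e = prs {e}"
  by (intro ext co_ext) (simp add: co_pr co_prs)

lemma prs_empty: "prs {} v = v"
  by (rule co_ext) (simp add: co_prs)

lemma prs_prs: "prs K (prs L v) = prs (K \<union> L) v"
  by (rule co_ext) (simp add: co_prs)

lemma foldr_pr: "foldr pr es v = prs (set es) v"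
  by (induction es) (simp_all add: prs_empty pr_eq_prs prs_prs)

lemma prs_add: "prs K (u + v) = prs K u + prs K v"
  by (rule co_ext) (simp add: co_prs)

lemma prs_scale: "prs K (c *\<^sub>W v) = c *\<^sub>W prs K v"
  by (rule co_ext) (simp add: co_prs)

lemma prs_zero: "prs K 0 = 0"
  by (rule co_ext) (simp add: co_prs)

lemma subspace_prs_preimage: "subspace V \<Longrightarrow> subspace {v. prs K v \<in> V}"
  by (auto simp: subspace_def prs_add prs_scale prs_zero)

text \<open>The preimage of a cell under \<open>prs K\<close> is a subspace, so the inclusion can be
  tested on the rows.\<close>

lemma prs_cell_subset_iff:
  assumes S: "S \<subseteq> {1..n}"
  shows "prs K ` cell S x \<subseteq> cell S' y \<longleftrightarrow> (\<forall>s\<in>S. \<forall>t\<in>{1..n} - S'.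
    co t (prs K (row S x s)) = (\<Sum>s'\<in>S'. co s' (prs K (row S x s)) * y (s', t)))"
proof -
  have "prs K ` cell S x \<subseteq> cell S' y \<longleftrightarrow> cell S x \<subseteq> {v. prs K v \<in> cell S' y}" by auto
  also have "\<dots> \<longleftrightarrow> (\<forall>s\<in>S. prs K (row S x s) \<in> cell S' y)"
    using cell_subset[OF S subspace_prs_preimage[OF subspace_cell]] row_in_cell[OF S] by fastforce
  finally show ?thesis by (simp add: cell_def)
qed

text \<open>A failing inclusion shows in one row \<open>s\<close> and one column \<open>t\<close>;
  the discrepancy there, times \<open>k\<close>, is the polynomial. The denominator \<open>k\<close>
  is for targets that are only rational in \<open>z\<close>.\<close>

lemma cell_inclusion_polyfun:
  assumes S: "S \<subseteq> {1..n}" "S' \<subseteq> {1..n}"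
    and X: "\<And>s t. s \<in> S \<Longrightarrow> t \<in> {1..n} - S \<Longrightarrow> (\<lambda>z. X z (s, t)) \<in> polyfuns I"
    and k: "k \<in> polyfuns I" "k z0 \<noteq> 0"
    and N: "\<And>s t. s \<in> S' \<Longrightarrow> t \<in> {1..n} - S' \<Longrightarrow> (\<lambda>z. N z (s, t)) \<in> polyfuns I"
    and neq: "\<not> prs K ` cell S (X z0) \<subseteq> cell S' (\<lambda>p. N z0 p / k z0)"
  obtains h where "h \<in> polyfuns I" "h z0 \<noteq> 0"
    "\<And>z. k z \<noteq> 0 \<Longrightarrow> prs K ` cell S (X z) \<subseteq> cell S' (\<lambda>p. N z p / k z) \<Longrightarrow> h z = 0"
proof -
  obtain s t where st: "s \<in> S" "t \<in> {1..n} - S'"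
    "co t (prs K (row S (X z0) s)) \<noteq> (\<Sum>s'\<in>S'. co s' (prs K (row S (X z0) s)) * (N z0 (s', t) / k z0))"
    using neq unfolding prs_cell_subset_iff[OF S(1)] by blast
  define h where "h z = k z * co t (prs K (row S (X z) s)) -
    (\<Sum>s'\<in>S'. co s' (prs K (row S (X z) s)) * N z (s', t))" for z
  have h: "h z = k z * (co t (prs K (row S (X z) s)) -
    (\<Sum>s'\<in>S'. co s' (prs K (row S (X z) s)) * (N z (s', t) / k z)))" if "k z \<noteq> 0" for z
    using that by (simp add: h_def right_diff_distrib sum_distrib_left)
  have co: "(\<lambda>z. co r (prs K (row S (X z) s))) \<in> polyfuns I" if r: "r \<in> {1..n}" for r
  proof -
    have "(\<lambda>z. if r \<in> K then 0 else if r \<in> S then (if r = s then 1 else 0) else X z (s, r)) \<in> polyfuns I"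
      using X[OF st(1), of r] r by (cases "r \<in> K"; cases "r \<in> S"; cases "r = s") (simp_all add: polyfuns.const)
    then show ?thesis unfolding co_prs[OF r] co_row[OF S(1) st(1) r] .
  qed
  show ?thesis
  proof (rule that[of h])
    show "h \<in> polyfuns I"
      unfolding h_def using st(2) S(2) by (intro polyfuns_intros k co N) auto
    show "h z0 \<noteq> 0" unfolding h[OF k(2)] using k(2) st(3) by simp
    show "h z = 0" if "k z \<noteq> 0" "prs K ` cell S (X z) \<subseteq> cell S' (\<lambda>p. N z p / k z)" for z
      unfolding h[OF that(1)] using that(2) st(1,2) unfolding prs_cell_subset_iff[OF S(1)] by simp
  qed
qed

lemma cell_inclusion_polyfun':
  assumes "S \<subseteq> {1..n}" "S' \<subseteq> {1..n}"
    and "\<And>s t. s \<in> S \<Longrightarrow> t \<in> {1..n} - S \<Longrightarrow> (\<lambda>z. X z (s, t)) \<in> polyfuns I"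
    and "\<And>s t. s \<in> S' \<Longrightarrow> t \<in> {1..n} - S' \<Longrightarrow> (\<lambda>z. Y z (s, t)) \<in> polyfuns I"
    and "\<not> prs K ` cell S (X z0) \<subseteq> cell S' (Y z0)"
  obtains h where "h \<in> polyfuns I" "h z0 \<noteq> 0" "\<And>z. prs K ` cell S (X z) \<subseteq> cell S' (Y z) \<Longrightarrow> h z = 0"
proof (rule cell_inclusion_polyfun[of S S' X I "\<lambda>_. 1" z0 Y K])
  show "\<not> prs K ` cell S (X z0) \<subseteq> cell S' (\<lambda>p. Y z0 p / 1)" using assms(5) by simp
  fix h assume h: "h \<in> polyfuns I" "h z0 \<noteq> 0"
    "\<And>z. 1 \<noteq> (0::complex) \<Longrightarrow> prs K ` cell S (X z) \<subseteq> cell S' (\<lambda>p. Y z p / 1) \<Longrightarrow> h z = 0"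
  show thesis by (rule that[OF h(1,2)]) (use h(3) in simp)
next
  show "(\<lambda>_. 1) \<in> polyfuns I" by (rule polyfuns.const)
qed (use assms(1-4) in simp_all)

text \<open>The ambient chart is arbitrary and its sets need not be admissible: outside the tower
  some single inclusion fails, which is an open condition.\<close>

lemma tower_closed:
  assumes Q: "tower_index Q"
  shows "closedin (zariski (fam_atlas Q fst)) (tower Q)"
proof (rule closedin_zariskiI)
  show "tower Q \<subseteq> atlas_points (fam_atlas Q fst)"
  proof
    fix V assume "V \<in> tower Q"
    then obtain S y where S: "admissible Q S" and V: "V = phi Q S y" by (rule tower_chart[OF Q])
    obtain x where "x \<in> aff_space (fam_index Q S)" "V = fam Q S x"
      using fam_aff_space[of Q S "\<lambda>(q, p). crd S y (fst q) (snd q) p"] unfolding V phi_eq_fam by metis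
    then show "V \<in> atlas_points (fam_atlas Q fst)"
      using atlas_pointsI[OF fam_atlasI[of Q S fst]] admissible_sets[OF Q S] by metis
  qed
next
  fix I \<psi> x0 assume I: "(I, \<psi>) \<in> fam_atlas Q fst" and "x0 \<in> aff_space I" and x0: "\<psi> x0 \<notin> tower Q"
  obtain S where S: "\<And>q. q \<in> Q \<Longrightarrow> S q \<subseteq> {1..n}" "\<And>q. q \<in> Q \<Longrightarrow> card (S q) = fst q"
    and I: "I = fam_index Q S" "\<psi> = fam Q S"
    by (rule fam_atlasE[OF I]) (rule that)
  \<comment> \<open>The zero matrix represents the conventional spaces at the boundary.\<close>
  define X where "X i j x = (\<lambda>p::nat \<times> nat. if i = 0 \<or> j = n then 0 else x ((i, j), p) :: complex)"
    for i j :: nat and x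
  have E: "ext_space (fam Q S x) i j = cell (ext_set S i j) (X i j x)" if "(i, j) \<in> Q \<or> i = 0 \<or> j = n" for i j x
    using that by (auto simp: ext_space_def ext_set_def X_def fam_apply)
  have XI: "(\<lambda>x. X i j x (s, t)) \<in> polyfuns I"
    if "(i, j) \<in> Q \<or> i = 0 \<or> j = n" "s \<in> ext_set S i j" "t \<in> {1..n} - ext_set S i j" for i j s t
    using that by (cases "i = 0 \<or> j = n")
      (auto simp: X_def ext_set_def I fam_index_def intro: polyfuns.intros)
  have sub: "ext_set S i j \<subseteq> {1..n}" if "(i, j) \<in> Q \<or> (i = 0 \<or> j = n) \<and> i \<le> n" for i j
    using that S(1) tower_indexD(3)[OF Q, of i j] by (auto simp: ext_set_def)
  have "fam Q S x0 \<in> (\<Pi>\<^sub>E q\<in>Q. Gr (fst q))" using S by (intro fam_in_PiE)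
  then obtain i j where ij: "(i, j) \<in> Q" and or:
    "\<not> ext_space (fam Q S x0) (i - 1) j \<subseteq> fam Q S x0 (i, j) \<or>
     \<not> pr (j + 1) ` fam Q S x0 (i, j) \<subseteq> ext_space (fam Q S x0) i (j + 1)"
    using x0 unfolding I tower_def by blast
  note D = tower_indexD[OF Q ij]
  have e: "ext_space (fam Q S x) (i - 1) j = cell (ext_set S (i - 1) j) (X (i - 1) j x)"
    "fam Q S x (i, j) = cell (ext_set S i j) (X i j x)"
    "ext_space (fam Q S x) i (j + 1) = cell (ext_set S i (j + 1)) (X i (j + 1) x)" for x
    using D E[of "i - 1" j x] E[of i j x] E[of i "j + 1" x] ij by (auto simp: ext_space_Q[OF Q ij])
  consider "\<not> prs {} ` cell (ext_set S (i - 1) j) (X (i - 1) j x0) \<subseteq> cell (ext_set S i j) (X i j x0)"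
    | "\<not> prs {j + 1} ` cell (ext_set S i j) (X i j x0) \<subseteq> cell (ext_set S i (j + 1)) (X i (j + 1) x0)"
    using or unfolding e pr_eq_prs by (auto simp: prs_empty)
  then show "\<exists>h\<in>polyfuns I. h x0 \<noteq> 0 \<and> (\<forall>x\<in>aff_space I. \<psi> x \<in> tower Q \<longrightarrow> h x = 0)"
  proof cases
    case 1
    obtain h where "h \<in> polyfuns I" "h x0 \<noteq> 0" and
      h: "\<And>x. prs {} ` cell (ext_set S (i - 1) j) (X (i - 1) j x) \<subseteq> cell (ext_set S i j) (X i j x) \<Longrightarrow> h x = 0"
    proof (rule cell_inclusion_polyfun'[of "ext_set S (i - 1) j" "ext_set S i j" "X (i - 1) j" I "X i j" "{}" x0])
      show "\<not> prs {} ` cell (ext_set S (i - 1) j) (X (i - 1) j x0) \<subseteq> cell (ext_set S i j) (X i j x0)"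
        by (rule 1)
      show "ext_set S (i - 1) j \<subseteq> {1..n}" "ext_set S i j \<subseteq> {1..n}" using D ij by (auto intro!: sub)
      show "(\<lambda>z. X (i - 1) j z (s, t)) \<in> polyfuns I"
        if "s \<in> ext_set S (i - 1) j" "t \<in> {1..n} - ext_set S (i - 1) j" for s t
        using XI[OF _ that] D by auto
      show "(\<lambda>z. X i j z (s, t)) \<in> polyfuns I" if "s \<in> ext_set S i j" "t \<in> {1..n} - ext_set S i j" for s t
        using XI[OF _ that] ij by auto
    qed (rule that)
    moreover have "h x = 0" if "\<psi> x \<in> tower Q" for x
      using towerD(2)[OF that ij] unfolding I e by (intro h) (simp add: prs_empty)
    ultimately show ?thesis by blast
  next
    case 2
    obtain h where "h \<in> polyfuns I" "h x0 \<noteq> 0" and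
      h: "\<And>x. prs {j + 1} ` cell (ext_set S i j) (X i j x) \<subseteq> cell (ext_set S i (j + 1)) (X i (j + 1) x) \<Longrightarrow> h x = 0"
    proof (rule cell_inclusion_polyfun'[of "ext_set S i j" "ext_set S i (j + 1)" "X i j" I "X i (j + 1)" "{j + 1}" x0])
      show "\<not> prs {j + 1} ` cell (ext_set S i j) (X i j x0) \<subseteq> cell (ext_set S i (j + 1)) (X i (j + 1) x0)"
        by (rule 2)
      show "ext_set S i (j + 1) \<subseteq> {1..n}" "ext_set S i j \<subseteq> {1..n}" using D ij by (auto intro!: sub)
      show "(\<lambda>z. X i (j + 1) z (s, t)) \<in> polyfuns I"
        if "s \<in> ext_set S i (j + 1)" "t \<in> {1..n} - ext_set S i (j + 1)" for s t
        using XI[OF _ that] D by auto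
      show "(\<lambda>z. X i j z (s, t)) \<in> polyfuns I" if "s \<in> ext_set S i j" "t \<in> {1..n} - ext_set S i j" for s t
        using XI[OF _ that] ij by auto
    qed (rule that)
    moreover have "h x = 0" if "\<psi> x \<in> tower Q" for x
      using towerD(3)[OF that ij] unfolding I e pr_eq_prs by (rule h)
    ultimately show ?thesis by blast
  qed
qed

end

section \<open>Filling in flags\<close>

context based_vector_space
begin

lemma intermediate_subspace:
  assumes "subspace A" "subspace B" "A \<subseteq> B" "dim A \<le> m" "m \<le> dim B"
  obtains V where "V \<in> Gr m" "A \<subseteq> V" "V \<subseteq> B"
proof -
  have "\<exists>V. V \<in> Gr m \<and> A \<subseteq> V \<and> V \<subseteq> B"
    using assms(1,3,4)
  proof (induction "m - dim A" arbitrary: A)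
    case 0
    then show ?case by (intro exI[of _ A]) (auto simp: Gr_def)
  next
    case (Suc c)
    then have "dim A < m" by simp
    then have "A \<noteq> B" using assms(5) by auto
    then obtain v where v: "v \<in> B" "v \<notin> A" using Suc.prems by blast
    define A' where "A' = span (insert v A)"
    have "dim A' = dim A + 1"
      using v Suc.prems(1) by (simp add: A'_def dim_insert span_eq_iff[THEN iffD2])
    moreover have "A' \<subseteq> B" unfolding A'_def using v Suc.prems assms(2) by (intro span_minimal) auto
    moreover have "A \<subseteq> A'" unfolding A'_def by (auto intro: span_base)
    moreover have "c = m - dim A'" "dim A' \<le> m" using calculation(1) Suc.hyps(2) by auto
    ultimately have "\<exists>V. V \<in> Gr m \<and> A' \<subseteq> V \<and> V \<subseteq> B"
      by (intro Suc.hyps(1)) (auto simp: A'_def)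
    then show ?case using \<open>A \<subseteq> A'\<close> by blast
  qed
  then show ?thesis using that by blast
qed

lemma subspace_co_zero: "subspace V \<Longrightarrow> subspace {v \<in> V. co e v = 0}"
  by (auto simp: subspace_def)

lemma dim_hyperplane:
  assumes V: "subspace V"
  shows "dim V \<le> dim {v \<in> V. co e v = 0} + 1"
proof (cases "\<forall>v\<in>V. co e v = 0")
  case True
  then have "{v \<in> V. co e v = 0} = V" by blast
  then show ?thesis by simp
next
  case False
  then obtain u where u: "u \<in> V" "co e u \<noteq> 0" by blast
  let ?H = "{v \<in> V. co e v = 0}"
  have "V \<subseteq> span (insert u ?H)"
  proof
    fix v assume v: "v \<in> V"
    let ?c = "co e v / co e u"
    have "v - ?c *\<^sub>W u \<in> ?H" using u v V by (auto intro: subspace_diff subspace_scale)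
    then have "(v - ?c *\<^sub>W u) + ?c *\<^sub>W u \<in> span (insert u ?H)"
      by (intro span_add span_scale) (auto intro: span_base)
    then show "v \<in> span (insert u ?H)" by simp
  qed
  then have "dim V \<le> dim (insert u ?H)" by (rule dim_mono)
  also have "\<dots> \<le> dim ?H + 1" by (simp add: dim_insert)
  finally show ?thesis .
qed

text \<open>\<open>prs {e}\<close> fixes the vectors of \<open>A\<close> without coordinate
  \<open>e\<close> and kills \<open>w e\<close>, which makes up for the dimension lost in passing to
  them.\<close>

lemma dim_pr_preimage:
  assumes A: "subspace A" and e: "e \<in> {1..n}"
  shows "dim A \<le> dim {v. prs {e} v \<in> A}"
proof -
  let ?H = "{v \<in> A. co e v = 0}"
  have H: "subspace ?H" by (rule subspace_co_zero[OF A])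
  have "w e \<notin> span ?H" using e co_w[OF e e] by (simp add: span_eq_iff[THEN iffD2, OF H])
  then have "dim (insert (w e) ?H) = dim ?H + 1" by (simp add: dim_insert)
  then have "dim A \<le> dim (insert (w e) ?H)" using dim_hyperplane[OF A] by simp
  also have "insert (w e) ?H \<subseteq> {v. prs {e} v \<in> A}"
  proof -
    have "prs {e} (w e) = 0" by (rule co_ext) (use e in \<open>simp add: co_prs co_w\<close>)
    moreover have "prs {e} v = v" if "co e v = 0" for v
      by (rule co_ext) (use that in \<open>simp add: co_prs\<close>)
    ultimately show ?thesis using subspace_0[OF A] by auto
  qed
  then have "dim (insert (w e) ?H) \<le> dim {v. prs {e} v \<in> A}" by (rule dim_subset)
  finally show ?thesis .
qed

lemma dim_prs_preimage:
  assumes "finite K" "K \<subseteq> {1..n}" "subspace A"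
  shows "dim A \<le> dim {v. prs K v \<in> A}"
  using assms
proof (induction K)
  case empty
  then show ?case by (simp add: prs_empty)
next
  case (insert e K)
  have "dim A \<le> dim {v. prs K v \<in> A}" using insert by simp
  also have "\<dots> \<le> dim {v. prs {e} v \<in> {v. prs K v \<in> A}}"
    using insert.prems by (intro dim_pr_preimage subspace_prs_preimage) auto
  also have "{v. prs {e} v \<in> {v. prs K v \<in> A}} = {v. prs (insert e K) v \<in> A}"
    by (simp add: prs_prs)
  finally show ?case .
qed

lemma linear_prs: "Vector_Spaces.linear scale scale (prs K)"
  by unfold_locales (simp_all add: prs_add prs_scale)

lemma prs_image:
  assumes "subspace V"
  shows "subspace (prs K ` V)" "dim (prs K ` V) \<le> dim V"
proof -
  interpret finite_dimensional_vector_space_pair_1 scale "w ` {1..n}" scale by unfold_locales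
  show "subspace (prs K ` V)" using linear_subspace_image[OF linear_prs assms] .
  show "dim (prs K ` V) \<le> dim V" using dim_image_le[OF linear_prs] .
qed

text \<open>The spaces are chosen in increasing dimension. The invariant is that everything built so
  far projects into all later prescribed spaces.\<close>

lemma full_flag:
  assumes D: "D \<subseteq> {1..<n}" and Fl: "\<And>q. q \<in> D \<Longrightarrow> Fl q \<in> Gr q"
    and inc: "\<And>p q. p \<in> D \<Longrightarrow> q \<in> D \<Longrightarrow> p < q \<Longrightarrow> prs {p + 1..q} ` Fl p \<subseteq> Fl q"
  shows "m < n \<Longrightarrow> \<exists>E. \<forall>i\<le>m. E i \<in> Gr i \<and> (i \<in> D \<longrightarrow> E i = Fl i) \<and>
    (i < m \<longrightarrow> prs {i + 1} ` E i \<subseteq> E (i + 1)) \<and> (\<forall>q\<in>D. i \<le> q \<longrightarrow> prs {i + 1..q} ` E i \<subseteq> Fl q)"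
proof (induction m)
  case 0
  have "0 \<notin> D" using D by auto
  moreover have "{0} \<in> Gr 0" by (simp add: Gr_def)
  moreover have "0 \<in> Fl q" if "q \<in> D" for q using Fl[OF that] by (auto simp: Gr_def subspace_0)
  ultimately show ?case by (intro exI[of _ "\<lambda>_. {0}"]) (auto simp: prs_zero)
next
  case (Suc m)
  then obtain E where E: "\<And>i. i \<le> m \<Longrightarrow> E i \<in> Gr i" "\<And>i. i \<le> m \<Longrightarrow> i \<in> D \<Longrightarrow> E i = Fl i"
    "\<And>i. i < m \<Longrightarrow> prs {i + 1} ` E i \<subseteq> E (i + 1)"
    "\<And>i q. i \<le> m \<Longrightarrow> q \<in> D \<Longrightarrow> i \<le> q \<Longrightarrow> prs {i + 1..q} ` E i \<subseteq> Fl q"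
    by (metis Suc_lessD less_imp_le)
  \<comment> \<open>The next space must lie in \<open>B\<close> to keep the invariant.\<close>
  define B where "B = {v. \<forall>q\<in>D. m + 1 \<le> q \<longrightarrow> prs {m + 2..q} v \<in> Fl q}"
  have "\<exists>X. X \<in> Gr (m + 1) \<and> (m + 1 \<in> D \<longrightarrow> X = Fl (m + 1)) \<and> prs {m + 1} ` E m \<subseteq> X \<and> X \<subseteq> B"
  proof (cases "m + 1 \<in> D")
    case True
    have "prs {m + 1..m + 1} ` E m \<subseteq> Fl (m + 1)" using True by (intro E(4)) auto
    moreover have "Fl (m + 1) \<subseteq> B"
    proof
      fix v assume v: "v \<in> Fl (m + 1)"
      have "prs {m + 2..q} v \<in> Fl q" if q: "q \<in> D" "m + 1 \<le> q" for q
      proof (cases "q = m + 1")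
        case True
        then show ?thesis using v by (simp add: prs_empty)
      next
        case False
        then show ?thesis using inc[OF True q(1)] q(2) v by (auto simp: add.assoc)
      qed
      then show "v \<in> B" by (simp add: B_def)
    qed
    ultimately show ?thesis using Fl[OF True] by auto
  next
    case False
    have subB: "subspace B"
      unfolding B_def using Fl by (auto simp: subspace_def prs_add prs_scale prs_zero Gr_def)
    have mB: "m + 1 \<le> dim B"
    proof (cases "\<exists>q\<in>D. m + 1 \<le> q")
      case False
      then have "B = UNIV" by (auto simp: B_def)
      then show ?thesis using Suc.prems card_image[OF w_inj] by simp
    next
      case True
      \<comment> \<open>Only the nearest prescribed space counts, since it projects into the later
        ones; its preimage has dimension at least \<open>q0\<close>, hence at least
        \<open>m + 1\<close>.\<close>
      define q0 where "q0 = (LEAST q. q \<in> D \<and> m + 1 \<le> q)"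
      have q0: "q0 \<in> D" "m + 1 \<le> q0"
        using LeastI_ex[of "\<lambda>q. q \<in> D \<and> m + 1 \<le> q"] True by (auto simp: q0_def)
      have q0min: "q0 \<le> q" if "q \<in> D" "m + 1 \<le> q" for q
        unfolding q0_def using that by (intro Least_le) auto
      have "{v. prs {m + 2..q0} v \<in> Fl q0} \<subseteq> B"
      proof
        fix v assume "v \<in> {v. prs {m + 2..q0} v \<in> Fl q0}"
        then have v: "prs {m + 2..q0} v \<in> Fl q0" by simp
        have "prs {m + 2..q} v \<in> Fl q" if q: "q \<in> D" "m + 1 \<le> q" for q
        proof (cases "q = q0")
          case False
          then have "q0 < q" using q0min[OF q] by simp
          then have "prs {q0 + 1..q} (prs {m + 2..q0} v) \<in> Fl q" using inc[OF q0(1) q(1)] v by blast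
          moreover have "{q0 + 1..q} \<union> {m + 2..q0} = {m + 2..q}" using \<open>q0 < q\<close> q0(2) by auto
          ultimately show ?thesis by (simp add: prs_prs)
        qed (use v in simp)
        then show "v \<in> B" by (simp add: B_def)
      qed
      then have "dim {v. prs {m + 2..q0} v \<in> Fl q0} \<le> dim B" by (rule dim_subset)
      moreover have "dim (Fl q0) \<le> dim {v. prs {m + 2..q0} v \<in> Fl q0}"
        using Fl[OF q0(1)] D q0(1) by (intro dim_prs_preimage) (auto simp: Gr_def)
      ultimately show ?thesis using Fl[OF q0(1)] q0(2) by (auto simp: Gr_def)
    qed
    have subE: "subspace (E m)" "dim (E m) = m" using E(1)[of m] by (auto simp: Gr_def)
    have "prs {m + 1} ` E m \<subseteq> B"
    proof
      fix u assume "u \<in> prs {m + 1} ` E m"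
      then obtain v where v: "v \<in> E m" "u = prs {m + 1} v" by blast
      have "prs {m + 2..q} u \<in> Fl q" if q: "q \<in> D" "m + 1 \<le> q" for q
      proof -
        have "prs {m + 1..q} v \<in> Fl q" using E(4)[of m q] q v(1) by auto
        moreover have "insert (m + 1) {m + 2..q} = {m + 1..q}" using q(2) by auto
        ultimately show ?thesis by (simp add: v prs_prs)
      qed
      then show "u \<in> B" by (simp add: B_def)
    qed
    then obtain X where "X \<in> Gr (m + 1)" "prs {m + 1} ` E m \<subseteq> X" "X \<subseteq> B"
      using intermediate_subspace[OF prs_image(1)[OF subE(1)] subB _ _ mB, of "{m + 1}"]
        prs_image(2)[OF subE(1), of "{m + 1}"] subE(2) by auto
    with False show ?thesis by blast
  qed
  then obtain X where X: "X \<in> Gr (m + 1)" "m + 1 \<in> D \<longrightarrow> X = Fl (m + 1)" "prs {m + 1} ` E m \<subseteq> X" "X \<subseteq> B"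
    by blast
  show ?case
  proof (intro exI[of _ "E(m + 1 := X)"] allI impI)
    fix i assume i: "i \<le> Suc m"
    show "(E(m + 1 := X)) i \<in> Gr i \<and> (i \<in> D \<longrightarrow> (E(m + 1 := X)) i = Fl i) \<and>
      (i < Suc m \<longrightarrow> prs {i + 1} ` (E(m + 1 := X)) i \<subseteq> (E(m + 1 := X)) (i + 1)) \<and>
      (\<forall>q\<in>D. i \<le> q \<longrightarrow> prs {i + 1..q} ` (E(m + 1 := X)) i \<subseteq> Fl q)"
    proof (cases "i = m + 1")
      case True
      then show ?thesis using X by (auto simp: B_def add.assoc)
    next
      case False
      then have "i \<le> m" using i by simp
      then show ?thesis using E[of i] E(4)[of i] X(3) False by (cases "i = m") auto
    qed
  qed
qed

text \<open>Induction on the distance \<open>j - i\<close> from the diagonal. A new space is put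
  between the projection of the one at (i, j - 1), of dimension at most \<open>i\<close>, and the
  vectors with vanishing coordinate \<open>i + 1\<close> in the one at (i + 1, j), of dimension at
  least \<open>i\<close>; the vanishing coordinate also gives containment in
  \<open>Wco\<close>.\<close>

lemma triangular_flag:
  assumes E: "\<And>i. i < n \<Longrightarrow> E i \<in> Gr i" "\<And>i. i + 1 < n \<Longrightarrow> prs {i + 1} ` E i \<subseteq> E (i + 1)"
  shows "\<exists>V. \<forall>i j. 1 \<le> i \<and> i \<le> j \<and> j < n \<and> j - i \<le> c \<longrightarrow> V i j \<in> Gr i \<and> V i j \<subseteq> Wco i j \<and>
    V i i = E i \<and> (i < j \<longrightarrow> prs {j} ` V i (j - 1) \<subseteq> V i j \<and> V i j \<subseteq> V (i + 1) j)"
proof (induction c)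
  case 0
  show ?case
    by (intro exI[of _ "\<lambda>i j. E i"]) (use E(1) in \<open>auto simp: Wco_def\<close>)
next
  case (Suc c)
  then obtain V where V0: "\<forall>i j. 1 \<le> i \<and> i \<le> j \<and> j < n \<and> j - i \<le> c \<longrightarrow> V i j \<in> Gr i \<and>
    V i j \<subseteq> Wco i j \<and> V i i = E i \<and> (i < j \<longrightarrow> prs {j} ` V i (j - 1) \<subseteq> V i j \<and> V i j \<subseteq> V (i + 1) j)"
    by (rule exE)
  have V: "\<And>i j. 1 \<le> i \<Longrightarrow> i \<le> j \<Longrightarrow> j < n \<Longrightarrow> j - i \<le> c \<Longrightarrow> V i j \<in> Gr i"
    "\<And>i j. 1 \<le> i \<Longrightarrow> i \<le> j \<Longrightarrow> j < n \<Longrightarrow> j - i \<le> c \<Longrightarrow> V i j \<subseteq> Wco i j"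
    "\<And>i. 1 \<le> i \<Longrightarrow> i < n \<Longrightarrow> V i i = E i"
    "\<And>i j. 1 \<le> i \<Longrightarrow> i < j \<Longrightarrow> j < n \<Longrightarrow> j - i \<le> c \<Longrightarrow> prs {j} ` V i (j - 1) \<subseteq> V i j"
    "\<And>i j. 1 \<le> i \<Longrightarrow> i < j \<Longrightarrow> j < n \<Longrightarrow> j - i \<le> c \<Longrightarrow> V i j \<subseteq> V (i + 1) j"
    subgoal using V0 by blast
    subgoal using V0 by blast
    subgoal for i using V0[rule_format, of i i] by simp
    subgoal for i j using V0[rule_format, of i j] by simp
    subgoal for i j using V0[rule_format, of i j] by simp
    done
  have "\<exists>X. 1 \<le> i \<and> i + c + 1 < n \<longrightarrow> X \<in> Gr i \<and> X \<subseteq> Wco i (i + c + 1) \<and>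
      prs {i + c + 1} ` V i (i + c) \<subseteq> X \<and> X \<subseteq> V (i + 1) (i + c + 1)" for i
  proof (cases "1 \<le> i \<and> i + c + 1 < n")
    case True
    define j where "j = i + c"
    have j: "i \<le> j" "j + 1 < n" "1 \<le> i" "i + 1 \<le> j + 1" using True by (auto simp: j_def)
    have A: "subspace (V i j)" "dim (V i j) = i" "V i j \<subseteq> Wco i j"
      using V(1,2)[of i j] j by (auto simp: Gr_def j_def)
    have B: "subspace (V (i + 1) (j + 1))" "dim (V (i + 1) (j + 1)) = i + 1" "V (i + 1) (j + 1) \<subseteq> Wco (i + 1) (j + 1)"
      using V(1,2)[of "i + 1" "j + 1"] j by (auto simp: Gr_def j_def)
    let ?B = "{v \<in> V (i + 1) (j + 1). co (i + 1) v = 0}"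
    have co: "co t (prs {j + 1} v) = (if t = j + 1 then 0 else co t v)" if "1 \<le> t" "t \<le> j + 1" for t v
      using that j by (subst co_prs) auto
    \<comment> \<open>For \<open>c = 0\<close> this is the flag condition; otherwise it passes
      through the space at (i + 1, j).\<close>
    have "prs {j + 1} ` V i j \<subseteq> V (i + 1) (j + 1)"
    proof (cases "c = 0")
      case True
      then show ?thesis using E(2)[of i] V(3)[of i] V(3)[of "i + 1"] j by (simp add: j_def)
    next
      case False
      have "V i j \<subseteq> V (i + 1) j" using V(5)[of i j] j False by (auto simp: j_def)
      moreover have "prs {j + 1} ` V (i + 1) (j + 1 - 1) \<subseteq> V (i + 1) (j + 1)"
        using j False by (intro V(4)) (auto simp: j_def)
      ultimately show ?thesis by auto
    qed
    moreover have "co (i + 1) u = 0" if "u \<in> prs {j + 1} ` V i j" for u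
      using that A(3) j by (auto simp: co Wco_def)
    ultimately have sub: "prs {j + 1} ` V i j \<subseteq> ?B" by blast
    have "dim (prs {j + 1} ` V i j) \<le> i" using prs_image(2)[OF A(1)] A(2) by metis
    moreover have "i \<le> dim ?B" using dim_hyperplane[OF B(1), of "i + 1"] B(2) by simp
    ultimately obtain X where X: "X \<in> Gr i" "prs {j + 1} ` V i j \<subseteq> X" "X \<subseteq> ?B"
      using intermediate_subspace[OF prs_image(1)[OF A(1)] subspace_co_zero[OF B(1)] sub] by blast
    have "X \<subseteq> Wco i (j + 1)"
    proof
      fix v assume "v \<in> X"
      then have "v \<in> Wco (i + 1) (j + 1)" "co (i + 1) v = 0" using X(3) B(3) by auto
      then have "co t v = 0" if "i < t" "t \<le> j + 1" for t
        using that by (cases "t = i + 1") (auto simp: Wco_def)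
      then show "v \<in> Wco i (j + 1)" by (simp add: Wco_def)
    qed
    with X show ?thesis by (auto simp: j_def)
  qed blast
  then obtain X where X: "\<And>i. 1 \<le> i \<Longrightarrow> i + c + 1 < n \<Longrightarrow> X i \<in> Gr i \<and> X i \<subseteq> Wco i (i + c + 1) \<and>
      prs {i + c + 1} ` V i (i + c) \<subseteq> X i \<and> X i \<subseteq> V (i + 1) (i + c + 1)"
    by metis
  define V' where "V' i j = (if j = i + c + 1 then X i else V i j)" for i j
  show ?case
  proof (intro exI[of _ V'] allI impI)
    fix i j assume ij: "1 \<le> i \<and> i \<le> j \<and> j < n \<and> j - i \<le> Suc c"
    show "V' i j \<in> Gr i \<and> V' i j \<subseteq> Wco i j \<and> V' i i = E i \<and>
        (i < j \<longrightarrow> prs {j} ` V' i (j - 1) \<subseteq> V' i j \<and> V' i j \<subseteq> V' (i + 1) j)"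
    proof (cases "j = i + c + 1")
      case True
      then show ?thesis using X[of i] V(3)[of i] ij by (simp add: V'_def)
    next
      case False
      then have "j - i \<le> c" using ij by auto
      then show ?thesis using V(1,2,4,5)[of i j] V(3)[of i] ij False by (auto simp: V'_def)
    qed
  qed
qed

lemma cell_empty: "cell {} x = {0}"
  using co_ext[of _ 0] by (auto simp: cell_def)

text \<open>Erasing the last coordinate of a vector in \<open>Wco i (n - 1)\<close> leaves only the
  first \<open>i\<close>, which matches the boundary convention.\<close>

lemma pr_last:
  assumes "V \<subseteq> Wco i j" "j + 1 = n"
  shows "pr (j + 1) ` V \<subseteq> cell {1..i} (\<lambda>_. 0)"
proof (intro image_subsetI)
  fix v assume v: "v \<in> V"
  show "pr (j + 1) v \<in> cell {1..i} (\<lambda>_. 0)"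
    unfolding cell_def
  proof (intro CollectI ballI)
    fix t assume t: "t \<in> {1..n} - {1..i}"
    have "v \<in> Wco i j" using assms(1) v by blast
    then have "t \<noteq> n \<longrightarrow> co t v = 0" using t assms(2) by (auto simp: Wco_def)
    then show "co t (pr (j + 1) v) = (\<Sum>s\<in>{1..i}. co s (pr (j + 1) v) * 0)"
      using t assms(2) by (simp add: co_pr)
  qed
qed

lemma triangular_in_tower:
  assumes Q: "tower_index Q"
    and V: "\<And>i j. 1 \<le> i \<Longrightarrow> i \<le> j \<Longrightarrow> j < n \<Longrightarrow> V i j \<in> Gr i \<and> V i j \<subseteq> Wco i j \<and>
      (i < j \<longrightarrow> prs {j} ` V i (j - 1) \<subseteq> V i j \<and> V i j \<subseteq> V (i + 1) j)"
  shows "(\<lambda>(i, j)\<in>Q. V i j) \<in> tower Q"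
proof -
  let ?V = "\<lambda>(i, j)\<in>Q. V i j"
  have "?V \<in> (\<Pi>\<^sub>E q\<in>Q. Gr (fst q))"
    using V tower_indexD(1-3)[OF Q] by (intro restrict_PiE_iff[THEN iffD2]) auto
  moreover have "ext_space ?V (i - 1) j \<subseteq> ?V (i, j) \<and> pr (j + 1) ` ?V (i, j) \<subseteq> ext_space ?V i (j + 1)"
    if ij: "(i, j) \<in> Q" for i j
  proof
    note D = tower_indexD[OF Q ij]
    have Vij: "?V (i, j) = V i j" using ij by simp
    have sub: "subspace (V i j)" using V D(1-3) by (auto simp: Gr_def)
    show "ext_space ?V (i - 1) j \<subseteq> ?V (i, j)"
    proof (cases "i = 1")
      case True
      then show ?thesis using subspace_0[OF sub] ij by (simp add: ext_space_def cell_empty)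
    next
      case False
      then have "(i - 1, j) \<in> Q" using D by auto
      then show ?thesis using V[of "i - 1" j] D False ij by (auto simp: ext_space_Q[OF Q])
    qed
    show "pr (j + 1) ` ?V (i, j) \<subseteq> ext_space ?V i (j + 1)"
    proof (cases "j + 1 = n")
      case True
      then show ?thesis using pr_last[of "V i j" i j] V[of i j] D ij by (simp add: ext_space_def)
    next
      case False
      then have "(i, j + 1) \<in> Q" using D by auto
      then show ?thesis
        using V[of i "j + 1"] tower_indexD[OF Q, of i "j + 1"] D ij by (auto simp: ext_space_Q[OF Q] pr_eq_prs)
    qed
  qed
  ultimately show ?thesis unfolding tower_def by blast
qed

lemma subspace_Wco: "subspace (Wco i j)"
  by (auto simp: Wco_def subspace_def)

lemma Wij_eq_Wco:
  assumes "i \<le> j" "j \<le> n"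
  shows "Wij i j = Wco i j"
proof
  let ?B = "{1..i} \<union> {j + 1..n}"
  have "w s \<in> Wco i j" if "s \<in> ?B" for s
    unfolding Wco_def using that assms by (auto simp: co_w)
  then show "Wij i j \<subseteq> Wco i j"
    unfolding Wij_def by (intro span_minimal subspace_Wco) auto
  show "Wco i j \<subseteq> Wij i j"
  proof
    fix v assume v: "v \<in> Wco i j"
    have "co t v *\<^sub>W w t \<in> Wij i j" if "t \<in> {1..n}" for t
    proof (cases "t \<in> ?B")
      case True
      then show ?thesis unfolding Wij_def by (intro span_scale span_base imageI)
    next
      case False
      then have "co t v = 0" using v that by (auto simp: Wco_def)
      then show ?thesis unfolding Wij_def by (simp add: span_zero)
    qed
    then have "(\<Sum>t\<in>{1..n}. co t v *\<^sub>W w t) \<in> Wij i j" unfolding Wij_def by (intro span_sum) auto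
    then show "v \<in> Wij i j" by (simp add: w_expansion)
  qed
qed

lemma tower_pr_chain:
  assumes Q: "tower_index Q" and V: "V \<in> tower Q" and ij: "(i, j) \<in> Q" and "j \<le> m" "m < n"
  shows "(i, m) \<in> Q \<and> prs {j + 1..m} ` V (i, j) \<subseteq> V (i, m)"
  using assms(4,5)
proof (induction m rule: dec_induct)
  case base
  then show ?case using ij by (simp add: prs_empty)
next
  case (step m)
  then have IH: "(i, m) \<in> Q" "prs {j + 1..m} ` V (i, j) \<subseteq> V (i, m)" by auto
  have Q1: "(i, m + 1) \<in> Q" using tower_indexD(5)[OF Q IH(1)] step by auto
  have "pr (m + 1) ` V (i, m) \<subseteq> V (i, m + 1)" using towerD(3)[OF V IH(1)] by (simp add: ext_space_Q[OF Q Q1])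
  moreover have "prs {j + 1..m + 1} v = pr (m + 1) (prs {j + 1..m} v)" for v
  proof -
    have "insert (m + 1) {j + 1..m} = {j + 1..m + 1}" using step by auto
    then show ?thesis by (simp add: pr_eq_prs prs_prs)
  qed
  ultimately have "prs {j + 1..m + 1} ` V (i, j) \<subseteq> V (i, m + 1)"
    using IH(2) by (simp add: image_subset_iff)
  then show ?case unfolding Suc_eq_plus1 using Q1 by blast
qed

lemma tower_inc_chain:
  assumes Q: "tower_index Q" and V: "V \<in> tower Q" and "i \<le> m" and "1 \<le> i" and "(m, j) \<in> Q"
  shows "(i, j) \<in> Q \<and> V (i, j) \<subseteq> V (m, j)"
  using assms(3,5)
proof (induction m rule: dec_induct)
  case (step m)
  have "m \<noteq> 0" using step assms(4) by simp
  then have Q1: "(m, j) \<in> Q" using tower_indexD(4)[OF Q step.prems] by simp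
  have "V (m, j) \<subseteq> V (Suc m, j)" using towerD(2)[OF V step.prems] by (simp add: ext_space_Q[OF Q Q1])
  then show ?case using step.IH[OF Q1] by blast
qed simp

end

section \<open>The given flag type and surjectivity of the forgetful map\<close>

locale flag_type = based_vector_space scale n w
  for scale :: "complex \<Rightarrow> 'w::ab_group_add \<Rightarrow> 'w" (infixr "*\<^sub>W" 75) and n w +
  fixes d :: "nat \<Rightarrow> nat" and k :: nat
  assumes k_pos: "1 \<le> k" and d_pos: "1 \<le> d 1" and d_mono: "strict_mono_on {1..k} d" and d_less: "d k < n"
begin

abbreviation "P \<equiv> flag_index_set n d k"

lemma d_strict: "l < l' \<Longrightarrow> 1 \<le> l \<Longrightarrow> l' \<le> k \<Longrightarrow> d l < d l'"
  using d_mono by (auto simp: strict_mono_on_def)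

lemma d_bounds:
  assumes "1 \<le> l" "l \<le> k"
  shows "1 \<le> d l" "d l < n"
  using d_strict[of 1 l] d_strict[of l k] d_pos d_less assms by (cases "l = 1"; cases "l = k"; simp)+

lemma d_inj: "inj_on d {1..k}"
  using d_mono strict_mono_on_imp_inj_on by blast

lemma P_tower_index: "tower_index P"
  unfolding tower_index_def flag_index_set_def
proof (intro allI impI)
  fix i j assume "(i, j) \<in> {(i, j). 1 \<le> i \<and> i \<le> j \<and> j \<le> n - 1 \<and> (\<exists>l\<in>{1..k}. i \<le> d l \<and> d l \<le> j)}"
  then obtain l where l: "l \<in> {1..k}" "i \<le> d l" "d l \<le> j" and ij: "1 \<le> i" "i \<le> j" "j \<le> n - 1" by auto
  then show "1 \<le> i \<and> i \<le> j \<and> j < n \<and>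
      (i = 1 \<or> (i - 1, j) \<in> {(i, j). 1 \<le> i \<and> i \<le> j \<and> j \<le> n - 1 \<and> (\<exists>l\<in>{1..k}. i \<le> d l \<and> d l \<le> j)}) \<and>
      (j + 1 = n \<or> (i, j + 1) \<in> {(i, j). 1 \<le> i \<and> i \<le> j \<and> j \<le> n - 1 \<and> (\<exists>l\<in>{1..k}. i \<le> d l \<and> d l \<le> j)})"
    using d_less by (auto intro!: bexI[of _ l])
qed

lemma diagonal_in_P: "l \<in> {1..k} \<Longrightarrow> (d l, d l) \<in> P"
  using d_bounds[of l] by (auto simp: flag_index_set_def)

text \<open>The descriptions differ at the boundary: \<open>Wij\<close> yields the condition for
  \<open>j + 1 = n\<close>, and conversely containment in \<open>Wij\<close> is recovered from a
  chart by \<open>crd_chain\<close>.\<close>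

lemma R_variety_eq_tower: "R_variety d k = tower P"
proof -
  have Gr: "(\<lambda>(i, j). Gr i) = (\<lambda>q :: nat \<times> nat. Gr (fst q))" by auto
  note Q = P_tower_index
  show ?thesis
  proof (intro subset_antisym subsetI)
    fix V assume V: "V \<in> R_variety d k"
    have 1: "V \<in> (\<Pi>\<^sub>E q\<in>P. Gr (fst q))" using V unfolding R_variety_def Gr by blast
    have 2: "V (i, j) \<subseteq> Wij i j" if "(i, j) \<in> P" for i j using V that unfolding R_variety_def by blast
    have 3: "pr (j + 1) ` V (i, j) \<subseteq> V (i, j + 1)" if "(i, j) \<in> P" "(i, j + 1) \<in> P" for i j
      using V that unfolding R_variety_def by blast
    have 4: "V (i, j + 1) \<subseteq> V (i + 1, j + 1)" if "(i, j + 1) \<in> P" "(i + 1, j + 1) \<in> P" for i j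
      using V that unfolding R_variety_def by blast
    have "ext_space V (i - 1) j \<subseteq> V (i, j) \<and> pr (j + 1) ` V (i, j) \<subseteq> ext_space V i (j + 1)"
      if ij: "(i, j) \<in> P" for i j
    proof
      note D = tower_indexD[OF Q ij]
      have "V (i, j) \<in> Gr i" using PiE_mem[OF 1 ij] by simp
      then have sub: "0 \<in> V (i, j)" by (auto simp: Gr_def subspace_0)
      show "ext_space V (i - 1) j \<subseteq> V (i, j)"
      proof (cases "i = 1")
        case True
        then show ?thesis using sub by (simp add: ext_space_def cell_empty)
      next
        case False
        then have "(i - 1, j) \<in> P" using D by auto
        then show ?thesis using 4[of "i - 1" "j - 1"] D ij False by (simp add: ext_space_Q[OF Q])
      qed
      show "pr (j + 1) ` V (i, j) \<subseteq> ext_space V i (j + 1)"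
      proof (cases "j + 1 = n")
        case True
        then show ?thesis
          using pr_last[of "V (i, j)" i j] 2[OF ij] D Wij_eq_Wco[of i j] by (simp add: ext_space_def)
      next
        case False
        then have "(i, j + 1) \<in> P" using D by auto
        then show ?thesis using 3 ij by (simp add: ext_space_Q[OF Q])
      qed
    qed
    with 1 show "V \<in> tower P" unfolding tower_def by blast
  next
    fix V assume V: "V \<in> tower P"
    obtain S y where S: "admissible P S" and Vphi: "V = phi P S y" by (rule tower_chart[OF Q V])
    have 1: "V \<in> (\<Pi>\<^sub>E q\<in>P. Gr (fst q))" using V unfolding tower_def by blast
    have 2: "V (i, j) \<subseteq> Wij i j" if ij: "(i, j) \<in> P" for i j
    proof -
      have "V (i, j) \<subseteq> Wco i j"
        using crd_chain[OF Q S, of i j y] ij unfolding Vphi by (auto simp: phi_def ext_set_Q[OF Q])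
      then show ?thesis using Wij_eq_Wco[of i j] tower_indexD[OF Q ij] by simp
    qed
    have 3: "pr (j + 1) ` V (i, j) \<subseteq> V (i, j + 1)" if "(i, j) \<in> P" "(i, j + 1) \<in> P" for i j
      using towerD(3)[OF V that(1)] by (simp add: ext_space_Q[OF Q that(2)])
    have 4: "V (i, j + 1) \<subseteq> V (i + 1, j + 1)" if "(i, j + 1) \<in> P" "(i + 1, j + 1) \<in> P" for i j
      using towerD(2)[OF V that(2)] by (simp add: ext_space_Q[OF Q that(1)])
    show "V \<in> R_variety d k"
      unfolding R_variety_def Gr using 1 2 3 4 by blast
  qed
qed

lemma deg_flag_variety_iff:
  "V \<in> deg_flag_variety d k \<longleftrightarrow> V \<in> (\<Pi>\<^sub>E l\<in>{1..k}. Gr (d l)) \<and>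
    (\<forall>l\<in>{1..<k}. prs {d l + 1..d (l + 1)} ` V l \<subseteq> V (l + 1))"
  unfolding deg_flag_variety_def foldr_pr set_upt Suc_eq_plus1[symmetric] atLeastLessThanSuc_atLeastAtMost
  by (rule mem_Collect_eq)

lemma forget_in_deg_flag:
  assumes V: "V \<in> tower P"
  shows "forget_off_diagonal d k V \<in> deg_flag_variety d k"
  unfolding deg_flag_variety_iff
proof (intro conjI ballI)
  show "forget_off_diagonal d k V \<in> (\<Pi>\<^sub>E l\<in>{1..k}. Gr (d l))"
    unfolding forget_off_diagonal_def
    by (intro restrict_PiE_iff[THEN iffD2] ballI towerD(1)[OF V diagonal_in_P])
  fix l assume l: "l \<in> {1..<k}"
  then have lk: "l \<in> {1..k}" "l + 1 \<in> {1..k}" by auto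
  have dl: "d l < d (l + 1)" "d (l + 1) < n" "1 \<le> d l"
    using d_strict[of l "l + 1"] d_bounds[of "l + 1"] d_bounds[of l] l by auto
  have "prs {d l + 1..d (l + 1)} ` V (d l, d l) \<subseteq> V (d l, d (l + 1))"
    using tower_pr_chain[OF P_tower_index V diagonal_in_P[OF lk(1)]] dl by auto
  also have "\<dots> \<subseteq> V (d (l + 1), d (l + 1))"
    using tower_inc_chain[OF P_tower_index V _ _ diagonal_in_P[OF lk(2)]] dl by auto
  finally show "prs {d l + 1..d (l + 1)} ` forget_off_diagonal d k V l \<subseteq> forget_off_diagonal d k V (l + 1)"
    using lk by (simp add: forget_off_diagonal_def)
qed

lemma deg_flag_pairs:
  assumes G: "G \<in> deg_flag_variety d k" and l: "1 \<le> l"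
  shows "Suc l \<le> l' \<Longrightarrow> l' \<le> k \<Longrightarrow> prs {d l + 1..d l'} ` G l \<subseteq> G l'"
proof (induction l' rule: dec_induct)
  case base
  then have "l \<in> {1..<k}" using l by auto
  then have "prs {d l + 1..d (l + 1)} ` G l \<subseteq> G (l + 1)" using G unfolding deg_flag_variety_iff by blast
  then show ?case by (simp only: Suc_eq_plus1)
next
  case (step m)
  have 1: "prs {d l + 1..d m} ` G l \<subseteq> G m" using step by simp
  have "m \<in> {1..<k}" using step l by auto
  then have 2: "prs {d m + 1..d (Suc m)} ` G m \<subseteq> G (Suc m)"
    using G unfolding deg_flag_variety_iff Suc_eq_plus1 by blast
  have "d l < d m" "d m < d (Suc m)" using step l by (auto intro!: d_strict)
  then have eq: "{d m + 1..d (Suc m)} \<union> {d l + 1..d m} = {d l + 1..d (Suc m)}" by auto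
  have "prs {d l + 1..d (Suc m)} v = prs {d m + 1..d (Suc m)} (prs {d l + 1..d m} v)" for v
    unfolding prs_prs eq ..
  then show ?case using 1 2 by auto
qed

lemma forget_surj:
  assumes G: "G \<in> deg_flag_variety d k"
  obtains V where "V \<in> tower P" "forget_off_diagonal d k V = G"
proof -
  \<comment> \<open>The given spaces reindexed by their dimensions, as \<open>full_flag\<close>
    expects.\<close>
  define Fl where "Fl q = G (inv_into {1..k} d q)" for q
  have Fl: "Fl (d l) = G l" if "l \<in> {1..k}" for l using d_inj that by (simp add: Fl_def)
  have GP: "G \<in> (\<Pi>\<^sub>E l\<in>{1..k}. Gr (d l))" using G unfolding deg_flag_variety_iff by blast
  have "\<exists>E. \<forall>i\<le>n - 1. E i \<in> Gr i \<and> (i \<in> d ` {1..k} \<longrightarrow> E i = Fl i) \<and>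
    (i < n - 1 \<longrightarrow> prs {i + 1} ` E i \<subseteq> E (i + 1)) \<and>
    (\<forall>q\<in>d ` {1..k}. i \<le> q \<longrightarrow> prs {i + 1..q} ` E i \<subseteq> Fl q)"
  proof (rule full_flag)
    show "d ` {1..k} \<subseteq> {1..<n}" using d_bounds by auto
    show "Fl q \<in> Gr q" if "q \<in> d ` {1..k}" for q
      using that Fl PiE_mem[OF GP] by auto
    show "prs {p + 1..q} ` Fl p \<subseteq> Fl q" if pq: "p \<in> d ` {1..k}" "q \<in> d ` {1..k}" "p < q" for p q
    proof -
      obtain l where l1: "l \<in> {1..k}" "p = d l" using pq(1) by blast
      obtain l' where l2: "l' \<in> {1..k}" "q = d l'" using pq(2) by blast
      note l = l1(1) l2(1) l1(2) l2(2)
      have "l < l'"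
      proof (rule ccontr)
        assume "\<not> l < l'"
        then consider "l = l'" | "l' < l" by linarith
        then have "l = l' \<or> d l' < d l" using d_strict[of l' l] l by cases auto
        then show False using pq(3) l by auto
      qed
      then show ?thesis using deg_flag_pairs[OF G, of l l'] l Fl by auto
    qed
    show "n - 1 < n" using d_less by simp
  qed
  then obtain E where E0: "\<forall>i\<le>n - 1. E i \<in> Gr i \<and> (i \<in> d ` {1..k} \<longrightarrow> E i = Fl i) \<and>
    (i < n - 1 \<longrightarrow> prs {i + 1} ` E i \<subseteq> E (i + 1)) \<and>
    (\<forall>q\<in>d ` {1..k}. i \<le> q \<longrightarrow> prs {i + 1..q} ` E i \<subseteq> Fl q)" by (rule exE)
  have E: "\<And>i. i \<le> n - 1 \<Longrightarrow> E i \<in> Gr i" "\<And>i. i \<le> n - 1 \<Longrightarrow> i \<in> d ` {1..k} \<Longrightarrow> E i = Fl i"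
    "\<And>i. i < n - 1 \<Longrightarrow> prs {i + 1} ` E i \<subseteq> E (i + 1)"
    using E0[rule_format] by simp_all
  \<comment> \<open>The bound \<open>n\<close> on \<open>j - i\<close> admits all pairs.\<close>
  have "\<exists>V. \<forall>i j. 1 \<le> i \<and> i \<le> j \<and> j < n \<and> j - i \<le> n \<longrightarrow> V i j \<in> Gr i \<and> V i j \<subseteq> Wco i j \<and>
    V i i = E i \<and> (i < j \<longrightarrow> prs {j} ` V i (j - 1) \<subseteq> V i j \<and> V i j \<subseteq> V (i + 1) j)"
    by (rule triangular_flag) (use E in auto)
  then obtain V where V0: "\<forall>i j. 1 \<le> i \<and> i \<le> j \<and> j < n \<and> j - i \<le> n \<longrightarrow> V i j \<in> Gr i \<and>
    V i j \<subseteq> Wco i j \<and> V i i = E i \<and> (i < j \<longrightarrow> prs {j} ` V i (j - 1) \<subseteq> V i j \<and> V i j \<subseteq> V (i + 1) j)"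
    by (rule exE)
  have V: "V i j \<in> Gr i \<and> V i j \<subseteq> Wco i j \<and>
      V i i = E i \<and> (i < j \<longrightarrow> prs {j} ` V i (j - 1) \<subseteq> V i j \<and> V i j \<subseteq> V (i + 1) j)"
    if "1 \<le> i" "i \<le> j" "j < n" for i j
    using V0[rule_format, of i j] that by simp
  show ?thesis
  proof (rule that[of "\<lambda>(i, j)\<in>P. V i j"])
    show "(\<lambda>(i, j)\<in>P. V i j) \<in> tower P"
      by (rule triangular_in_tower[OF P_tower_index]) (use V in blast)
    have "V (d l) (d l) = G l" if l: "l \<in> {1..k}" for l
      using V[of "d l" "d l"] E(2)[of "d l"] d_bounds[of l] Fl[OF l] l by auto
    moreover have "G l = undefined" if "l \<notin> {1..k}" for l using PiE_arb[OF GP that] .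
    ultimately show "forget_off_diagonal d k (\<lambda>(i, j)\<in>P. V i j) = G"
      using diagonal_in_P by (auto simp: forget_off_diagonal_def fun_eq_iff)
  qed
qed

lemma deg_flag_eq_image: "deg_flag_variety d k = forget_off_diagonal d k ` tower P"
  using forget_in_deg_flag forget_surj by blast

end

section \<open>The forgetful map is a morphism\<close>

lemma prod_atlasI: "(I, \<psi>) \<in> \<A> \<Longrightarrow> (J, \<phi>) \<in> \<B> \<Longrightarrow>
    (I <+> J, \<lambda>x. (\<psi> (\<lambda>i. x (Inl i)), \<phi> (\<lambda>j. x (Inr j)))) \<in> prod_atlas \<A> \<B>"
  unfolding prod_atlas_def by blast

lemma prod_atlas_points:
  assumes "p \<in> atlas_points \<A>" "q \<in> atlas_points \<B>"
  shows "(p, q) \<in> atlas_points (prod_atlas \<A> \<B>)"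
proof -
  obtain I \<psi> x where I: "(I, \<psi>) \<in> \<A>" "x \<in> aff_space I" "\<psi> x = p" by (rule atlas_pointsE[OF assms(1)])
  obtain J \<phi> y where J: "(J, \<phi>) \<in> \<B>" "y \<in> aff_space J" "\<phi> y = q" by (rule atlas_pointsE[OF assms(2)])
  have "case_sum x y \<in> aff_space (I <+> J)"
    using I(2) J(2) by (auto simp: aff_space_def split: sum.split)
  from atlas_pointsI[OF prod_atlasI[OF I(1) J(1)] this] show ?thesis using I(3) J(3) by simp
qed

context based_vector_space
begin

definition par :: "(nat \<times> nat) set \<Rightarrow> (nat \<times> nat \<Rightarrow> nat set) \<Rightarrow> (nat \<times> nat \<Rightarrow> complex) \<Rightarrow>
    (nat \<times> nat) \<times> nat \<times> nat \<Rightarrow> complex" where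
  "par Q S y = (\<lambda>i. if i \<in> fam_index Q S then crd S y (fst (fst i)) (snd (fst i)) (snd i) else 0)"

lemma par_aff_space: "par Q S y \<in> aff_space (fam_index Q S)"
  by (simp add: par_def aff_space_def)

lemma fam_par: "fam Q S (par Q S y) = phi Q S y"
  unfolding fam_def phi_def
  by (intro restrict_ext cell_cong) (auto simp: par_def fam_index_def)

lemma par_polyfun:
  assumes "tower_index Q"
  shows "(\<lambda>y. par Q S y i) \<in> polyfuns Q"
proof (cases "i \<in> fam_index Q S")
  case True
  then have "(fst (fst i), snd (fst i)) \<in> Q" by (auto simp: fam_index_def)
  then show ?thesis using True crd_polyfun[OF assms] by (simp add: par_def)
qed (simp add: par_def polyfuns.const)

lemma tower_subset_atlas_points:
  assumes "tower_index Q"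
  shows "tower Q \<subseteq> atlas_points (fam_atlas Q fst)"
  using closedin_subset[OF tower_closed[OF assms]] by (simp add: topspace_zariski)

text \<open>By equality of dimensions, distinct members differ by a failing inclusion, the form
  needed for \<open>cell_inclusion_polyfun\<close>.\<close>

lemma fam_not_subset:
  assumes "\<And>a. a \<in> A \<Longrightarrow> S a \<subseteq> {1..n}" "\<And>a. a \<in> A \<Longrightarrow> S' a \<subseteq> {1..n}"
    and "\<And>a. a \<in> A \<Longrightarrow> card (S a) = card (S' a)" and "fam A S x \<noteq> fam A S' y"
  obtains a where "a \<in> A" "\<not> prs {} ` cell (S a) (\<lambda>i. x (a, i)) \<subseteq> cell (S' a) (\<lambda>i. y (a, i))"
proof -
  have "\<exists>a\<in>A. cell (S a) (\<lambda>i. x (a, i)) \<noteq> cell (S' a) (\<lambda>i. y (a, i))"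
  proof (rule ccontr)
    assume "\<not> ?thesis"
    then have "fam A S x = fam A S' y" unfolding fam_def by (intro restrict_ext) simp
    with assms(4) show False ..
  qed
  then obtain a where a: "a \<in> A" "cell (S a) (\<lambda>i. x (a, i)) \<noteq> cell (S' a) (\<lambda>i. y (a, i))" ..
  have "\<not> cell (S a) (\<lambda>i. x (a, i)) \<subseteq> cell (S' a) (\<lambda>i. y (a, i))"
  proof
    assume sub: "cell (S a) (\<lambda>i. x (a, i)) \<subseteq> cell (S' a) (\<lambda>i. y (a, i))"
    have "cell (S a) (\<lambda>i. x (a, i)) = cell (S' a) (\<lambda>i. y (a, i))"
      by (rule Gr_eqI[OF cell_in_Gr cell_in_Gr sub]) (simp_all add: assms(1-3) a(1))
    with a(2) show False by simp
  qed
  then show ?thesis using that a(1) by (simp add: prs_empty)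
qed

end

context flag_type
begin

lemma finite_P: "finite P"
  by (rule tower_index_finite[OF P_tower_index])

lemma R_ambient_eq: "R_ambient d k = fam_atlas P fst"
  unfolding R_ambient_def fam_atlas_def by (simp add: case_prod_unfold)

lemma deg_flag_ambient_eq: "deg_flag_ambient d k = fam_atlas {1..k} d"
  unfolding deg_flag_ambient_def fam_atlas_def ..

abbreviation "forget \<equiv> forget_off_diagonal d k"
abbreviation "\<A> \<equiv> fam_atlas P fst"
abbreviation "\<B> \<equiv> fam_atlas {1..k} d"
abbreviation "F \<equiv> deg_flag_variety d k"

lemma good_A: "good_atlas \<A>"
  by (rule good_fam_atlas[OF finite_P])

lemma good_B: "good_atlas \<B>"
  by (rule good_fam_atlas) simp

lemma forget_fam:
  "forget (fam P S x) = fam {1..k} (\<lambda>l. S (d l, d l)) (\<lambda>(l, p). x ((d l, d l), p))"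
  unfolding forget_off_diagonal_def fam_def by (intro restrict_ext) (simp add: diagonal_in_P)

lemma F_subset_atlas_points: "F \<subseteq> atlas_points \<B>"
proof
  fix G assume "G \<in> F"
  then obtain V where V: "V \<in> tower P" "forget V = G" by (rule forget_surj)
  obtain S y where S: "admissible P S" and "V = phi P S y" by (rule tower_chart[OF P_tower_index V(1)])
  then have G: "G = fam {1..k} (\<lambda>l. S (d l, d l)) (\<lambda>(l, p). par P S y ((d l, d l), p))"
    using V(2) by (simp flip: fam_par forget_fam)
  obtain x where x: "x \<in> aff_space (fam_index {1..k} (\<lambda>l. S (d l, d l)))" "G = fam {1..k} (\<lambda>l. S (d l, d l)) x"
    using fam_aff_space[of "{1..k}" "\<lambda>l. S (d l, d l)" "\<lambda>(l, p). par P S y ((d l, d l), p)"] G by metis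
  have "(fam_index {1..k} (\<lambda>l. S (d l, d l)), fam {1..k} (\<lambda>l. S (d l, d l))) \<in> \<B>"
    using admissible_sets[OF P_tower_index S diagonal_in_P] by (intro fam_atlasI) auto
  from atlas_pointsI[OF this x(1)] show "G \<in> atlas_points \<B>" using x(2) by simp
qed

lemma F_closed: "closedin (zariski \<B>) F"
proof (rule closedin_zariskiI[OF F_subset_atlas_points])
  fix I \<psi> x0 assume "(I, \<psi>) \<in> \<B>" and x0: "\<psi> x0 \<notin> F"
  obtain T where T: "\<And>l. l \<in> {1..k} \<Longrightarrow> T l \<subseteq> {1..n}" "\<And>l. l \<in> {1..k} \<Longrightarrow> card (T l) = d l"
    and I: "I = fam_index {1..k} T" "\<psi> = fam {1..k} T"
    by (rule fam_atlasE[OF \<open>(I, \<psi>) \<in> \<B>\<close>]) (rule that)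
  have "fam {1..k} T x0 \<in> (\<Pi>\<^sub>E l\<in>{1..k}. Gr (d l))" using T by (intro fam_in_PiE)
  then obtain l where l: "l \<in> {1..<k}" and
    "\<not> prs {d l + 1..d (l + 1)} ` fam {1..k} T x0 l \<subseteq> fam {1..k} T x0 (l + 1)"
    using x0 unfolding I deg_flag_variety_iff by blast
  then have lk: "l \<in> {1..k}" "l + 1 \<in> {1..k}" and
    neq: "\<not> prs {d l + 1..d (l + 1)} ` cell (T l) (\<lambda>p. x0 (l, p)) \<subseteq> cell (T (l + 1)) (\<lambda>p. x0 (l + 1, p))"
    by (auto simp: fam_apply)
  obtain h where h: "h \<in> polyfuns I" "h x0 \<noteq> 0" "\<And>x. prs {d l + 1..d (l + 1)} ` cell (T l) (\<lambda>p. x (l, p)) \<subseteq>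
      cell (T (l + 1)) (\<lambda>p. x (l + 1, p)) \<Longrightarrow> h x = 0"
  proof (rule cell_inclusion_polyfun'[of "T l" "T (l + 1)" "\<lambda>x p. x (l, p)" I "\<lambda>x p. x (l + 1, p)"
        "{d l + 1..d (l + 1)}" x0])
    show "(\<lambda>x. x (l, s, t)) \<in> polyfuns I" if "s \<in> T l" "t \<in> {1..n} - T l" for s t
      using that lk by (intro polyfuns.coord) (auto simp: I fam_index_def)
    show "(\<lambda>x. x (l + 1, s, t)) \<in> polyfuns I" if "s \<in> T (l + 1)" "t \<in> {1..n} - T (l + 1)" for s t
      using that lk by (intro polyfuns.coord) (auto simp: I fam_index_def)
  qed (use T lk neq in \<open>blast+\<close>)
  have "h x = 0" if "\<psi> x \<in> F" for x
  proof (rule h(3))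
    have "prs {d l + 1..d (l + 1)} ` fam {1..k} T x l \<subseteq> fam {1..k} T x (l + 1)"
      using that l unfolding I deg_flag_variety_iff by blast
    then show "prs {d l + 1..d (l + 1)} ` cell (T l) (\<lambda>p. x (l, p)) \<subseteq> cell (T (l + 1)) (\<lambda>p. x (l + 1, p))"
      by (simp only: fam_apply[OF lk(1)] fam_apply[OF lk(2)])
  qed
  with h(1,2) show "\<exists>h\<in>polyfuns I. h x0 \<noteq> 0 \<and> (\<forall>x\<in>aff_space I. \<psi> x \<in> F \<longrightarrow> h x = 0)" by blast
qed

text \<open>The target chart \<open>T\<close> is arbitrary, so the source chart is built around it:
  \<open>T\<close> on the diagonal, any suitable sets off it. In these charts forgetting merely
  selects coordinates.\<close>

lemma forget_rational:
  assumes "V \<in> tower P"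
  shows "rational_at \<A> X \<B> forget V"
  unfolding rational_at_def
proof (intro allI impI)
  fix J \<theta> y assume *: "(J, \<theta>) \<in> \<B> \<and> y \<in> aff_space J \<and> \<theta> y = forget V"
  then have "(J, \<theta>) \<in> \<B>" by blast
  then obtain T where T: "\<And>l. l \<in> {1..k} \<Longrightarrow> T l \<subseteq> {1..n}" "\<And>l. l \<in> {1..k} \<Longrightarrow> card (T l) = d l"
    and J: "J = fam_index {1..k} T" "\<theta> = fam {1..k} T"
    by (rule fam_atlasE) (rule that)
  obtain S y' where S: "admissible P S" and V: "V = phi P S y'" by (rule tower_chart[OF P_tower_index assms])
  define l where "l q = inv_into {1..k} d (fst q)" for q :: "nat \<times> nat"
  have l: "l (d m, d m) = m" if "m \<in> {1..k}" for m using d_inj that by (simp add: l_def)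
  define Dg where "Dg = (\<lambda>m. (d m, d m)) ` {1..k}"
  define S' where "S' q = (if q \<in> Dg then T (l q) else S q)" for q
  define x where "x = (\<lambda>(q, p). if q \<in> Dg then y (l q, p) else crd S y' (fst q) (snd q) p)"
  have S'diag: "S' (d m, d m) = T m" if "m \<in> {1..k}" for m using that l by (auto simp: S'_def Dg_def)
  have chart: "(fam_index P S', fam P S') \<in> \<A>"
  proof (rule fam_atlasI)
    fix q assume q: "q \<in> P"
    have "S' q \<subseteq> {1..n} \<and> card (S' q) = fst q"
    proof (cases "q \<in> Dg")
      case True
      then obtain m where m: "m \<in> {1..k}" "q = (d m, d m)" by (auto simp: Dg_def)
      then show ?thesis using T[OF m(1)] S'diag by simp
    next
      case False
      then show ?thesis using admissible_sets[OF P_tower_index S q] by (simp add: S'_def)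
    qed
    then show "S' q \<subseteq> {1..n}" "card (S' q) = fst q" by simp_all
  qed
  have "V q = fam P S' x q" if q: "q \<in> P" for q
  proof (cases "q \<in> Dg")
    case True
    then obtain m where m: "m \<in> {1..k}" "q = (d m, d m)" by (auto simp: Dg_def)
    have "V q = forget V m" using m by (simp add: forget_off_diagonal_def)
    also have "\<dots> = cell (T m) (\<lambda>p. y (m, p))" using * m by (metis J(2) fam_apply)
    also have "\<dots> = fam P S' x q"
      using True q m l by (simp add: fam_apply S'diag x_def)
    finally show ?thesis .
  next
    case False
    then show ?thesis using q by (simp add: V phi_def fam_apply S'_def x_def)
  qed
  then have Vx: "V = fam P S' x"
    using assms by (intro extensionalityI[OF _ fam_extensional]) (auto simp: tower_def PiE_def)
  obtain x' where x': "x' \<in> aff_space (fam_index P S')" "V = fam P S' x'"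
    using fam_aff_space[of P S' x] Vx by metis
  define num where "num i z = (z ((d (fst i), d (fst i)), snd i) :: complex)" for i :: "nat \<times> nat \<times> nat" and z
  have "forget (fam P S' z) = fam {1..k} T (ratvec J num (\<lambda>_. 1) z)" for z
    unfolding forget_fam unfolding fam_def
    by (intro restrict_ext cell_cong) (auto simp: S'diag ratvec_def num_def J fam_index_def)
  moreover have "num i \<in> polyfuns (fam_index P S')" if "i \<in> J" for i
  proof -
    have "((d (fst i), d (fst i)), snd i) \<in> fam_index P S'"
      using that diagonal_in_P by (auto simp: J fam_index_def S'diag)
    then show ?thesis unfolding num_def[abs_def] by (rule polyfuns.coord)
  qed
  ultimately show "\<exists>I \<psi> x h num. (I, \<psi>) \<in> \<A> \<and> x \<in> aff_space I \<and> \<psi> x = V \<and> h \<in> polyfuns I \<and>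
          (\<forall>j\<in>J. num j \<in> polyfuns I) \<and> h x \<noteq> 0 \<and>
          (\<forall>z\<in>aff_space I. h z \<noteq> 0 \<and> \<psi> z \<in> X \<longrightarrow> forget (\<psi> z) = \<theta> (ratvec J num h z))"
    using chart x' J(2)
    by (intro exI[of _ "fam_index P S'"] exI[of _ "fam P S'"] exI[of _ x'] exI[of _ "\<lambda>_. 1"] exI[of _ num])
      (simp add: polyfuns.const)
qed

lemma forget_morphism:
  assumes "X \<subseteq> tower P" "Y \<subseteq> F" "forget ` X \<subseteq> Y"
  shows "var_morphism \<A> X \<B> Y forget"
  using assms tower_subset_atlas_points[OF P_tower_index] F_subset_atlas_points
  by (intro var_morphismI good_A good_B forget_rational) auto


section \<open>Properness\<close>

text \<open>The diagonal of the whole ambient space is closed, and this is restricted to the fibre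
  product.\<close>

lemma forget_separated: "separated_morphism \<A> (tower P) forget"
proof -
  define C where "C = (\<lambda>p. (p, p)) ` atlas_points \<A>"
  have "closedin (zariski (prod_atlas \<A> \<A>)) C"
  proof (rule closedin_zariskiI)
    show "C \<subseteq> atlas_points (prod_atlas \<A> \<A>)" by (auto simp: C_def prod_atlas_points)
    fix I \<psi> x0 assume "(I, \<psi>) \<in> prod_atlas \<A> \<A>" and x0: "x0 \<in> aff_space I" "\<psi> x0 \<notin> C"
    then obtain I1 \<psi>1 I2 \<psi>2 where ch: "(I1, \<psi>1) \<in> \<A>" "(I2, \<psi>2) \<in> \<A>"
      and I: "I = I1 <+> I2" "\<psi> = (\<lambda>x. (\<psi>1 (\<lambda>i. x (Inl i)), \<psi>2 (\<lambda>i. x (Inr i))))"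
      by (auto simp: prod_atlas_def)
    obtain S where S: "\<And>q. q \<in> P \<Longrightarrow> S q \<subseteq> {1..n}" "\<And>q. q \<in> P \<Longrightarrow> card (S q) = fst q"
      "I1 = fam_index P S" "\<psi>1 = fam P S" by (rule fam_atlasE[OF ch(1)]) (rule that)
    obtain S' where S': "\<And>q. q \<in> P \<Longrightarrow> S' q \<subseteq> {1..n}" "\<And>q. q \<in> P \<Longrightarrow> card (S' q) = fst q"
      "I2 = fam_index P S'" "\<psi>2 = fam P S'" by (rule fam_atlasE[OF ch(2)]) (rule that)
    have "(\<lambda>i. x0 (Inl i)) \<in> aff_space I1" using x0(1) by (auto simp: aff_space_def I)
    then have "\<psi>1 (\<lambda>i. x0 (Inl i)) \<in> atlas_points \<A>" by (rule atlas_pointsI[OF ch(1)])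
    then have "fam P S (\<lambda>i. x0 (Inl i)) \<noteq> fam P S' (\<lambda>i. x0 (Inr i))"
      using x0(2) by (auto simp: I C_def S(4) S'(4))
    then obtain q where q: "q \<in> P"
      "\<not> prs {} ` cell (S q) (\<lambda>i. x0 (Inl (q, i))) \<subseteq> cell (S' q) (\<lambda>i. x0 (Inr (q, i)))"
      by (rule fam_not_subset[of P S S', rotated 3]) (use S(1,2) S'(1,2) in simp_all)
    obtain h where h: "h \<in> polyfuns I" "h x0 \<noteq> 0"
      "\<And>x. prs {} ` cell (S q) (\<lambda>i. x (Inl (q, i))) \<subseteq> cell (S' q) (\<lambda>i. x (Inr (q, i))) \<Longrightarrow> h x = 0"
    proof (rule cell_inclusion_polyfun'[of "S q" "S' q" "\<lambda>x i. x (Inl (q, i))" I "\<lambda>x i. x (Inr (q, i))" "{}" x0])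
      show "(\<lambda>x. x (Inl (q, s, t))) \<in> polyfuns I" if "s \<in> S q" "t \<in> {1..n} - S q" for s t
        using that q(1) by (intro polyfuns.coord) (auto simp: I S(3) fam_index_def)
      show "(\<lambda>x. x (Inr (q, s, t))) \<in> polyfuns I" if "s \<in> S' q" "t \<in> {1..n} - S' q" for s t
        using that q(1) by (intro polyfuns.coord) (auto simp: I S'(3) fam_index_def)
    qed (use S(1) S'(1) q in \<open>blast+\<close>)
    have "h x = 0" if "\<psi> x \<in> C" for x
    proof (rule h(3))
      have "fam P S (\<lambda>i. x (Inl i)) q = fam P S' (\<lambda>i. x (Inr i)) q"
        using that by (auto simp: I C_def S(4) S'(4))
      then show "prs {} ` cell (S q) (\<lambda>i. x (Inl (q, i))) \<subseteq> cell (S' q) (\<lambda>i. x (Inr (q, i)))"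
        by (simp add: fam_apply[OF q(1)] prs_empty)
    qed
    with h(1,2) show "\<exists>h\<in>polyfuns I. h x0 \<noteq> 0 \<and> (\<forall>y\<in>aff_space I. \<psi> y \<in> C \<longrightarrow> h y = 0)" by blast
  qed
  moreover have "(\<lambda>p. (p, p)) ` tower P = C \<inter> {(p, q). p \<in> tower P \<and> q \<in> tower P \<and> forget p = forget q}"
    using tower_subset_atlas_points[OF P_tower_index] by (auto simp: C_def)
  ultimately show ?thesis unfolding separated_morphism_def closedin_subtopology by blast
qed

lemma affine_chart: "(J, \<lambda>x. x) \<in> affine_atlas J"
  by (simp add: affine_atlas_def)

text \<open>A point can miss \<open>C\<close> in three ways: by \<open>C'\<close>, by
  \<open>Z\<close>, or because the images in \<open>F\<close> differ. The last is an open condition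
  because \<open>g\<close> is rational near the point.\<close>

lemma fibre_product_zclosed:
  fixes J :: "nat set"
  assumes Z: "closedin (zariski (affine_atlas J)) Z"
    and g: "var_morphism (affine_atlas J) Z \<B> F g"
    and C': "closedin (zariski (prod_atlas \<A> (affine_atlas J))) C'"
    and C: "C = C' \<inter> {(p, z). p \<in> tower P \<and> z \<in> Z \<and> forget p = g z}"
    and S: "admissible P S"
  shows "zclosed (P <+> J) {x. (phi P S (\<lambda>q. x (Inl q)), \<lambda>j. x (Inr j)) \<in> C}"
  unfolding zclosed_def
proof
  fix x0 assume "x0 \<in> aff_space (P <+> J) - {x. (phi P S (\<lambda>q. x (Inl q)), \<lambda>j. x (Inr j)) \<in> C}"
  then have x0: "x0 \<in> aff_space (P <+> J)" "(phi P S (\<lambda>q. x0 (Inl q)), \<lambda>j. x0 (Inr j)) \<notin> C" by auto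
  let ?y = "\<lambda>x q. x (Inl q) :: complex" and ?z = "\<lambda>x j. x (Inr j) :: complex"
  have zJ: "?z x \<in> aff_space J" if "x \<in> aff_space (P <+> J)" for x using that by (auto simp: aff_space_def)
  have Zsub: "Z \<subseteq> aff_space J"
    using closedin_subset[OF Z] by (simp add: topspace_zariski atlas_points_def affine_atlas_def)
  have ypoly: "(\<lambda>x. f (?y x)) \<in> polyfuns (P <+> J)" if "f \<in> polyfuns P" for f
    by (rule polyfuns_compose[OF that]) (auto intro: polyfuns.coord)
  have zpoly: "(\<lambda>x. f (?z x)) \<in> polyfuns (P <+> J)" if "f \<in> polyfuns J" for f
    by (rule polyfuns_compose[OF that]) (auto intro: polyfuns.coord)
  note sets = admissible_sets[OF P_tower_index S]
  have chart: "(fam_index P S, fam P S) \<in> \<A>" using sets by (intro fam_atlasI)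
  consider "(phi P S (?y x0), ?z x0) \<notin> C'" | "?z x0 \<notin> Z" | "?z x0 \<in> Z" "forget (phi P S (?y x0)) \<noteq> g (?z x0)"
    using x0(2) phi_in_tower[OF P_tower_index S] by (auto simp: C)
  then show "\<exists>h\<in>polyfuns (P <+> J). h x0 \<noteq> 0 \<and>
      (\<forall>x\<in>aff_space (P <+> J) \<inter> {x. (phi P S (?y x), ?z x) \<in> C}. h x = 0)"
  proof cases
    case 1
    let ?I = "fam_index P S <+> J"
    let ?\<psi> = "\<lambda>x. (fam P S (\<lambda>i. x (Inl i)), \<lambda>j. x (Inr j))"
    \<comment> \<open>Inserts the tower coordinates into the ambient chart by polynomials, so that
      closed conditions can be pulled back.\<close>
    define u where "u x = case_sum (par P S (?y x)) (?z x)" for x :: "nat \<times> nat + nat \<Rightarrow> complex"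
    have u: "u x \<in> aff_space ?I" if "x \<in> aff_space (P <+> J)" for x
      using zJ[OF that] par_aff_space[of P S "?y x"] unfolding u_def aff_space_def
      by (auto split: sum.split simp del: split_paired_All)
    have \<psi>u: "?\<psi> (u x) = (phi P S (?y x), ?z x)" for x by (simp add: u_def fam_par)
    obtain h where h: "h \<in> polyfuns ?I" "h (u x0) \<noteq> 0" "\<And>v. v \<in> aff_space ?I \<Longrightarrow> ?\<psi> v \<in> C' \<Longrightarrow> h v = 0"
      by (rule closedin_zariskiD[OF C' prod_atlasI[OF chart affine_chart] u[OF x0(1)]])
        (use 1 \<psi>u that in auto)
    have "(\<lambda>x. h (u x)) \<in> polyfuns (P <+> J)"
    proof (rule polyfuns_compose[OF h(1)])
      fix i assume "i \<in> ?I"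
      then show "(\<lambda>x. u x i) \<in> polyfuns (P <+> J)"
        using ypoly[OF par_polyfun[OF P_tower_index]] by (auto simp: u_def intro: polyfuns.coord)
    qed
    moreover have "h (u x) = 0" if "x \<in> aff_space (P <+> J)" "(phi P S (?y x), ?z x) \<in> C" for x
      using that u h(3)[of "u x"] \<psi>u[of x] by (auto simp: C)
    ultimately show ?thesis using h(2) by (intro bexI[of _ "\<lambda>x. h (u x)"]) auto
  next
    case 2
    obtain h where h: "h \<in> polyfuns J" "h (?z x0) \<noteq> 0" "\<And>z. z \<in> aff_space J \<Longrightarrow> z \<in> Z \<Longrightarrow> h z = 0"
      by (rule closedin_zariskiD[OF Z affine_chart zJ[OF x0(1)]]) (use 2 that in auto)
    then show ?thesis
      using zpoly[OF h(1)] zJ by (intro bexI[of _ "\<lambda>x. h (?z x)"]) (auto simp: C)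
  next
    case 3
    have cont: "continuous_map (subtopology (zariski (affine_atlas J)) Z) (subtopology (zariski \<B>) F) g"
      using g by (simp add: var_morphism_def)
    have "g (?z x0) \<in> F"
      using continuous_map_funspace[OF cont] 3(1) Zsub by (auto simp: topspace_zariski atlas_points_def affine_atlas_def)
    then obtain K \<theta> v where K: "(K, \<theta>) \<in> \<B>" "v \<in> aff_space K" "\<theta> v = g (?z x0)"
      using F_subset_atlas_points by (elim atlas_pointsE[OF subsetD]) auto
    obtain T where T: "\<And>l. l \<in> {1..k} \<Longrightarrow> T l \<subseteq> {1..n}" "\<And>l. l \<in> {1..k} \<Longrightarrow> card (T l) = d l"
      and KT: "K = fam_index {1..k} T" "\<theta> = fam {1..k} T"
      by (rule fam_atlasE[OF K(1)]) (rule that)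
    obtain h num where h: "h \<in> polyfuns J" "\<And>i. i \<in> K \<Longrightarrow> num i \<in> polyfuns J" "h (?z x0) \<noteq> 0"
      and gh: "\<And>z. z \<in> Z \<Longrightarrow> h z \<noteq> 0 \<Longrightarrow> g z = \<theta> (ratvec K num h z)"
      by (rule affine_morphism_rational[OF good_B F_subset_atlas_points g Zsub 3(1) K]) (rule that)
    have forget_phi: "forget (phi P S y) = fam {1..k} (\<lambda>l. S (d l, d l)) (\<lambda>(l, p). par P S y ((d l, d l), p))"
      for y by (simp flip: fam_par add: forget_fam)
    have "fam {1..k} (\<lambda>l. S (d l, d l)) (\<lambda>(l, p). par P S (?y x0) ((d l, d l), p)) \<noteq>
        fam {1..k} T (ratvec K num h (?z x0))"
      using 3 gh[OF 3(1) h(3)] by (simp add: forget_phi KT)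
    then obtain l where l: "l \<in> {1..k}"
      "\<not> prs {} ` cell (S (d l, d l)) (\<lambda>p. par P S (?y x0) ((d l, d l), p)) \<subseteq>
        cell (T l) (\<lambda>p. ratvec K num h (?z x0) (l, p))"
      by (rule fam_not_subset[rotated 3]) (use T sets[OF diagonal_in_P] in simp_all)
    have ratT: "cell (T l) (\<lambda>p. ratvec K num h z (l, p)) = cell (T l) (\<lambda>p. num (l, p) z / h z)" for z
      using l(1) by (intro cell_cong) (auto simp: ratvec_def KT fam_index_def)
    obtain H where H: "H \<in> polyfuns (P <+> J)" "H x0 \<noteq> 0"
      "\<And>x. h (?z x) \<noteq> 0 \<Longrightarrow> prs {} ` cell (S (d l, d l)) (\<lambda>p. par P S (?y x) ((d l, d l), p)) \<subseteq>
        cell (T l) (\<lambda>p. num (l, p) (?z x) / h (?z x)) \<Longrightarrow> H x = 0"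
    proof (rule cell_inclusion_polyfun[of "S (d l, d l)" "T l" "\<lambda>x p. par P S (?y x) ((d l, d l), p)"
          "P <+> J" "\<lambda>x. h (?z x)" x0 "\<lambda>x p. num (l, p) (?z x)" "{}"])
      show "(\<lambda>x. num (l, s, t) (?z x)) \<in> polyfuns (P <+> J)" if "s \<in> T l" "t \<in> {1..n} - T l" for s t
        using that l(1) by (intro zpoly h(2)) (auto simp: KT fam_index_def)
      show "(\<lambda>x. par P S (?y x) ((d l, d l), s, t)) \<in> polyfuns (P <+> J)" for s t
        by (rule ypoly[OF par_polyfun[OF P_tower_index]])
      show "\<not> prs {} ` cell (S (d l, d l)) (\<lambda>p. par P S (?y x0) ((d l, d l), p)) \<subseteq>
        cell (T l) (\<lambda>p. num (l, p) (?z x0) / h (?z x0))" using l(2) unfolding ratT .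
    qed (use sets[OF diagonal_in_P[OF l(1)]] T l(1) zpoly[OF h(1)] h(3) in auto)
    \<comment> \<open>The factor \<open>h\<close> disposes of points where the local expression for
      \<open>g\<close> is not valid.\<close>
    have "h (?z x) * H x = 0" if x: "(phi P S (?y x), ?z x) \<in> C" for x
    proof (cases "h (?z x) = 0")
      case False
      have "?z x \<in> Z" "forget (phi P S (?y x)) = g (?z x)" using x by (auto simp: C)
      then have "fam {1..k} (\<lambda>l. S (d l, d l)) (\<lambda>(l, p). par P S (?y x) ((d l, d l), p)) l =
          fam {1..k} T (ratvec K num h (?z x)) l"
        using gh False by (simp add: forget_phi KT)
      then have "H x = 0" using False l(1) by (intro H(3)) (simp_all add: fam_apply ratT prs_empty)
      then show ?thesis by simp
    qed simp
    then show ?thesis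
      using H(1,2) h(3) zpoly[OF h(1)] by (intro bexI[of _ "\<lambda>x. h (?z x) * H x"]) (auto intro: polyfuns.mult)
  qed
qed

text \<open>The tower is descended one projective line at a time.\<close>

lemma tower_image_zclosed:
  fixes J :: "nat set"
  assumes top: "\<And>S. admissible P S \<Longrightarrow> zclosed (P <+> J) {x. (phi P S (\<lambda>q. x (Inl q)), \<lambda>j. x (Inr j)) \<in> C}"
    and C: "\<And>V z. (V, z) \<in> C \<Longrightarrow> V \<in> tower P"
    and "tower_index Q" "Q \<subseteq> P" "admissible Q S"
  shows "zclosed (Q <+> J) {x. \<exists>V. (V, \<lambda>j. x (Inr j)) \<in> C \<and> restrict V Q = phi Q S (\<lambda>q. x (Inl q))}"
  using assms(3-5)
proof (induction "card (P - Q)" arbitrary: Q S rule: less_induct)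
  case less
  note Q = less.prems(1) and S = less.prems(3)
  show ?case
  proof (cases "Q = P")
    case True
    have "restrict V P = V" if "(V, z) \<in> C" for V z
      using tower_undefined[OF C[OF that]] by (intro ext) (simp add: restrict_def)
    then have "{x. \<exists>V. (V, \<lambda>j. x (Inr j)) \<in> C \<and> restrict V Q = phi Q S (\<lambda>q. x (Inl q))} =
        {x. (phi P S (\<lambda>q. x (Inl q)), \<lambda>j. x (Inr j)) \<in> C}"
      unfolding True by (metis (no_types, lifting))
    then show ?thesis using top S True by simp
  next
    case False
    then obtain q where q: "q \<in> P - Q" "tower_index (insert q Q)"
      using tower_index_insert[OF Q P_tower_index] less.prems(2) by blast
    obtain i j where ij: "q = (i, j)" by fastforce
    have new: "(i, j) \<notin> Q" and Q1: "tower_index (insert (i, j) Q)" using q ij by auto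
    have sub: "insert (i, j) Q \<subseteq> P" using q less.prems(2) by (auto simp: ij)
    obtain a b where ab: "insert (j + 1) (ext_set S i (j + 1)) = insert b (insert a (ext_set S (i - 1) j))"
      "a \<notin> ext_set S (i - 1) j" "b \<notin> insert a (ext_set S (i - 1) j)"
      by (rule step_choice[OF Q Q1 new S]) (rule that)
    then have ba: "insert (j + 1) (ext_set S i (j + 1)) = insert a (insert b (ext_set S (i - 1) j))"
      "b \<notin> ext_set S (i - 1) j" "a \<notin> insert b (ext_set S (i - 1) j)" by auto
    define S' where "S' c = S((i, j) := insert c (ext_set S (i - 1) j))" for c
    \<comment> \<open>The traces of the larger stage, closed by induction, in the two charts of the
      line; \<open>c\<close> is the index added to the chart set.\<close>
    define E where "E c = {x. \<exists>V. (V, \<lambda>j. x (Inr j)) \<in> C \<and>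
      restrict V (insert (i, j) Q) = phi (insert (i, j) Q) (S' c) (\<lambda>q. x (Inl q))}" for c
    have "card (P - insert (i, j) Q) < card (P - Q)"
      using q finite_P by (intro psubset_card_mono) (auto simp: ij)
    then have Eclosed: "zclosed (insert (i, j) Q <+> J) (E c)" if "c = a \<or> c = b" for c
      unfolding E_def S'_def
      using that admissible_step[OF Q Q1 new S ab] admissible_step[OF Q Q1 new S ba] Q1 sub less.hyps by blast
    have Plus: "insert (i, j) Q <+> J = insert (Inl (i, j)) (Q <+> J)" by auto
    have upd: "(\<lambda>q. (x(Inl (i, j) := l)) (Inl q)) = (\<lambda>q. x (Inl q))((i, j) := l)"
      "(\<lambda>j'. (x(Inl (i, j) := l)) (Inr j')) = (\<lambda>j'. x (Inr j'))" for x :: "nat \<times> nat + nat \<Rightarrow> complex" and l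
      by auto
    have "zclosed (Q <+> J) {x. (\<exists>l. x(Inl (i, j) := l) \<in> E a) \<or> x(Inl (i, j) := 0) \<in> E b}"
    proof (rule zclosed_proj_line)
      show "Inl (i, j) \<notin> Q <+> J" using new by auto
      show "zclosed (insert (Inl (i, j)) (Q <+> J)) (E a)" "zclosed (insert (Inl (i, j)) (Q <+> J)) (E b)"
        using Eclosed unfolding Plus by blast+
      show "x(Inl (i, j) := l) \<in> E a \<longleftrightarrow> x(Inl (i, j) := inverse l) \<in> E b" if "l \<noteq> 0" for x l
        unfolding E_def mem_Collect_eq upd S'_def using phi_glue[OF Q Q1 new S ab that] by simp
    qed
    \<comment> \<open>Every extension of a point of the smaller stage lies in chart \<open>a\<close>
      or is the origin of chart \<open>b\<close>, so projecting along the line loses no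
      point.\<close>
    moreover have "{x. (\<exists>l. x(Inl (i, j) := l) \<in> E a) \<or> x(Inl (i, j) := 0) \<in> E b} =
        {x. \<exists>V. (V, \<lambda>j. x (Inr j)) \<in> C \<and> restrict V Q = phi Q S (\<lambda>q. x (Inl q))}" (is "?L = ?R")
    proof (intro subset_antisym subsetI)
      fix x assume "x \<in> ?L"
      then obtain c l V where c: "c = a \<or> c = b" and V: "(V, \<lambda>j. x (Inr j)) \<in> C"
        "restrict V (insert (i, j) Q) = phi (insert (i, j) Q) (S' c) ((\<lambda>q. x (Inl q))((i, j) := l))"
        unfolding E_def mem_Collect_eq upd by blast
      have "restrict V Q = restrict (restrict V (insert (i, j) Q)) Q" by (auto simp: restrict_def fun_eq_iff)
      also have "\<dots> = phi Q S (\<lambda>q. x (Inl q))"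
        unfolding V(2) S'_def using c restrict_phi_step[OF Q Q1 new S ab] restrict_phi_step[OF Q Q1 new S ba] by blast
      finally show "x \<in> ?R" using V(1) by blast
    next
      fix x assume "x \<in> ?R"
      then obtain V where V: "(V, \<lambda>j. x (Inr j)) \<in> C" "restrict V Q = phi Q S (\<lambda>q. x (Inl q))" by blast
      have V1: "restrict V (insert (i, j) Q) \<in> tower (insert (i, j) Q)"
        by (rule tower_restrict[OF Q1 C[OF V(1)] sub])
      have "restrict (restrict V (insert (i, j) Q)) Q = phi Q S (\<lambda>q. x (Inl q))"
        unfolding V(2)[symmetric] by (auto simp: restrict_def fun_eq_iff)
      from phi_extensions[OF Q Q1 new S ab V1 this] show "x \<in> ?L"
        unfolding E_def mem_Collect_eq upd S'_def using V(1) by blast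
    qed
    ultimately show ?thesis by simp
  qed
qed

text \<open>For the empty index set the tower is a point, and what remains of \<open>C\<close> is
  its image in the affine variety.\<close>

lemma forget_universally_closed: "universally_closed_morphism \<A> (tower P) \<B> F forget"
  unfolding universally_closed_morphism_def closed_map_def
proof (intro allI impI, elim conjE)
  fix J :: "nat set" and Z g C
  assume Z: "closedin (zariski (affine_atlas J)) Z" and g: "var_morphism (affine_atlas J) Z \<B> F g"
  assume "closedin (subtopology (zariski (prod_atlas \<A> (affine_atlas J)))
      {(p, z). p \<in> tower P \<and> z \<in> Z \<and> forget p = g z}) C"
  then obtain C' where C': "closedin (zariski (prod_atlas \<A> (affine_atlas J))) C'"
    and C: "C = C' \<inter> {(p, z). p \<in> tower P \<and> z \<in> Z \<and> forget p = g z}"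
    by (auto simp: closedin_subtopology)
  have Zsub: "Z \<subseteq> aff_space J"
    using closedin_subset[OF Z] by (simp add: topspace_zariski atlas_points_def affine_atlas_def)
  have "zclosed ({} <+> J) {x. \<exists>V. (V, \<lambda>j. x (Inr j)) \<in> C \<and>
      restrict V {} = phi {} (\<lambda>_. {}) (\<lambda>q. x (Inl q))}"
  proof (rule tower_image_zclosed)
    show "zclosed (P <+> J) {x. (phi P S (\<lambda>q. x (Inl q)), \<lambda>j. x (Inr j)) \<in> C}" if "admissible P S" for S
      by (rule fibre_product_zclosed[OF Z g C' C that])
  qed (auto simp: C tower_index_def admissible_def)
  moreover have "restrict V {} = phi {} (\<lambda>_. {}) y" for V y
    by (simp add: phi_def restrict_def)
  ultimately have E: "zclosed ({} <+> J) {x :: nat \<times> nat + nat \<Rightarrow> complex. \<exists>V. (V, \<lambda>j. x (Inr j)) \<in> C}" by simp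
  have "closedin (zariski (affine_atlas J)) (snd ` C)"
  proof (rule closedin_zariskiI)
    show "snd ` C \<subseteq> atlas_points (affine_atlas J)"
      using Zsub by (auto simp: C atlas_points_def affine_atlas_def)
    fix I \<psi> z0 assume "(I, \<psi>) \<in> affine_atlas J" and z0: "z0 \<in> aff_space I" "\<psi> z0 \<notin> snd ` C"
    then have I: "I = J" "\<psi> = (\<lambda>x. x)" by (auto simp: affine_atlas_def)
    \<comment> \<open>\<open>{} <+> J\<close> and \<open>J\<close> differ only in the type of their
      indices.\<close>
    define u where "u z = case_sum (\<lambda>_ :: nat \<times> nat. 0) z" for z :: "nat \<Rightarrow> complex"
    have u: "u z \<in> aff_space ({} <+> J)" if "z \<in> aff_space J" for z
      using that by (auto simp: u_def aff_space_def split: sum.split)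
    have uR: "(\<lambda>j. u z (Inr j)) = z" for z by (simp add: u_def)
    have "u z0 \<in> aff_space ({} <+> J) - {x. \<exists>V. (V, \<lambda>j. x (Inr j)) \<in> C}"
      using u z0 by (force simp: uR I)
    then obtain h where h: "h \<in> polyfuns ({} <+> J)" "h (u z0) \<noteq> 0"
      "\<forall>x\<in>aff_space ({} <+> J) \<inter> {x. \<exists>V. (V, \<lambda>j. x (Inr j)) \<in> C}. h x = 0"
      using E unfolding zclosed_def by blast
    have "(\<lambda>z. h (u z)) \<in> polyfuns J"
      by (rule polyfuns_compose[OF h(1)]) (auto simp: u_def intro: polyfuns.coord)
    moreover have "h (u z) = 0" if "z \<in> aff_space J" "z \<in> snd ` C" for z
    proof -
      have "u z \<in> {x. \<exists>V. (V, \<lambda>j. x (Inr j)) \<in> C}" using that(2) by (auto simp: uR)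
      then show ?thesis using h(3) u[OF that(1)] by blast
    qed
    ultimately show "\<exists>h\<in>polyfuns I. h z0 \<noteq> 0 \<and> (\<forall>y\<in>aff_space I. \<psi> y \<in> snd ` C \<longrightarrow> h y = 0)"
      using h(2) unfolding I by (intro bexI[of _ "\<lambda>z. h (u z)"]) auto
  qed
  moreover have "snd ` C = snd ` C \<inter> Z" by (auto simp: C)
  ultimately show "closedin (subtopology (zariski (affine_atlas J)) Z) (snd ` C)"
    unfolding closedin_subtopology by blast
qed

lemma forget_proper: "proper_morphism \<A> (tower P) \<B> F forget"
  unfolding proper_morphism_def
  by (intro conjI forget_separated forget_universally_closed forget_morphism)
    (auto simp: deg_flag_eq_image)

end

section \<open>Birationality\<close>

context flag_type
begin

text \<open>Only the diagonal spaces are constrained; that all others then lie in the initial charts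
  is \<open>big_cell_lift\<close>.\<close>

definition big_R :: "(nat \<times> nat \<Rightarrow> 'w set) set" where
  "big_R = {V \<in> tower P. \<forall>l\<in>{1..k}. V (d l, d l) \<in> range (cell {1..d l})}"

definition big_F :: "(nat \<Rightarrow> 'w set) set" where
  "big_F = {G \<in> F. \<forall>l\<in>{1..k}. G l \<in> range (cell {1..d l})}"

text \<open>Several levels may qualify; on the big cell they all determine the same space at the
  given pair.\<close>

definition level :: "nat \<times> nat \<Rightarrow> nat" where
  "level q = (SOME l. l \<in> {1..k} \<and> fst q \<le> d l \<and> d l \<le> snd q)"

lemma level:
  assumes "(i, j) \<in> P"
  shows "level (i, j) \<in> {1..k}" "i \<le> d (level (i, j))" "d (level (i, j)) \<le> j"
proof -
  have "\<exists>l. l \<in> {1..k} \<and> fst (i, j) \<le> d l \<and> d l \<le> snd (i, j)"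
    using assms by (auto simp: flag_index_set_def)
  from someI_ex[OF this]
  show "level (i, j) \<in> {1..k}" "i \<le> d (level (i, j))" "d (level (i, j)) \<le> j"
    by (auto simp: level_def)
qed

definition initial :: "nat \<times> nat \<Rightarrow> nat set" where
  "initial q = {1..fst q}"

text \<open>The formula for the inverse on the big cell: at a pair (i, j), the columns beyond
  \<open>j\<close> are copied from the matrix at the chosen level, and the columns up to
  \<open>j\<close> vanish.\<close>

definition lift :: "(nat \<times> nat \<times> nat \<Rightarrow> complex) \<Rightarrow> (nat \<times> nat) \<times> nat \<times> nat \<Rightarrow> complex" where
  "lift x = (\<lambda>(q, s, t). if (q, s, t) \<in> fam_index P initial \<and> snd q < t then x (level q, s, t) else 0)"

lemma lift_aff_space: "lift x \<in> aff_space (fam_index P initial)"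
  by (auto simp: lift_def aff_space_def)

lemma initial_subset: "q \<in> P \<Longrightarrow> initial q \<subseteq> {1..n}" "card (initial q) = fst q"
  using tower_indexD[OF P_tower_index, of "fst q" "snd q"] by (auto simp: initial_def)

lemma initial_chart: "(fam_index P initial, fam P initial) \<in> \<A>"
  using initial_subset by (intro fam_atlasI)

lemma diagonal_chart: "(fam_index {1..k} (\<lambda>l. {1..d l}), fam {1..k} (\<lambda>l. {1..d l})) \<in> \<B>"
  using d_bounds by (intro fam_atlasI) (auto intro: less_imp_le less_le_trans)

text \<open>\<open>u\<close> has the first \<open>m\<close> coordinates of \<open>v\<close>; those
  from \<open>m + 1\<close> to \<open>j\<close>, dictated by the full matrix, are erased by the
  projection.\<close>

lemma prs_cell_initial:
  assumes m: "m \<le> j" "j \<le> n" and v: "v \<in> cell {1..m} (\<lambda>(s, t). if j < t then x (s, t) else 0)"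
  obtains u where "u \<in> cell {1..m} x" "prs {m + 1..j} u = v"
proof -
  have sub: "{1..m} \<subseteq> {1..n}" using m by auto
  obtain u where u: "u \<in> cell {1..m} x" "\<And>s. s \<in> {1..m} \<Longrightarrow> co s u = co s v"
    by (rule cell_vector[OF sub, of x "\<lambda>s. co s v"]) (rule that)
  have "prs {m + 1..j} u = v"
  proof (rule co_ext)
    fix t assume t: "t \<in> {1..n}"
    show "co t (prs {m + 1..j} u) = co t v"
    proof (cases "t \<le> m")
      case True
      then show ?thesis using t u(2) by (simp add: co_prs)
    next
      case False
      then have "co t v = (\<Sum>s\<in>{1..m}. co s v * (if j < t then x (s, t) else 0))"
        using cellD[OF v t] by simp
      moreover have "co t u = (\<Sum>s\<in>{1..m}. co s u * x (s, t))" using cellD[OF u(1) t] False by simp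
      ultimately show ?thesis using False t u(2) by (auto simp: co_prs intro!: sum.cong)
    qed
  qed
  with u(1) show ?thesis by (rule that)
qed

text \<open>
  Over the big cell \<open>V\<^bsub>i,j\<^esub>\<close> is forced to be \<open>pr\<^bsub>m+1\<^esub> \<dots> pr\<^bsub>j\<^esub> V\<^sub>m \<inter> W\<^bsub>i,j\<^esub>\<close>, for any \<open>m = d l\<close> between \<open>i\<close> and \<open>j\<close>.
\<close>

lemma big_cell_lift:
  assumes V: "V \<in> tower P" and x: "forget V = fam {1..k} (\<lambda>l. {1..d l}) x"
  shows "V = fam P initial (lift x)"
proof -
  note Q = P_tower_index
  obtain S y where S: "admissible P S" and Vphi: "V = phi P S y" by (rule tower_chart[OF Q V])
  have main: "V (i, j) = cell {1..i} (\<lambda>p. lift x ((i, j), p))" if ij: "(i, j) \<in> P" for i j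
  proof -
    note D = tower_indexD[OF Q ij]
    define l m where "l = level (i, j)" and "m = d l"
    have l: "l \<in> {1..k}" "i \<le> m" "m \<le> j" using level[OF ij] by (auto simp: l_def m_def)
    have Vm: "V (m, m) = cell {1..m} (\<lambda>p. x (l, p))"
      using fun_cong[OF x, of l] l(1) by (simp add: forget_off_diagonal_def fam_apply m_def)
    have chain: "(m, j) \<in> P" "prs {m + 1..j} ` V (m, m) \<subseteq> V (m, j)"
      using tower_pr_chain[OF Q V diagonal_in_P[OF l(1)], of j] l D by (auto simp: m_def)
    let ?x = "\<lambda>(s, t). if j < t then x (l, s, t) else 0"
    \<comment> \<open>Both sides have dimension \<open>m\<close>, so this inclusion determines the
      space at (m, j).\<close>
    have "cell {1..m} ?x \<subseteq> V (m, j)"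
    proof
      fix v assume v: "v \<in> cell {1..m} ?x"
      have "j \<le> n" using D by simp
      obtain u where "u \<in> cell {1..m} (\<lambda>p. x (l, p))" "prs {m + 1..j} u = v"
        by (rule prs_cell_initial[OF l(3) \<open>j \<le> n\<close>, of v "\<lambda>p. x (l, p)"]) (use v that in auto)
      then show "v \<in> V (m, j)" using chain(2) Vm by blast
    qed
    moreover have "cell {1..m} ?x \<in> Gr m" using l D by (intro cell_in_Gr) auto
    ultimately have Vmj: "V (m, j) = cell {1..m} ?x"
      using Gr_eqI towerD(1)[OF V chain(1)] by blast
    have "V (i, j) \<subseteq> cell {1..i} (\<lambda>p. lift x ((i, j), p))"
    proof
      fix v assume v: "v \<in> V (i, j)"
      have vm: "v \<in> cell {1..m} ?x"
        using tower_inc_chain[OF Q V l(2) D(1) chain(1)] v unfolding Vmj by blast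
      have "V (i, j) \<subseteq> Wco i j"
        using crd_chain[OF Q S, of i j y] ij unfolding Vphi by (auto simp: phi_def ext_set_Q[OF Q])
      then have vW: "co t v = 0" if "i < t" "t \<le> j" for t using v that by (auto simp: Wco_def)
      show "v \<in> cell {1..i} (\<lambda>p. lift x ((i, j), p))"
        unfolding cell_def
      proof (intro CollectI ballI)
        fix t assume t: "t \<in> {1..n} - {1..i}"
        show "co t v = (\<Sum>s\<in>{1..i}. co s v * lift x ((i, j), s, t))"
        proof (cases "t \<le> j")
          case True
          moreover have "i < t" using t by auto
          ultimately show ?thesis using vW[of t] by (simp add: lift_def)
        next
          case False
          then have "co t v = (\<Sum>s\<in>{1..m}. co s v * x (l, s, t))"
            using cellD[OF vm, of t] t l(3) by simp
          \<comment> \<open>The coordinates from \<open>i + 1\<close> to \<open>m\<close> vanish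
            because \<open>m \<le> j\<close>.\<close>
          also have "\<dots> = (\<Sum>s\<in>{1..i}. co s v * x (l, s, t))"
            using l vW by (intro sum.mono_neutral_right) auto
          also have "\<dots> = (\<Sum>s\<in>{1..i}. co s v * lift x ((i, j), s, t))"
            using False t ij by (intro sum.cong) (auto simp: lift_def fam_index_def initial_def l_def)
          finally show ?thesis .
        qed
      qed
    qed
    then show ?thesis
      using Gr_eqI towerD(1)[OF V ij] cell_in_Gr[of "{1..i}" i] D by auto
  qed
  have "V \<in> extensional P" using V by (auto simp: tower_def PiE_def)
  moreover have "V q = fam P initial (lift x) q" if "q \<in> P" for q
    using main[of "fst q" "snd q"] that by (simp add: fam_apply initial_def)
  ultimately show ?thesis by (intro extensionalityI[OF _ fam_extensional])
qed

lemma big_F_chart: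
  assumes "G \<in> big_F"
  obtains x where "x \<in> aff_space (fam_index {1..k} (\<lambda>l. {1..d l}))" "G = fam {1..k} (\<lambda>l. {1..d l}) x"
proof -
  have G: "G \<in> F" "\<forall>l\<in>{1..k}. \<exists>x. G l = cell {1..d l} x" using assms by (auto simp: big_F_def)
  from bchoice[OF G(2)] obtain x where x: "\<And>l. l \<in> {1..k} \<Longrightarrow> G l = cell {1..d l} (x l)" by blast
  have "G \<in> extensional {1..k}" using G(1) by (auto simp: deg_flag_variety_iff PiE_def)
  then have "G = fam {1..k} (\<lambda>l. {1..d l}) (\<lambda>(l, p). x l p)"
    by (rule extensionalityI[OF _ fam_extensional]) (simp add: fam_apply x)
  then show ?thesis
    using that fam_aff_space[of "{1..k}" "\<lambda>l. {1..d l}" "\<lambda>(l, p). x l p"] by metis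
qed

lemma big_F_open: "openin (subtopology (zariski \<B>) F) big_F"
proof -
  let ?\<psi> = "fam {1..k} (\<lambda>l. {1..d l})" and ?I = "fam_index {1..k} (\<lambda>l. {1..d l})"
  \<comment> \<open>A whole chart as the principal open set of the constant 1.\<close>
  have "zariski_open \<B> (?\<psi> ` {x \<in> aff_space ?I. (1::complex) \<noteq> 0})"
    by (rule open_principal[OF good_B diagonal_chart]) (rule polyfuns.const)
  moreover have "big_F = ?\<psi> ` {x \<in> aff_space ?I. (1::complex) \<noteq> 0} \<inter> F"
  proof (intro subset_antisym subsetI)
    fix G assume G: "G \<in> big_F"
    obtain x where "x \<in> aff_space ?I" "G = ?\<psi> x" by (rule big_F_chart[OF G])
    moreover have "G \<in> F" using G by (simp add: big_F_def)
    ultimately show "G \<in> ?\<psi> ` {x \<in> aff_space ?I. (1::complex) \<noteq> 0} \<inter> F" by simp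
  next
    fix G assume "G \<in> ?\<psi> ` {x \<in> aff_space ?I. (1::complex) \<noteq> 0} \<inter> F"
    then show "G \<in> big_F" by (auto simp: big_F_def fam_apply)
  qed
  ultimately show ?thesis unfolding openin_subtopology openin_zariski by blast
qed

lemma big_R_iff: "V \<in> big_R \<longleftrightarrow> V \<in> tower P \<and> forget V \<in> big_F"
proof -
  have "forget V l = V (d l, d l)" if "l \<in> {1..k}" for l
    using that by (simp add: forget_off_diagonal_def)
  then show ?thesis by (auto simp: big_R_def big_F_def forget_in_deg_flag)
qed

lemma topspace_R: "topspace (subtopology (zariski \<A>) (tower P)) = tower P"
  using tower_subset_atlas_points[OF P_tower_index] by (auto simp: topspace_zariski)

lemma topspace_F: "topspace (subtopology (zariski \<B>) F) = F"
  using F_subset_atlas_points by (auto simp: topspace_zariski)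

lemma forget_continuous:
  "continuous_map (subtopology (zariski \<A>) (tower P)) (subtopology (zariski \<B>) F) forget"
  using forget_morphism[of "tower P" F] by (auto simp: var_morphism_def deg_flag_eq_image)

lemma big_R_open: "openin (subtopology (zariski \<A>) (tower P)) big_R"
proof -
  have "big_R = {V \<in> tower P. forget V \<in> big_F}" using big_R_iff by blast
  then show ?thesis
    using openin_continuous_map_preimage[OF forget_continuous big_F_open] by (simp only: topspace_R)
qed

text \<open>
  A point outside the big cell is moved into it along the affine line through it in one of the
  coordinates of the tower, for one \<open>V\<^bsub>i,j\<^esub>\<close> after the other.
\<close>

lemma big_cell_dense:
  assumes O: "zariski_open \<A> X"
    and "tower_index Q" "Q \<subseteq> P" "V \<in> tower P \<inter> X" "\<And>q. q \<in> Q \<Longrightarrow> V q \<in> range (cell (initial q))"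
  shows "\<exists>V'\<in>tower P \<inter> X. \<forall>q\<in>P. V' q \<in> range (cell (initial q))"
  using assms(2-5)
proof (induction "card (P - Q)" arbitrary: Q V rule: less_induct)
  case less
  note Q = less.prems(1) and QP = less.prems(2) and big = less.prems(4)
  show ?case
  proof (cases "Q = P")
    case True
    then show ?thesis using less.prems by blast
  next
    case False
    then obtain q where q: "q \<in> P - Q" "tower_index (insert q Q)"
      using tower_index_insert[OF Q P_tower_index] QP by blast
    obtain i j where ij: "q = (i, j)" by fastforce
    have new: "(i, j) \<notin> Q" and Q1: "tower_index (insert (i, j) Q)" and ijP: "(i, j) \<in> P" using q ij by auto
    have sub: "insert (i, j) Q \<subseteq> P" using q QP by (auto simp: ij)
    note D = tower_indexD[OF Q1 insertI1]
    have less: "card (P - insert (i, j) Q) < card (P - Q)"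
      using q finite_P by (intro psubset_card_mono) (auto simp: ij)
    have init: "ext_set initial p r = {1..p}" for p r by (simp add: ext_set_def initial_def)
    have "admissible Q initial"
      unfolding admissible_def init by (auto simp: initial_def)
    from chart_extension[OF Q P_tower_index QP _ this big] less.prems(3)
    obtain S y where S: "admissible P S" "\<forall>q\<in>Q. S q = initial q" and V: "V = phi P S y" by blast
    have SQ: "admissible Q S" using S(1) QP by (auto simp: admissible_def)
    have "\<exists>V'\<in>tower P \<inter> X. \<forall>q\<in>insert (i, j) Q. V' q \<in> range (cell (initial q))"
    proof (cases "S (i, j) = initial (i, j)")
      case True
      have "V (i, j) \<in> range (cell (initial (i, j)))"
        using ijP True by (simp add: V phi_def)
      then show ?thesis using less.prems(3) big by blast
    next
      case False
      define a b where "a = new_elt S i j" and "b = left_out S i j"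
      have S1: "ext_set S (i - 1) j = {1..i - 1}" "ext_set S i (j + 1) = {1..i}"
        using ext_set_cong[OF Q, of S initial "i - 1" j] ext_set_cong[OF Q, of S initial i "j + 1"] S(2) D new
        by (auto simp: init)
      note sets = step_sets[OF P_tower_index S(1) ijP, folded a_def b_def]
      have ab: "insert (j + 1) (ext_set S i (j + 1)) = insert b (insert a (ext_set S (i - 1) j))"
        "a \<notin> ext_set S (i - 1) j" "b \<notin> insert a (ext_set S (i - 1) j)"
        using sets by auto
      have ins: "{1..i} = insert i {1..i - 1}" using D(1) by auto
      have "a \<noteq> i" using False sets(1) unfolding S1 ins[symmetric] by (auto simp: initial_def ins)
      moreover have "i \<in> insert b (insert a {1..i - 1})" using ab(1) unfolding S1 ins by auto
      \<comment> \<open>If the chart in use is not the initial one, the left-out index must be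
        \<open>i\<close>, so chart \<open>b\<close> is the initial one.\<close>
      ultimately have b: "b = i" using D(1) by auto
      have inb: "insert b (ext_set S (i - 1) j) = initial (i, j)" by (simp add: S1 b initial_def ins[symmetric])
      \<comment> \<open>Moves the point along the line through it in the coordinate (i, j); the
        spaces indexed by \<open>Q\<close> stay fixed.\<close>
      define y' where "y' e = y((i, j) := y (i, j) + e)" for e
      define V' where "V' e = phi P S (y' e)" for e
      have V'0: "V' 0 = V" by (simp add: V'_def y'_def V)
      have S_upd: "S((i, j) := insert a (ext_set S (i - 1) j)) = S" using sets(1) by (intro fun_upd_idem)
      have restr: "restrict (V' e) (insert (i, j) Q) = phi (insert (i, j) Q) S (y' e)" for e
        using sub by (auto simp: V'_def phi_def restrict_def fun_eq_iff)
      have step: "V' e q = phi Q S y q" if "q \<in> Q" for e q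
      proof -
        have "V' e q = phi (insert (i, j) Q) S (y' e) q" using fun_cong[OF restr, of e q] that by simp
        also have "\<dots> = restrict (phi (insert (i, j) Q) S (y' e)) Q q" using that by simp
        also have "\<dots> = phi Q S y q"
          using restrict_phi_step[OF Q Q1 new SQ ab, of y "y (i, j) + e"] unfolding S_upd y'_def by simp
        finally show ?thesis .
      qed
      have bigQ: "V' e q \<in> range (cell (initial q))" if "q \<in> Q" for e q
        unfolding step[OF that] using that S(2) by (simp add: phi_def)
      have bigij: "V' e (i, j) \<in> range (cell (initial (i, j)))" if "y (i, j) + e \<noteq> 0" for e
      proof -
        have "V' e (i, j) = phi (insert (i, j) Q) S (y' e) (i, j)" using fun_cong[OF restr, of e "(i, j)"] by simp
        also have "\<dots> = phi (insert (i, j) Q) (S((i, j) := insert b (ext_set S (i - 1) j)))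
            (y((i, j) := inverse (y (i, j) + e))) (i, j)"
          using phi_glue[OF Q Q1 new SQ ab that, of y] unfolding S_upd y'_def by simp
        also have "\<dots> \<in> range (cell (initial (i, j)))" by (simp add: phi_def inb)
        finally show ?thesis .
      qed
      have chart: "(fam_index P S, fam P S) \<in> \<A>"
        using admissible_sets[OF P_tower_index S(1)] by (intro fam_atlasI)
      have "fam P S (par P S y) \<in> X" using less.prems(3) V by (simp add: fam_par)
      then obtain h where h: "h \<in> polyfuns (fam_index P S)" "h (par P S y) \<noteq> 0"
        "\<And>x. x \<in> aff_space (fam_index P S) \<Longrightarrow> h x \<noteq> 0 \<Longrightarrow> fam P S x \<in> X"
        using zariski_open_localD[OF O chart par_aff_space] by blast
      have "(\<lambda>y. h (par P S y)) \<in> polyfuns P"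
        by (rule polyfuns_compose[OF h(1) par_polyfun[OF P_tower_index]])
      from polyfuns_curve[OF this, of "\<lambda>p. if p = (i, j) then [:y (i, j), 1:] else [:y p:]"]
      obtain f where f: "\<And>e. h (par P S (\<lambda>p. poly (if p = (i, j) then [:y (i, j), 1:] else [:y p:]) e)) = poly f e"
        by blast
      have "(\<lambda>p. poly (if p = (i, j) then [:y (i, j), 1:] else [:y p:]) e) = y' e" for e
        by (auto simp: y'_def fun_eq_iff)
      then have f: "h (par P S (y' e)) = poly f e" for e using f by simp
      have "f \<noteq> 0" using h(2) f[of 0] by (auto simp: y'_def)
      \<comment> \<open>Two conditions on \<open>e\<close>: the point must stay in \<open>X\<close>,
        and it must avoid the point at infinity of the initial chart, where
        \<open>y (i, j) + e = 0\<close>.\<close>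
      then have "f * [:y (i, j), 1:] \<noteq> 0" by (metis mult_eq_0_iff pCons_eq_0_iff zero_neq_one)
      then have "finite {e. poly (f * [:y (i, j), 1:]) e = 0}" by (rule poly_roots_finite)
      then obtain e where e: "e \<notin> {e. poly (f * [:y (i, j), 1:]) e = 0}"
        using ex_new_if_finite[OF infinite_UNIV_char_0] by blast
      then have "poly f e * poly [:y (i, j), 1:] e \<noteq> 0" unfolding mem_Collect_eq poly_mult .
      then have "poly f e \<noteq> 0" and "poly [:y (i, j), 1:] e \<noteq> 0" unfolding mult_eq_0_iff by blast+
      then have "h (par P S (y' e)) \<noteq> 0" and "y (i, j) + e \<noteq> 0" unfolding f by simp_all
      then have "V' e \<in> X" "V' e (i, j) \<in> range (cell (initial (i, j)))"
        using h(3)[OF par_aff_space] bigij by (auto simp: V'_def fam_par)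
      moreover have "V' e \<in> tower P" unfolding V'_def by (rule phi_in_tower[OF P_tower_index S(1)])
      ultimately show ?thesis using bigQ by blast
    qed
    then obtain V' where "V' \<in> tower P \<inter> X" "\<And>q. q \<in> insert (i, j) Q \<Longrightarrow> V' q \<in> range (cell (initial q))"
      by blast
    from less.hyps[OF less Q1 sub this] show ?thesis .
  qed
qed

lemma big_R_dense: "subtopology (zariski \<A>) (tower P) closure_of big_R = tower P"
proof -
  have "big_R \<inter> T \<noteq> {}" if T: "openin (subtopology (zariski \<A>) (tower P)) T" "T \<noteq> {}" for T
  proof -
    obtain X where X: "zariski_open \<A> X" "T = X \<inter> tower P"
      using T(1) by (auto simp: openin_subtopology openin_zariski)
    obtain V where "V \<in> tower P \<inter> X" using T(2) X(2) by blast
    moreover have "tower_index {}" by (simp add: tower_index_def)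
    ultimately obtain V' where V': "V' \<in> tower P \<inter> X" "\<forall>q\<in>P. V' q \<in> range (cell (initial q))"
      using big_cell_dense[OF X(1)] by blast
    have "V' (d l, d l) \<in> range (cell {1..d l})" if "l \<in> {1..k}" for l
      using V'(2) diagonal_in_P[OF that] by (force simp: initial_def)
    then have "V' \<in> big_R" using V'(1) by (simp add: big_R_def)
    then show ?thesis using V'(1) X(2) by blast
  qed
  then show ?thesis
    using dense_intersects_open[of "subtopology (zariski \<A>) (tower P)" big_R] unfolding topspace_R by blast
qed

text \<open>By surjectivity, nonempty open subsets of \<open>F\<close> have nonempty open preimages,
  and these meet \<open>big_R\<close>.\<close>

lemma big_F_dense: "subtopology (zariski \<B>) F closure_of big_F = F"
proof -
  have "big_F \<inter> T \<noteq> {}" if T: "openin (subtopology (zariski \<B>) F) T" "T \<noteq> {}" for T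
  proof -
    have "openin (subtopology (zariski \<A>) (tower P)) {V \<in> tower P. forget V \<in> T}"
      using openin_continuous_map_preimage[OF forget_continuous T(1)] by (simp only: topspace_R)
    moreover have "{V \<in> tower P. forget V \<in> T} \<noteq> {}"
    proof -
      obtain G where G: "G \<in> T" using T(2) by blast
      then have "G \<in> F" using openin_subset[OF T(1)] by (auto simp: topspace_F)
      then obtain V where "V \<in> tower P" "forget V = G" by (rule forget_surj)
      with G show ?thesis by blast
    qed
    ultimately have "big_R \<inter> {V \<in> tower P. forget V \<in> T} \<noteq> {}"
      using big_R_dense dense_intersects_open[of "subtopology (zariski \<A>) (tower P)" big_R]
      unfolding topspace_R by blast
    then show ?thesis using big_R_iff by blast
  qed
  then show ?thesis
    using dense_intersects_open[of "subtopology (zariski \<B>) F" big_F] unfolding topspace_F by blast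
qed

text \<open>Some point of the fibre; over \<open>big_F\<close> it is the only one.\<close>

definition section_map :: "(nat \<Rightarrow> 'w set) \<Rightarrow> nat \<times> nat \<Rightarrow> 'w set" where
  "section_map G = (SOME V. V \<in> tower P \<and> forget V = G)"

lemma section_map:
  assumes "G \<in> F"
  shows "section_map G \<in> tower P" "forget (section_map G) = G"
proof -
  have "\<exists>V. V \<in> tower P \<and> forget V = G" using forget_surj[OF assms] by blast
  from someI_ex[OF this] show "section_map G \<in> tower P" "forget (section_map G) = G"
    by (auto simp: section_map_def)
qed

lemma section_map_chart:
  "fam {1..k} (\<lambda>l. {1..d l}) x \<in> F \<Longrightarrow> section_map (fam {1..k} (\<lambda>l. {1..d l}) x) = fam P initial (lift x)"
  by (intro big_cell_lift section_map)

lemma lift_polyfun: "(\<lambda>x. lift x i) \<in> polyfuns (fam_index {1..k} (\<lambda>l. {1..d l}))"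
proof -
  obtain q s t where i: "i = (q, s, t)" by (metis prod.exhaust)
  show ?thesis
  proof (cases "(q, s, t) \<in> fam_index P initial \<and> snd q < t")
    case True
    then have "(level q, s, t) \<in> fam_index {1..k} (\<lambda>l. {1..d l})"
      using level[of "fst q" "snd q"] by (auto simp: fam_index_def initial_def)
    then show ?thesis using True by (auto simp: i lift_def intro: polyfuns.coord)
  next
    case False
    then show ?thesis by (auto simp: i lift_def polyfuns.const)
  qed
qed

text \<open>On the big cell the section is \<open>lift\<close>; a transition from the initial chart
  brings it into the arbitrary chart \<open>\<theta>\<close>.\<close>

lemma section_map_rational:
  assumes G: "G \<in> big_F"
  shows "rational_at \<B> big_F \<A> section_map G"
  unfolding rational_at_def
proof (intro allI impI)
  fix J \<theta> y assume "(J, \<theta>) \<in> \<A> \<and> y \<in> aff_space J \<and> \<theta> y = section_map G"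
  then have *: "(J, \<theta>) \<in> \<A>" "y \<in> aff_space J" "\<theta> y = section_map G" by auto
  let ?I = "fam_index {1..k} (\<lambda>l. {1..d l})" and ?\<psi> = "fam {1..k} (\<lambda>l. {1..d l})"
  obtain x where x: "x \<in> aff_space ?I" "G = ?\<psi> x" by (rule big_F_chart[OF G])
  have "?\<psi> x \<in> F" using G x(2) by (simp add: big_F_def)
  then have eq: "fam P initial (lift x) = \<theta> y" using *(3) section_map_chart x(2) by simp
  obtain h num where h: "h \<in> polyfuns (fam_index P initial)"
    "\<And>j. j \<in> J \<Longrightarrow> num j \<in> polyfuns (fam_index P initial)" "h (lift x) \<noteq> 0"
    "\<And>z. z \<in> aff_space (fam_index P initial) \<Longrightarrow> h z \<noteq> 0 \<Longrightarrow> fam P initial z = \<theta> (ratvec J num h z)"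
    by (rule good_atlas_transition[of \<A> "fam_index P initial" "fam P initial" J \<theta> "lift x" y,
          OF good_A initial_chart *(1) lift_aff_space *(2) eq]) (rule that)
  show "\<exists>I \<psi> x h num. (I, \<psi>) \<in> \<B> \<and> x \<in> aff_space I \<and> \<psi> x = G \<and> h \<in> polyfuns I \<and>
      (\<forall>j\<in>J. num j \<in> polyfuns I) \<and> h x \<noteq> 0 \<and>
      (\<forall>z\<in>aff_space I. h z \<noteq> 0 \<and> \<psi> z \<in> big_F \<longrightarrow> section_map (\<psi> z) = \<theta> (ratvec J num h z))"
  proof (intro exI[of _ ?I] exI[of _ ?\<psi>] exI[of _ x] exI[of _ "\<lambda>z. h (lift z)"]
      exI[of _ "\<lambda>j z. num j (lift z)"] conjI ballI impI)
    show "(\<lambda>z. h (lift z)) \<in> polyfuns ?I" by (rule polyfuns_compose[OF h(1) lift_polyfun])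
    show "(\<lambda>z. num j (lift z)) \<in> polyfuns ?I" if "j \<in> J" for j
      by (rule polyfuns_compose[OF h(2)[OF that] lift_polyfun])
    fix z assume z: "h (lift z) \<noteq> 0 \<and> ?\<psi> z \<in> big_F"
    then have "section_map (?\<psi> z) = fam P initial (lift z)"
      by (intro section_map_chart) (simp add: big_F_def)
    also have "\<dots> = \<theta> (ratvec J num h (lift z))" using z h(4)[OF lift_aff_space] by blast
    also have "ratvec J num h (lift z) = ratvec J (\<lambda>j z. num j (lift z)) (\<lambda>z. h (lift z)) z"
      by (simp add: ratvec_def)
    finally show "section_map (?\<psi> z) = \<theta> (ratvec J (\<lambda>j z. num j (lift z)) (\<lambda>z. h (lift z)) z)" .
  qed (use x h(3) diagonal_chart in auto)
qed

lemma forget_big_iso: "var_isomorphism \<A> big_R \<B> big_F forget"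
  unfolding var_isomorphism_def
proof (intro conjI exI[of _ section_map] ballI)
  have sub: "big_R \<subseteq> tower P" "big_F \<subseteq> F" by (auto simp: big_R_def big_F_def)
  show "var_morphism \<A> big_R \<B> big_F forget"
    using sub by (intro forget_morphism) (auto simp: big_R_iff)
  have inv: "section_map G \<in> big_R" if "G \<in> big_F" for G
    using section_map[of G] that by (simp add: big_R_iff big_F_def)
  show "var_morphism \<B> big_F \<A> big_R section_map"
    using sub tower_subset_atlas_points[OF P_tower_index] F_subset_atlas_points inv
    by (intro var_morphismI good_A good_B section_map_rational) auto
  show "forget (section_map G) = G" if "G \<in> big_F" for G
    using section_map[of G] that by (simp add: big_F_def)
  show "section_map (forget V) = V" if V: "V \<in> big_R" for V
  proof -
    have "forget V \<in> big_F" "V \<in> tower P" using V big_R_iff by auto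
    moreover obtain x where x: "forget V = fam {1..k} (\<lambda>l. {1..d l}) x"
      by (rule big_F_chart[OF \<open>forget V \<in> big_F\<close>]) (rule that)
    ultimately show ?thesis
      using big_cell_lift[of V x] section_map_chart[of x] by (simp add: big_F_def)
  qed
qed

lemma forget_birational: "birational_morphism \<A> (tower P) \<B> F forget"
  unfolding birational_morphism_def
  by (intro conjI exI[of _ big_R] exI[of _ big_F] forget_morphism big_R_open big_R_dense big_F_open
      big_F_dense forget_big_iso) (auto simp: deg_flag_eq_image)

end

text \<open>The two closedness statements ensure that \<open>R\<close> and \<open>F\<close> are
  closed subvarieties, since smoothness and desingularization are formulated for arbitrary
  subsets.\<close>

theorem proposition2p9:
  fixes scale :: "complex \<Rightarrow> 'w::ab_group_add \<Rightarrow> 'w"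
    and n k :: nat and w :: "nat \<Rightarrow> 'w" and d :: "nat \<Rightarrow> nat"
  assumes "based_vector_space scale n w"
    and "1 \<le> k" and "1 \<le> d 1" and "strict_mono_on {1..k} d" and "d k < n"
  defines "\<A> \<equiv> based_vector_space.R_ambient scale n w d k"
    and "R \<equiv> based_vector_space.R_variety scale n w d k"
    and "\<B> \<equiv> based_vector_space.deg_flag_ambient scale n w d k"
    and "F \<equiv> based_vector_space.deg_flag_variety scale n w d k"
  shows "closedin (zariski \<A>) R \<and> closedin (zariski \<B>) F \<and>
    smooth_variety \<A> R \<and>
    desingularization \<A> R \<B> F (based_vector_space.forget_off_diagonal d k)"
proof -
  interpret flag_type scale n w d k
    using assms(1-5) by (simp add: flag_type_def flag_type_axioms_def)
  have smooth: "smooth_variety \<A> R"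
    unfolding \<A>_def R_def R_ambient_eq R_variety_eq_tower by (rule tower_smooth[OF P_tower_index])
  have "closedin (zariski \<A>) R"
    unfolding \<A>_def R_def R_ambient_eq R_variety_eq_tower by (rule tower_closed[OF P_tower_index])
  moreover have "closedin (zariski \<B>) F"
    unfolding \<B>_def F_def deg_flag_ambient_eq by (rule F_closed)
  moreover have "proper_morphism \<A> R \<B> F forget" "birational_morphism \<A> R \<B> F forget"
    unfolding \<A>_def R_def \<B>_def F_def R_ambient_eq R_variety_eq_tower deg_flag_ambient_eq
    by (rule forget_proper, rule forget_birational)
  ultimately show ?thesis using smooth unfolding desingularization_def by blast
qed

end
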